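(* There exists a polynomial time algorithm which takes as input a graph $G = (V, E)$, vertex deletion costs $c:V\rightarrow\mathbb{R}_{\ge 0}$, a target density $\rho\in \mathbb{R}$, and an error parameter $\epsilon \in (0, 1/2)$, and returns a set $S\subseteq V$ such that: (1) $\lambda^*_{G - S} \leq \left(\frac{1}{1 - 2\epsilon}\right) \cdot \rho$, and (2) $\sum_{u\in S}c_u \leq \left(\frac{1}{\epsilon}\right) \cdot \mathrm{OPT}$, where $\mathrm{OPT}$ denotes the cost of an optimum solution to $\rho$-GraphDD on the instance $(G,c)$.
   Context: For a graph $G=(V,E)$, let $\lambda^*_G:=\max\{|E(S)|/|S|:\emptyset\ne S\subseteq V\}$, where $E(S)$ is the set of edges with both end vertices in $S$ (for a graph with no vertices any condition $\lambda^*_G\le\rho$ is considered to hold). The problem $\rho$-GraphDD is: given a graph $G=(V,E)$ and vertex costs $c:V\rightarrow\mathbb{R}_{\ge 0}$, find $S\subseteq V$ minimizing $\sum_{u\in S}c_u$ subject to $\lambda^*_{G-S}\le\rho$. *)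

theory Defs
  imports Complex_Main "HOL-Library.Log_Nat" "HOL-Computational_Algebra.Polynomial"
begin

section \<open>Graphs, density and the density deletion problem\<close>

text \<open>Finite simple undirected graphs, with natural numbers as vertex names.\<close>

definition graph :: "nat set \<Rightarrow> nat set set \<Rightarrow> bool" where
  "graph V E \<longleftrightarrow> finite V \<and> (\<forall>e\<in>E. e \<subseteq> V \<and> card e = 2)"

definition edges_within :: "nat set set \<Rightarrow> nat set \<Rightarrow> nat set set" where
  "edges_within E S = {e \<in> E. e \<subseteq> S}"

definition max_density :: "nat set \<Rightarrow> nat set set \<Rightarrow> real" where
  "max_density V E = Max {real (card (edges_within E S)) / real (card S) | S. S \<noteq> {} \<and> S \<subseteq> V}"

text \<open>For the graph without vertices the maximum above is over the empty set; every density bound,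
  including a negative one, is considered to hold for it.\<close>

definition density_at_most :: "nat set \<Rightarrow> nat set set \<Rightarrow> real \<Rightarrow> bool" where
  "density_at_most V E \<rho> \<longleftrightarrow> V = {} \<or> max_density V E \<le> \<rho>"

text \<open>The graph \<open>G - S\<close> has vertex set \<open>V - S\<close> and edge set \<open>edges_within E (V - S)\<close>.\<close>

definition density_after_deletion_at_most ::
    "nat set \<Rightarrow> nat set set \<Rightarrow> nat set \<Rightarrow> real \<Rightarrow> bool" where
  "density_after_deletion_at_most V E S \<rho> \<longleftrightarrow>
     density_at_most (V - S) (edges_within E (V - S)) \<rho>"

definition GraphDD_feasible :: "nat set \<Rightarrow> nat set set \<Rightarrow> real \<Rightarrow> nat set \<Rightarrow> bool" where
  "GraphDD_feasible V E \<rho> S \<longleftrightarrow> S \<subseteq> V \<and> density_after_deletion_at_most V E S \<rho>"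

definition GraphDD_OPT :: "nat set \<Rightarrow> nat set set \<Rightarrow> (nat \<Rightarrow> real) \<Rightarrow> real \<Rightarrow> real" where
  "GraphDD_OPT V E c \<rho> = Min {\<Sum>u\<in>S. c u | S. GraphDD_feasible V E \<rho> S}"

lemma GraphDD_OPT_attained:
  assumes "finite V"
  shows "finite {\<Sum>u\<in>S. c u | S. GraphDD_feasible V E \<rho> S}"
    and "{\<Sum>u\<in>S. c u | S. GraphDD_feasible V E \<rho> S} \<noteq> {}"
proof -
  have "{\<Sum>u\<in>S. c u | S. GraphDD_feasible V E \<rho> S} \<subseteq> sum c ` Pow V"
    by (auto simp: GraphDD_feasible_def)
  then show "finite {\<Sum>u\<in>S. c u | S. GraphDD_feasible V E \<rho> S}"
    using assms by (meson finite_Pow_iff finite_imageI finite_subset)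
  have "GraphDD_feasible V E \<rho> V"
    by (simp add: GraphDD_feasible_def density_after_deletion_at_most_def density_at_most_def)
  then show "{\<Sum>u\<in>S. c u | S. GraphDD_feasible V E \<rho> S} \<noteq> {}"
    by blast
qed

section \<open>The model of computation\<close>

text \<open>
  A random access machine over the naturals and the reals, programmed by while-programs.
  A program uses finitely many named arrays of natural numbers, which may be used as addresses,
  and finitely many named arrays of reals; a scalar is an array used at index 0 only.
  The real operations are \<open>+\<close>, \<open>-\<close>, \<open>*\<close>, \<open>/\<close>, comparison, and the embedding of the naturals;
  there is no rounding, so no information flows from reals to naturals except by comparisons.
  Subtraction of naturals is truncated and division by zero yields zero, as usual in HOL.
\<close>

type_synonym state = "(string \<Rightarrow> nat \<Rightarrow> nat) \<times> (string \<Rightarrow> nat \<Rightarrow> real)"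

datatype nexp =
    NConst nat
  | NGet string nexp
  | NAdd nexp nexp
  | NSub nexp nexp
  | NMul nexp nexp

datatype rexp =
    ROfNat nexp
  | RGet string nexp
  | RAdd rexp rexp
  | RSub rexp rexp
  | RMul rexp rexp
  | RDiv rexp rexp

datatype bexp =
    NLe nexp nexp
  | RLe rexp rexp
  | BNot bexp
  | BAnd bexp bexp

datatype com =
    Skip
  | NSet string nexp nexp
  | RSet string nexp rexp
  | Seq com com
  | If bexp com com
  | While bexp com

fun nval :: "nexp \<Rightarrow> state \<Rightarrow> nat" where
  "nval (NConst k) s = k"
| "nval (NGet a i) s = fst s a (nval i s)"
| "nval (NAdd e f) s = nval e s + nval f s"
| "nval (NSub e f) s = nval e s - nval f s"
| "nval (NMul e f) s = nval e s * nval f s"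

fun rval :: "rexp \<Rightarrow> state \<Rightarrow> real" where
  "rval (ROfNat e) s = real (nval e s)"
| "rval (RGet a i) s = snd s a (nval i s)"
| "rval (RAdd e f) s = rval e s + rval f s"
| "rval (RSub e f) s = rval e s - rval f s"
| "rval (RMul e f) s = rval e s * rval f s"
| "rval (RDiv e f) s = rval e s / rval f s"

fun bval :: "bexp \<Rightarrow> state \<Rightarrow> bool" where
  "bval (NLe e f) s \<longleftrightarrow> nval e s \<le> nval f s"
| "bval (RLe e f) s \<longleftrightarrow> rval e s \<le> rval f s"
| "bval (BNot b) s \<longleftrightarrow> \<not> bval b s"
| "bval (BAnd b d) s \<longleftrightarrow> bval b s \<and> bval d s"

text \<open>
  Every operation is charged the sizes of its operands and of its result: the cost of an expression
  is the sum of the sizes of the values of all its subexpressions. Naturals (hence also addresses)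
  are always charged their binary length, i.e. the logarithmic cost criterion. The size of
  a real is a parameter \<open>sz\<close>, with two instances: \<open>unit_size\<close> yields the real RAM with
  unit cost arithmetic on reals; \<open>bit_size\<close>, meaningful for rational data only, yields the
  logarithmic cost criterion for fractions in lowest terms, for which polynomial time coincides
  with polynomial time on Turing machines.
\<close>

definition nat_size :: "nat \<Rightarrow> nat" where
  "nat_size k = 1 + floorlog 2 k"

definition unit_size :: "real \<Rightarrow> nat" where
  "unit_size x = 1"

definition bit_size :: "real \<Rightarrow> nat" where
  "bit_size x = (case quotient_of (THE r. x = real_of_rat r) of
     (p, q) \<Rightarrow> 1 + floorlog 2 (nat \<bar>p\<bar>) + floorlog 2 (nat q))"

fun ncost :: "nexp \<Rightarrow> state \<Rightarrow> nat" where
  "ncost (NConst k) s = nat_size k"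
| "ncost (NGet a i) s = ncost i s + nat_size (nval (NGet a i) s)"
| "ncost (NAdd e f) s = ncost e s + ncost f s + nat_size (nval (NAdd e f) s)"
| "ncost (NSub e f) s = ncost e s + ncost f s + nat_size (nval (NSub e f) s)"
| "ncost (NMul e f) s = ncost e s + ncost f s + nat_size (nval (NMul e f) s)"

fun rcost :: "(real \<Rightarrow> nat) \<Rightarrow> rexp \<Rightarrow> state \<Rightarrow> nat" where
  "rcost sz (ROfNat e) s = ncost e s + sz (rval (ROfNat e) s)"
| "rcost sz (RGet a i) s = ncost i s + sz (rval (RGet a i) s)"
| "rcost sz (RAdd e f) s = rcost sz e s + rcost sz f s + sz (rval (RAdd e f) s)"
| "rcost sz (RSub e f) s = rcost sz e s + rcost sz f s + sz (rval (RSub e f) s)"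
| "rcost sz (RMul e f) s = rcost sz e s + rcost sz f s + sz (rval (RMul e f) s)"
| "rcost sz (RDiv e f) s = rcost sz e s + rcost sz f s + sz (rval (RDiv e f) s)"

fun bcost :: "(real \<Rightarrow> nat) \<Rightarrow> bexp \<Rightarrow> state \<Rightarrow> nat" where
  "bcost sz (NLe e f) s = ncost e s + ncost f s + 1"
| "bcost sz (RLe e f) s = rcost sz e s + rcost sz f s + 1"
| "bcost sz (BNot b) s = bcost sz b s + 1"
| "bcost sz (BAnd b d) s = bcost sz b s + bcost sz d s + 1"

text \<open>\<open>exec sz P s t s'\<close>: program \<open>P\<close> started in \<open>s\<close> halts in \<open>s'\<close>, at total cost \<open>t\<close>.\<close>

inductive exec :: "(real \<Rightarrow> nat) \<Rightarrow> com \<Rightarrow> state \<Rightarrow> nat \<Rightarrow> state \<Rightarrow> bool" for sz where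
  Skip: "exec sz Skip s 1 s"
| NSet: "exec sz (NSet a i e) s (ncost i s + ncost e s + 1)
           ((fst s)(a := (fst s a)(nval i s := nval e s)), snd s)"
| RSet: "exec sz (RSet a i e) s (ncost i s + rcost sz e s + 1)
           (fst s, (snd s)(a := (snd s a)(nval i s := rval e s)))"
| Seq: "exec sz P s t s' \<Longrightarrow> exec sz Q s' t' s'' \<Longrightarrow> exec sz (Seq P Q) s (t + t' + 1) s''"
| IfTrue: "bval b s \<Longrightarrow> exec sz P s t s' \<Longrightarrow> exec sz (If b P Q) s (bcost sz b s + t + 1) s'"
| IfFalse: "\<not> bval b s \<Longrightarrow> exec sz Q s t s' \<Longrightarrow> exec sz (If b P Q) s (bcost sz b s + t + 1) s'"
| WhileFalse: "\<not> bval b s \<Longrightarrow> exec sz (While b P) s (bcost sz b s + 1) s"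
| WhileTrue: "bval b s \<Longrightarrow> exec sz P s t s' \<Longrightarrow> exec sz (While b P) s' t' s'' \<Longrightarrow>
    exec sz (While b P) s (bcost sz b s + t + t' + 1) s''"

definition halts_within :: "(real \<Rightarrow> nat) \<Rightarrow> com \<Rightarrow> state \<Rightarrow> nat \<Rightarrow> state \<Rightarrow> bool" where
  "halts_within sz P s T s' \<longleftrightarrow> (\<exists>t\<le>T. exec sz P s t s')"

inductive_cases SkipE: "exec sz Skip s t s'"
inductive_cases NSetE: "exec sz (NSet a i e) s t s'"
inductive_cases RSetE: "exec sz (RSet a i e) s t s'"
inductive_cases SeqE: "exec sz (Seq P Q) s t s'"
inductive_cases IfE: "exec sz (If b P Q) s t s'"
inductive_cases WhileE: "exec sz (While b P) s t s'"

text \<open>Programs are deterministic, and the size measure influences the cost but not the result.\<close>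

lemma exec_deterministic:
  "exec sz P s t s' \<Longrightarrow> exec sz' P s u s'' \<Longrightarrow> s' = s''"
proof (induction arbitrary: u s'' rule: exec.induct)
  case Skip then show ?case by (auto elim: SkipE)
next
  case NSet then show ?case by (auto elim: NSetE)
next
  case RSet then show ?case by (auto elim: RSetE)
next
  case Seq from Seq.prems show ?case by (rule SeqE) (use Seq.IH in blast)
next
  case IfTrue from IfTrue.prems show ?case by (rule IfE) (use IfTrue in blast)+
next
  case IfFalse from IfFalse.prems show ?case by (rule IfE) (use IfFalse in blast)+
next
  case WhileFalse from WhileFalse.prems show ?case by (rule WhileE) (use WhileFalse in blast)+
next
  case WhileTrue from WhileTrue.prems show ?case by (rule WhileE) (use WhileTrue in blast)+
qed

section \<open>Instances as machine inputs\<close>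

text \<open>The graph is presented by a repetition-free list of its vertices and a repetition-free list of
  its edges, in any order, where the two ends of an edge come in either order.\<close>

definition presents ::
    "nat list \<Rightarrow> (nat \<times> nat) list \<Rightarrow> nat set \<Rightarrow> nat set set \<Rightarrow> bool" where
  "presents vs es V E \<longleftrightarrow>
     distinct vs \<and> set vs = V \<and>
     distinct (map (\<lambda>(u, v). {u, v}) es) \<and> set (map (\<lambda>(u, v). {u, v}) es) = E"

text \<open>The cost array is indexed by vertex names. All memory not mentioned is initially zero.\<close>

definition input_state ::
    "nat list \<Rightarrow> (nat \<times> nat) list \<Rightarrow> (nat \<Rightarrow> real) \<Rightarrow> real \<Rightarrow> real \<Rightarrow> state" where
  "input_state vs es c \<rho> \<epsilon> =
    ((\<lambda>a i. if a = ''n'' \<and> i = 0 then length vs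
            else if a = ''m'' \<and> i = 0 then length es
            else if a = ''vertex'' \<and> i < length vs then vs ! i
            else if a = ''end1'' \<and> i < length es then fst (es ! i)
            else if a = ''end2'' \<and> i < length es then snd (es ! i)
            else 0),
     (\<lambda>a i. if a = ''rho'' \<and> i = 0 then \<rho>
            else if a = ''eps'' \<and> i = 0 then \<epsilon>
            else if a = ''cost'' \<and> i \<in> set vs then c i
            else 0))"

definition input_size ::
    "(real \<Rightarrow> nat) \<Rightarrow> nat list \<Rightarrow> (nat \<times> nat) list \<Rightarrow> (nat \<Rightarrow> real) \<Rightarrow> real \<Rightarrow> real \<Rightarrow> nat" where
  "input_size sz vs es c \<rho> \<epsilon> =
     nat_size (length vs) + nat_size (length es) +
     (\<Sum>v\<leftarrow>vs. nat_size v + sz (c v)) + (\<Sum>(u, v)\<leftarrow>es. nat_size u + nat_size v) +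
     sz \<rho> + sz \<epsilon>"

text \<open>The returned set is read off its characteristic vector, indexed by vertex names.\<close>

definition returned_set :: "nat set \<Rightarrow> state \<Rightarrow> nat set" where
  "returned_set V s = {v \<in> V. fst s ''out'' v = 1}"

end

theory Submission
  imports Defs
begin

text \<open>
  The algorithm is a local ratio algorithm. As long as the remaining graph contains a vertex set
  \<open>W\<close> with \<open>(1 - 2\<epsilon>) |E(W)| > \<rho> |W|\<close>, subtract from the costs the largest multiple of the degrees
  in \<open>G[W]\<close> that keeps them nonnegative, and delete a vertex whose cost became zero. The degrees
  of any vertex set sum up to at most \<open>2 |E(W)|\<close>, whereas every solution \<open>S\<close> destroys at least
  \<open>|E(W)| - \<rho> |W| \<ge> 2\<epsilon> |E(W)|\<close> edges of \<open>W\<close>, so each subtraction is within the ratio \<open>1/\<epsilon>\<close>.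

  A densest set is found by balancing: every edge consists of \<open>b > n\<^sup>3\<close> tokens, each assigned to
  one of its ends, and a token is moved to the other end as long as this end has at least two
  tokens less. Each move decreases the sum of the squared loads, so few passes over the edges
  suffice; afterwards some set of the form \<open>{v. load v \<ge> t}\<close> is a densest one.

  Neither the number of steps nor the result depends on the sizes of the reals, so the real RAM
  and the bit model are treated together. In the bit model the costs stay fractions of
  polynomial size, because each subtraction multiplies their common denominator by a degree.
\<close>

section \<open>Weakest preconditions with implicit polynomial running time\<close>

text \<open>Two obstacles shape the proof. The machine charges operand sizes, so running time is
  certified relative to one number \<open>B\<close> that bounds the sizes of all cells and the
  lengths of all loops: the time is then a polynomial in \<open>B\<close> read off the syntax, and
  only size bounds remain to be shown. The delicate sizes are those of the costs: the general size
  bound for a subtraction at least doubles, hence would grow exponentially over the rounds. It is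
  replaced by an invariant of the cost vector as a whole, combined with the fact that costs stay
  between 0 and their original values.

  Balancing takes the place of a linear program or a flow computation. Token loads are a fractional
  orientation of the edges, that is, a dual solution whose maximum bounds every density; approximate
  optimality is enough because densities are separated. This search uses naturals of polynomial
  magnitude only; \<rho> and \<epsilon> enter in a single final comparison.

  The estimate of the edges destroyed by a solution relies on \<rho> \<ge> 0. For \<rho> < 0 every
  vertex must be deleted, a case that the program treats separately.\<close>

fun nval_coeff :: "nexp \<Rightarrow> nat" where
  "nval_coeff (NConst k) = nat_size k"
| "nval_coeff (NGet a i) = 1"
| "nval_coeff (NAdd e f) = nval_coeff e + nval_coeff f"
| "nval_coeff (NSub e f) = nval_coeff e"
| "nval_coeff (NMul e f) = nval_coeff e + nval_coeff f"

fun ncost_coeff :: "nexp \<Rightarrow> nat" where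
  "ncost_coeff (NConst k) = nat_size k"
| "ncost_coeff (NGet a i) = ncost_coeff i + 1"
| "ncost_coeff (NAdd e f) = ncost_coeff e + ncost_coeff f + nval_coeff (NAdd e f)"
| "ncost_coeff (NSub e f) = ncost_coeff e + ncost_coeff f + nval_coeff (NSub e f)"
| "ncost_coeff (NMul e f) = ncost_coeff e + ncost_coeff f + nval_coeff (NMul e f)"

fun rval_coeff :: "rexp \<Rightarrow> nat" where
  "rval_coeff (ROfNat e) = 2 * nval_coeff e"
| "rval_coeff (RGet a i) = 1"
| "rval_coeff (RAdd e f) = 2 * (rval_coeff e + rval_coeff f)"
| "rval_coeff (RSub e f) = 2 * (rval_coeff e + rval_coeff f)"
| "rval_coeff (RMul e f) = 2 * (rval_coeff e + rval_coeff f)"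
| "rval_coeff (RDiv e f) = 2 * (rval_coeff e + rval_coeff f)"

fun rcost_coeff :: "rexp \<Rightarrow> nat" where
  "rcost_coeff (ROfNat e) = ncost_coeff e + rval_coeff (ROfNat e)"
| "rcost_coeff (RGet a i) = ncost_coeff i + 1"
| "rcost_coeff (RAdd e f) = rcost_coeff e + rcost_coeff f + rval_coeff (RAdd e f)"
| "rcost_coeff (RSub e f) = rcost_coeff e + rcost_coeff f + rval_coeff (RSub e f)"
| "rcost_coeff (RMul e f) = rcost_coeff e + rcost_coeff f + rval_coeff (RMul e f)"
| "rcost_coeff (RDiv e f) = rcost_coeff e + rcost_coeff f + rval_coeff (RDiv e f)"

fun bcost_coeff :: "bexp \<Rightarrow> nat" where
  "bcost_coeff (NLe e f) = ncost_coeff e + ncost_coeff f + 1"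
| "bcost_coeff (RLe e f) = rcost_coeff e + rcost_coeff f + 1"
| "bcost_coeff (BNot b) = bcost_coeff b + 1"
| "bcost_coeff (BAnd b d) = bcost_coeff b + bcost_coeff d + 1"

text \<open>The argument of the polynomial is a common bound on the sizes of all memory cells and
  on the number of iterations of every loop.\<close>

fun time_poly :: "com \<Rightarrow> nat poly" where
  "time_poly Skip = 1"
| "time_poly (NSet a i e) = [:1, ncost_coeff i + ncost_coeff e:]"
| "time_poly (RSet a i e) = [:1, ncost_coeff i + rcost_coeff e:]"
| "time_poly (Seq P Q) = time_poly P + time_poly Q + 1"
| "time_poly (If b P Q) = [:1, bcost_coeff b:] + time_poly P + time_poly Q"
| "time_poly (While b P) = [:0, 1:] * ([:1, bcost_coeff b:] + time_poly P) + [:1, bcost_coeff b:]"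

fun nat_writes :: "com \<Rightarrow> string set" where
  "nat_writes Skip = {}"
| "nat_writes (NSet a i e) = {a}"
| "nat_writes (RSet a i e) = {}"
| "nat_writes (Seq P Q) = nat_writes P \<union> nat_writes Q"
| "nat_writes (If b P Q) = nat_writes P \<union> nat_writes Q"
| "nat_writes (While b P) = nat_writes P"

fun real_writes :: "com \<Rightarrow> string set" where
  "real_writes Skip = {}"
| "real_writes (NSet a i e) = {}"
| "real_writes (RSet a i e) = {a}"
| "real_writes (Seq P Q) = real_writes P \<union> real_writes Q"
| "real_writes (If b P Q) = real_writes P \<union> real_writes Q"
| "real_writes (While b P) = real_writes P"

section \<open>Frame conditions and state updates\<close>

definition agree_off :: "string set \<Rightarrow> string set \<Rightarrow> state \<Rightarrow> state \<Rightarrow> bool" where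
  "agree_off X Y s s' \<longleftrightarrow> (\<forall>a. a \<notin> X \<longrightarrow> fst s' a = fst s a) \<and> (\<forall>a. a \<notin> Y \<longrightarrow> snd s' a = snd s a)"

lemma exec_agree_off: "exec sz P s t s' \<Longrightarrow> agree_off (nat_writes P) (real_writes P) s s'"
  by (induction rule: exec.induct) (auto simp: agree_off_def)

definition nset :: "string \<Rightarrow> nat \<Rightarrow> nat \<Rightarrow> state \<Rightarrow> state" where
  "nset a i v s = ((fst s)(a := (fst s a)(i := v)), snd s)"

definition rset :: "string \<Rightarrow> nat \<Rightarrow> real \<Rightarrow> state \<Rightarrow> state" where
  "rset a i v s = (fst s, (snd s)(a := (snd s a)(i := v)))"

lemma nset_simps [simp]:
  "fst (nset a i v s) = (fst s)(a := (fst s a)(i := v))" "snd (nset a i v s) = snd s"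
  by (auto simp: nset_def)

lemma rset_simps [simp]:
  "fst (rset a i v s) = fst s" "snd (rset a i v s) = (snd s)(a := (snd s a)(i := v))"
  by (auto simp: rset_def)

abbreviation scalar :: "string \<Rightarrow> nexp" where
  "scalar a \<equiv> NGet a (NConst 0)"

definition For :: "string \<Rightarrow> string \<Rightarrow> com \<Rightarrow> com" where
  "For i h P = Seq (NSet i (NConst 0) (NConst 0))
     (While (NLe (NAdd (scalar i) (NConst 1)) (scalar h))
       (Seq P (NSet i (NConst 0) (NAdd (scalar i) (NConst 1)))))"

lemma writes_For [simp]:
  "nat_writes (For i h P) = insert i (nat_writes P)" "real_writes (For i h P) = real_writes P"
  by (auto simp: For_def)

section \<open>Binary lengths of sums and products\<close>

lemma floorlog_le_if_less_power: "k < 2 ^ a \<Longrightarrow> floorlog 2 k \<le> a"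
  by (cases "k = 0") (simp_all add: floorlog_leI)

lemma less_power_floorlog: "k < 2 ^ floorlog 2 k"
  by (cases "k = 0") (auto simp: floorlog_bounds)

lemma nat_size_pos: "1 \<le> nat_size k"
  by (simp add: nat_size_def)

lemma nat_size_le_Suc: "nat_size k \<le> k + 1"
  using floorlog_le_if_less_power[of k k] less_exp[of k] by (simp add: nat_size_def)

lemma nat_size_mono: "k \<le> l \<Longrightarrow> nat_size k \<le> nat_size l"
  by (simp add: nat_size_def floorlog_mono)

lemma nat_size_add: "nat_size (k + l) \<le> nat_size k + nat_size l"
proof -
  have "k < 2 ^ (floorlog 2 k + floorlog 2 l)" "l < 2 ^ (floorlog 2 k + floorlog 2 l)"
    using less_power_floorlog[of k] less_power_floorlog[of l]
    by (meson le_add1 le_add2 less_le_trans one_le_numeral power_increasing)+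
  then have "k + l < 2 ^ (floorlog 2 k + floorlog 2 l + 1)" by simp
  from floorlog_le_if_less_power[OF this] show ?thesis by (simp add: nat_size_def)
qed

lemma nat_size_mult: "nat_size (k * l) \<le> nat_size k + nat_size l"
proof -
  have "k * l < 2 ^ (floorlog 2 k + floorlog 2 l)"
    unfolding power_add by (intro mult_strict_mono' less_power_floorlog) auto
  from floorlog_le_if_less_power[OF this] show ?thesis by (simp add: nat_size_def)
qed

text \<open>\<open>good\<close> is the set of all reals under unit cost and the set of rationals
  under bit cost. The factors 2 absorb the growth of a sum of fractions, where both denominators
  enter the new numerator as well, and the denominator 1 of an embedded natural.\<close>

locale bounded_machine =
  fixes sz :: "real \<Rightarrow> nat" and good :: "real set" and B :: nat
  assumes B_pos: "1 \<le> B"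
    and good_of_nat: "real k \<in> good"
    and good_ops: "x \<in> good \<Longrightarrow> y \<in> good \<Longrightarrow>
      x + y \<in> good \<and> x - y \<in> good \<and> x * y \<in> good \<and> x / y \<in> good"
    and sz_of_nat: "sz (real k) \<le> 2 * nat_size k"
    and sz_ops: "x \<in> good \<Longrightarrow> y \<in> good \<Longrightarrow>
      sz (x + y) \<le> 2 * (sz x + sz y) \<and> sz (x - y) \<le> 2 * (sz x + sz y) \<and>
      sz (x * y) \<le> 2 * (sz x + sz y) \<and> sz (x / y) \<le> 2 * (sz x + sz y)"
begin

definition bnd :: "state \<Rightarrow> bool" where
  "bnd s \<longleftrightarrow> (\<forall>a i. nat_size (fst s a i) \<le> B) \<and> (\<forall>a i. snd s a i \<in> good \<and> sz (snd s a i) \<le> B)"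

lemma bnd_cell: "bnd s \<Longrightarrow> nat_size (fst s a i) \<le> B"
  by (simp add: bnd_def)

lemma bnd_rcell: "bnd s \<Longrightarrow> snd s a i \<in> good \<and> sz (snd s a i) \<le> B"
  by (simp add: bnd_def)

lemma coeff_B: "k \<le> k * B"
  using B_pos by simp

lemma nval_size: "bnd s \<Longrightarrow> nat_size (nval e s) \<le> nval_coeff e * B"
proof (induction e)
  case (NConst x) then show ?case by (simp add: coeff_B)
next
  case (NGet x1 e) then show ?case by (simp add: bnd_cell)
next
  case (NAdd e f)
  then show ?case using nat_size_add[of "nval e s" "nval f s"] by (simp add: algebra_simps)
next
  case (NSub e f)
  then show ?case using nat_size_mono[of "nval e s - nval f s" "nval e s"] by simp
next
  case (NMul e f)
  then show ?case using nat_size_mult[of "nval e s" "nval f s"] by (simp add: algebra_simps)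
qed

lemma ncost_le: "bnd s \<Longrightarrow> ncost e s \<le> ncost_coeff e * B"
proof (induction e)
  case (NConst x) then show ?case by (simp add: coeff_B)
next
  case (NGet a e)
  then show ?case using bnd_cell[of s a "nval e s"] by (simp add: algebra_simps)
next
  case (NAdd e f)
  then show ?case using nval_size[of s "NAdd e f"] by (simp add: algebra_simps)
next
  case (NSub e f)
  then show ?case using nval_size[of s "NSub e f"] by (simp add: algebra_simps)
next
  case (NMul e f)
  then show ?case using nval_size[of s "NMul e f"] by (simp add: algebra_simps)
qed

lemma rval_size: "bnd s \<Longrightarrow> rval e s \<in> good \<and> sz (rval e s) \<le> rval_coeff e * B"
proof (induction e)
  case (ROfNat x)
  then show ?case
    using sz_of_nat[of "nval x s"] nval_size[of s x] good_of_nat[of "nval x s"] by simp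
next
  case (RGet a e) then show ?case by (simp add: bnd_rcell)
next
  case (RAdd e f)
  then show ?case using good_ops sz_ops[of "rval e s" "rval f s"] by (simp add: algebra_simps)
next
  case (RSub e f)
  then show ?case using good_ops sz_ops[of "rval e s" "rval f s"] by (simp add: algebra_simps)
next
  case (RMul e f)
  then show ?case using good_ops sz_ops[of "rval e s" "rval f s"] by (simp add: algebra_simps)
next
  case (RDiv e f)
  then show ?case using good_ops sz_ops[of "rval e s" "rval f s"] by (simp add: algebra_simps)
qed

lemma rcost_le: "bnd s \<Longrightarrow> rcost sz e s \<le> rcost_coeff e * B"
proof (induction e)
  case (ROfNat x)
  then show ?case using ncost_le[of s x] rval_size[of s "ROfNat x"] by (simp add: algebra_simps)
next
  case (RGet a e)
  then show ?case using ncost_le[of s e] bnd_rcell[of s a "nval e s"] by (simp add: algebra_simps)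
next
  case (RAdd e f)
  then show ?case using rval_size[of s "RAdd e f"] by (simp add: algebra_simps)
next
  case (RSub e f)
  then show ?case using rval_size[of s "RSub e f"] by (simp add: algebra_simps)
next
  case (RMul e f)
  then show ?case using rval_size[of s "RMul e f"] by (simp add: algebra_simps)
next
  case (RDiv e f)
  then show ?case using rval_size[of s "RDiv e f"] by (simp add: algebra_simps)
qed

lemma bcost_le: "bnd s \<Longrightarrow> bcost sz b s \<le> bcost_coeff b * B"
proof (induction b)
  case (NLe e f)
  then show ?case using ncost_le[of s e] ncost_le[of s f] B_pos by (simp add: algebra_simps)
next
  case (RLe e f)
  then show ?case using rcost_le[of s e] rcost_le[of s f] B_pos by (simp add: algebra_simps)
qed (use B_pos in \<open>auto simp: algebra_simps\<close>)

text \<open>The size bound is part of the predicate on both sides, so assertions never mention it;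
  only writes have to show that the new value is small. The existence of an execution includes
  termination, and by determinism there is no other result.\<close>

definition wp :: "com \<Rightarrow> (state \<Rightarrow> bool) \<Rightarrow> state \<Rightarrow> bool" where
  "wp P Q s \<longleftrightarrow> (bnd s \<longrightarrow>
     (\<exists>t s'. exec sz P s t s' \<and> t \<le> poly (time_poly P) B \<and> bnd s' \<and> Q s'))"

lemma wp_Skip: "Q s \<Longrightarrow> wp Skip Q s"
proof -
  assume "Q s"
  moreover have "1 \<le> poly (time_poly Skip) B" by simp
  ultimately show ?thesis unfolding wp_def using exec.Skip[of sz s] by blast
qed

lemma wp_NSet:
  assumes "bnd s \<Longrightarrow> nat_size (nval e s) \<le> B" and "Q (nset a (nval i s) (nval e s) s)"
  shows "wp (NSet a i e) Q s"
  unfolding wp_def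
proof
  assume b: "bnd s"
  have "exec sz (NSet a i e) s (ncost i s + ncost e s + 1) (nset a (nval i s) (nval e s) s)"
    unfolding nset_def by (rule exec.NSet)
  moreover have "ncost i s + ncost e s + 1 \<le> poly (time_poly (NSet a i e)) B"
    using ncost_le[OF b, of i] ncost_le[OF b, of e] by (simp add: algebra_simps)
  moreover have "bnd (nset a (nval i s) (nval e s) s)"
    using b assms(1) by (auto simp: bnd_def)
  ultimately show "\<exists>t s'. exec sz (NSet a i e) s t s' \<and> t \<le> poly (time_poly (NSet a i e)) B \<and> bnd s' \<and> Q s'"
    using assms(2) by blast
qed

lemma wp_RSet:
  assumes "bnd s \<Longrightarrow> rval e s \<in> good \<and> sz (rval e s) \<le> B" and "Q (rset a (nval i s) (rval e s) s)"
  shows "wp (RSet a i e) Q s"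
  unfolding wp_def
proof
  assume b: "bnd s"
  have "exec sz (RSet a i e) s (ncost i s + rcost sz e s + 1) (rset a (nval i s) (rval e s) s)"
    unfolding rset_def by (rule exec.RSet)
  moreover have "ncost i s + rcost sz e s + 1 \<le> poly (time_poly (RSet a i e)) B"
    using ncost_le[OF b, of i] rcost_le[OF b, of e] by (simp add: algebra_simps)
  moreover have "bnd (rset a (nval i s) (rval e s) s)"
    using b assms(1) by (auto simp: bnd_def)
  ultimately show "\<exists>t s'. exec sz (RSet a i e) s t s' \<and> t \<le> poly (time_poly (RSet a i e)) B \<and> bnd s' \<and> Q s'"
    using assms(2) by blast
qed

lemma wp_Seq: "wp P (wp P' Q) s \<Longrightarrow> wp (Seq P P') Q s"
  unfolding wp_def
proof
  assume *: "bnd s \<longrightarrow> (\<exists>t s'. exec sz P s t s' \<and> t \<le> poly (time_poly P) B \<and> bnd s' \<and>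
    (bnd s' \<longrightarrow> (\<exists>t s''. exec sz P' s' t s'' \<and> t \<le> poly (time_poly P') B \<and> bnd s'' \<and> Q s'')))"
    and "bnd s"
  then obtain t s' t' s'' where t: "exec sz P s t s'" "t \<le> poly (time_poly P) B"
    "exec sz P' s' t' s''" "t' \<le> poly (time_poly P') B" "bnd s''" "Q s''" by blast
  have "t + t' + 1 \<le> poly (time_poly (Seq P P')) B" using t by simp
  with exec.Seq[OF t(1,3)] t show "\<exists>t s'. exec sz (Seq P P') s t s' \<and>
    t \<le> poly (time_poly (Seq P P')) B \<and> bnd s' \<and> Q s'" by blast
qed

lemma wp_If:
  assumes "bval b s \<Longrightarrow> wp P Q s" and "\<not> bval b s \<Longrightarrow> wp P' Q s"
  shows "wp (If b P P') Q s"
  unfolding wp_def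
proof
  assume b: "bnd s"
  show "\<exists>t s'. exec sz (If b P P') s t s' \<and> t \<le> poly (time_poly (If b P P')) B \<and> bnd s' \<and> Q s'"
  proof (cases "bval b s")
    case True
    with assms(1) b obtain t s' where t: "exec sz P s t s'" "t \<le> poly (time_poly P) B" "bnd s'" "Q s'"
      unfolding wp_def by blast
    have "bcost sz b s + t + 1 \<le> poly (time_poly (If b P P')) B"
      using t(2) bcost_le[OF b, of b] by (simp add: algebra_simps)
    with t exec.IfTrue[OF True t(1)] show ?thesis by blast
  next
    case False
    with assms(2) b obtain t s' where t: "exec sz P' s t s'" "t \<le> poly (time_poly P') B" "bnd s'" "Q s'"
      unfolding wp_def by blast
    have "bcost sz b s + t + 1 \<le> poly (time_poly (If b P P')) B"
      using t(2) bcost_le[OF b, of b] by (simp add: algebra_simps)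
    with t exec.IfFalse[OF False t(1)] show ?thesis by blast
  qed
qed

text \<open>The frame condition follows from the write sets alone, so it can be added to any
  postcondition, and loop invariants need not carry unchanged arrays.\<close>

lemma wp_frame:
  "wp P (\<lambda>s'. agree_off (nat_writes P) (real_writes P) s s' \<longrightarrow> Q s') s \<Longrightarrow> wp P Q s"
  unfolding wp_def using exec_agree_off by blast

lemma wp_mono: "wp P Q s \<Longrightarrow> (\<And>s'. Q s' \<Longrightarrow> Q' s') \<Longrightarrow> wp P Q' s"
  unfolding wp_def by blast

lemma wp_conseq:
  assumes "wp P Q s"
    and "\<And>s'. Q s' \<Longrightarrow> agree_off (nat_writes P) (real_writes P) s s' \<Longrightarrow> Q' s'"
  shows "wp P Q' s"
  by (rule wp_frame, rule wp_mono[OF assms(1)]) (use assms(2) in blast)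

text \<open>The condition \<open>N + 1 \<le> B\<close> serves twice: the counter, which ends at
  \<open>N\<close>, fits into a cell, and \<open>N\<close> iterations are paid for by the factor
  \<open>B\<close> in \<open>time_poly\<close>. The step may use the frame relative to the start of
  the loop.\<close>

lemma wp_For:
  assumes ni: "i \<notin> nat_writes P" and nh: "h \<notin> nat_writes P" "h \<noteq> i"
    and N: "fst s h 0 = N" "N + 1 \<le> B"
    and J0: "J 0 (nset i 0 0 s)"
    and step: "\<And>k s'. k < N \<Longrightarrow> J k s' \<Longrightarrow> agree_off (insert i (nat_writes P)) (real_writes P) s s' \<Longrightarrow>
      fst s' i 0 = k \<Longrightarrow> wp P (\<lambda>s''. J (k + 1) (nset i 0 (k + 1) s'')) s'"
  shows "wp (For i h P) (J N) s"
proof -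
  define g where "g = NLe (NAdd (scalar i) (NConst 1)) (scalar h)"
  define P' where "P' = Seq P (NSet i (NConst 0) (NAdd (scalar i) (NConst 1)))"
  define it where "it = bcost_coeff g * B + poly (time_poly P') B + 1"
  let ?A = "agree_off (insert i (nat_writes P)) (real_writes P) s"
  \<comment> \<open>Here \<open>d\<close> is the number of remaining iterations, \<open>it\<close>
    the price of one of them, and the last summand pays for the failing test.\<close>
  have loop: "\<exists>t s'. exec sz (While g P') s1 t s' \<and> t \<le> d * it + (bcost_coeff g * B + 1) \<and> bnd s' \<and> J N s'"
    if "k \<le> N" "d = N - k" "J k s1" "?A s1" "fst s1 i 0 = k" "bnd s1" for k d s1
    using that
  proof (induction d arbitrary: k s1)
    case 0
    then have "k = N" by simp
    moreover have "fst s1 h 0 = N" using 0 nh N(1) by (simp add: agree_off_def)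
    ultimately have "\<not> bval g s1" using 0 by (simp add: g_def)
    from exec.WhileFalse[OF this, of sz P'] show ?case using bcost_le[of s1 g] 0 \<open>k = N\<close> by fastforce
  next
    case (Suc d)
    then have k: "k < N" by simp
    have h: "fst s1 h 0 = N" using Suc.prems nh N(1) by (simp add: agree_off_def)
    have gt: "bval g s1" using Suc.prems k h by (simp add: g_def)
    have "wp P' (\<lambda>s2. J (k + 1) s2 \<and> ?A s2 \<and> fst s2 i 0 = k + 1) s1"
      unfolding P'_def
    proof (rule wp_Seq, rule wp_conseq[OF step[OF k]])
      show "J k s1" "?A s1" "fst s1 i 0 = k" using Suc.prems by auto
      fix s2 assume j: "J (k + 1) (nset i 0 (k + 1) s2)"
        and a: "agree_off (nat_writes P) (real_writes P) s1 s2"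
      have i2: "fst s2 i 0 = k" using a ni Suc.prems by (simp add: agree_off_def)
      show "wp (NSet i (NConst 0) (NAdd (scalar i) (NConst 1)))
        (\<lambda>s2. J (k + 1) s2 \<and> ?A s2 \<and> fst s2 i 0 = k + 1) s2"
      proof (rule wp_NSet)
        show "nat_size (nval (NAdd (scalar i) (NConst 1)) s2) \<le> B"
          using nat_size_le_Suc[of "k + 1"] k N i2 by simp
        show "J (k + 1) (nset i (nval (NConst 0) s2) (nval (NAdd (scalar i) (NConst 1)) s2) s2) \<and>
          ?A (nset i (nval (NConst 0) s2) (nval (NAdd (scalar i) (NConst 1)) s2) s2) \<and>
          fst (nset i (nval (NConst 0) s2) (nval (NAdd (scalar i) (NConst 1)) s2) s2) i 0 = k + 1"
          using j i2 a Suc.prems(4) by (auto simp: agree_off_def)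
      qed
    qed
    then obtain t s2 where 1: "exec sz P' s1 t s2" "t \<le> poly (time_poly P') B" "bnd s2"
      "J (k + 1) s2" "?A s2" "fst s2 i 0 = k + 1"
      using Suc.prems unfolding wp_def by blast
    obtain t' s3 where 2: "exec sz (While g P') s2 t' s3" "t' \<le> d * it + (bcost_coeff g * B + 1)"
      "bnd s3" "J N s3"
    proof -
      have "k + 1 \<le> N" "d = N - (k + 1)" using k Suc.prems(2) by simp_all
      from Suc.IH[OF this 1(4,5,6,3)] show ?thesis using that by blast
    qed
    have "exec sz (While g P') s1 (bcost sz g s1 + t + t' + 1) s3"
      by (rule exec.WhileTrue[OF gt 1(1) 2(1)])
    moreover have "bcost sz g s1 + t + t' + 1 \<le> Suc d * it + (bcost_coeff g * B + 1)"
    proof -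
      have "bcost sz g s1 + t + t' + 1 \<le> it + t'"
        using 1(2) bcost_le[OF Suc.prems(6), of g] by (simp add: it_def)
      with 2(2) show ?thesis by simp
    qed
    ultimately show ?case using 2 by blast
  qed
  have "wp (While g P') (J N) (nset i 0 0 s)"
    unfolding wp_def
  proof
    assume b: "bnd (nset i 0 0 s)"
    have "?A (nset i 0 0 s)" by (simp add: agree_off_def)
    with loop[of 0 N "nset i 0 0 s"] b J0 obtain t s' where t: "exec sz (While g P') (nset i 0 0 s) t s'"
      "t \<le> N * it + (bcost_coeff g * B + 1)" "bnd s'" "J N s'" by auto
    have "N * it \<le> B * it" using N by simp
    with t(2) have "t \<le> B * it + (bcost_coeff g * B + 1)" by linarith
    also have "\<dots> = poly (time_poly (While g P')) B"
      by (simp add: it_def algebra_simps)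
    finally have "t \<le> poly (time_poly (While g P')) B" .
    with t show "\<exists>t s'. exec sz (While g P') (nset i 0 0 s) t s' \<and> t \<le> poly (time_poly (While g P')) B \<and> bnd s' \<and> J N s'"
      by blast
  qed
  then show ?thesis
    unfolding For_def g_def[symmetric] P'_def[symmetric]
    using nat_size_le_Suc[of 0] B_pos by (intro wp_Seq wp_NSet) auto
qed

end

section \<open>Balanced token assignments and dense subgraphs\<close>

locale edge_list =
  fixes V :: "nat set" and m :: nat and u w :: "nat \<Rightarrow> nat"
  assumes finite_V: "finite V"
    and ends_V: "j < m \<Longrightarrow> u j \<in> V \<and> w j \<in> V"
    and ends_neq: "j < m \<Longrightarrow> u j \<noteq> w j"
begin

definition inside :: "nat set \<Rightarrow> nat \<Rightarrow> bool" where
  "inside S j \<longleftrightarrow> u j \<in> S \<and> w j \<in> S"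

definition ecount :: "nat set \<Rightarrow> nat" where
  "ecount S = (\<Sum>j<m. of_bool (inside S j))"

text \<open>One sum covers degrees (weights 1 and 1), loads (\<open>x j\<close> and
  \<open>b - x j\<close>) and the initial loads (0 and \<open>b\<close>). The cut-off
  \<open>k\<close> turns it into an invariant of loops over the edges.\<close>

definition endsum :: "(nat \<Rightarrow> nat) \<Rightarrow> (nat \<Rightarrow> nat) \<Rightarrow> nat set \<Rightarrow> nat \<Rightarrow> nat \<Rightarrow> nat" where
  "endsum f g A k v = (\<Sum>j<k. of_bool (inside A j) * (of_bool (u j = v) * f j + of_bool (w j = v) * g j))"

abbreviation deg :: "nat set \<Rightarrow> nat \<Rightarrow> nat" where
  "deg A \<equiv> endsum (\<lambda>j. 1) (\<lambda>j. 1) A m"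

text \<open>Every edge \<open>j\<close> consists of \<open>b\<close> tokens, \<open>x j\<close> of which are assigned to its first end.\<close>

abbreviation load :: "nat set \<Rightarrow> nat \<Rightarrow> (nat \<Rightarrow> nat) \<Rightarrow> nat \<Rightarrow> nat" where
  "load A b x \<equiv> endsum x (\<lambda>j. b - x j) A m"

lemma sum_endsum:
  assumes "finite X"
  shows "(\<Sum>v\<in>X. endsum f g A k v) =
    (\<Sum>j<k. of_bool (inside A j) * (of_bool (u j \<in> X) * f j + of_bool (w j \<in> X) * g j))"
proof -
  have *: "(\<Sum>v\<in>X. of_bool (y = v) * c) = of_bool (y \<in> X) * c" for y and c :: nat
    using assms by (simp add: of_bool_def if_distrib[of "\<lambda>t. t * c"] cong: if_cong)
  have "(\<Sum>v\<in>X. endsum f g A k v) =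
    (\<Sum>j<k. \<Sum>v\<in>X. of_bool (inside A j) * (of_bool (u j = v) * f j + of_bool (w j = v) * g j))"
    unfolding endsum_def by (rule sum.swap)
  also have "\<dots> = (\<Sum>j<k. of_bool (inside A j) * (of_bool (u j \<in> X) * f j + of_bool (w j \<in> X) * g j))"
    by (simp add: sum_distrib_left[symmetric] sum.distrib *)
  finally show ?thesis .
qed

text \<open>The ends of an edge differ, so at a fixed vertex only one of its two summands is
  present; hence \<open>b * m\<close> and not twice as much.\<close>

lemma endsum_le:
  assumes "k \<le> m" "\<And>j. j < k \<Longrightarrow> f j \<le> b \<and> g j \<le> b"
  shows "endsum f g A k v \<le> b * m"
proof -
  have "endsum f g A k v \<le> (\<Sum>j<k. b)"
    unfolding endsum_def
  proof (intro sum_mono)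
    fix j assume "j \<in> {..<k}"
    then show "of_bool (inside A j) * (of_bool (u j = v) * f j + of_bool (w j = v) * g j) \<le> b"
      using assms(1) assms(2)[of j] ends_neq[of j] by (auto simp: of_bool_def)
  qed
  also have "\<dots> \<le> b * m" using assms(1) by simp
  finally show ?thesis .
qed

text \<open>Contributions are added on both sides instead of being subtracted, since subtraction of
  naturals is truncated.\<close>

lemma load_move:
  assumes j: "j < m" "inside A j" and x: "x j \<le> b" "y \<le> b"
  shows "load A b (x(j := y)) v + of_bool (u j = v) * x j + of_bool (w j = v) * y =
    load A b x v + of_bool (u j = v) * y + of_bool (w j = v) * x j"
proof -
  define t where "t z i = of_bool (inside A i) *
    (of_bool (u i = v) * z i + of_bool (w i = v) * (b - z i))" for z i
  have e: "load A b z v = t z j + sum (t z) ({..<m} - {j})" for z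
    unfolding endsum_def t_def[symmetric] using j by (intro sum.remove) auto
  have r: "sum (t (x(j := y))) ({..<m} - {j}) = sum (t x) ({..<m} - {j})"
    by (intro sum.cong) (auto simp: t_def)
  have t: "t z j = of_bool (u j = v) * z j + of_bool (w j = v) * (b - z j)" for z
    using j by (simp add: t_def)
  show ?thesis
    unfolding e[of x] e[of "x(j := y)"] r t using x by (simp add: of_bool_def)
qed

text \<open>No single token gains by changing its end. A move pays off only if the loads differ by
  at least 2, hence the slack of 1.\<close>

definition stable :: "nat set \<Rightarrow> nat \<Rightarrow> (nat \<Rightarrow> nat) \<Rightarrow> (nat \<Rightarrow> nat) \<Rightarrow> nat \<Rightarrow> bool" where
  "stable A b x L k \<longleftrightarrow> (\<forall>j<k. inside A j \<longrightarrow>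
     (0 < x j \<longrightarrow> L (u j) \<le> L (w j) + 1) \<and> (x j < b \<longrightarrow> L (w j) \<le> L (u j) + 1))"

text \<open>The layers \<open>{v. L v \<ge> M - i}\<close> below the maximal load \<open>M\<close> cannot all be distinct. If two
  consecutive ones coincide, no token leaves the layer \<open>T\<close>, so its density is at least
  \<open>(M - n) / b\<close>, whereas no density exceeds \<open>M / b\<close>. Two different densities differ by at
  least \<open>1 / n\<^sup>2\<close>, hence \<open>T\<close> is a densest set.\<close>

lemma stable_densest:
  assumes A: "A \<subseteq> V" "A \<noteq> {}" and n: "card V \<le> n" "n ^ 3 < b"
    and x: "\<And>j. j < m \<Longrightarrow> x j \<le> b" and st: "stable A b x (load A b x) m"
  obtains z where "z \<in> A"
    and "\<And>S. S \<subseteq> A \<Longrightarrow> ecount S * card {v \<in> A. load A b x z \<le> load A b x v} \<le>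
      ecount {v \<in> A. load A b x z \<le> load A b x v} * card S"
proof -
  define L where "L = load A b x"
  define M where "M = Max (L ` A)"
  \<comment> \<open>The index stands on the right to avoid the truncated difference
    \<open>M - i\<close>.\<close>
  define T where "T i = {v \<in> A. M \<le> L v + i}" for i
  have fA: "finite A" using A finite_V finite_subset by blast
  have card_le: "card S \<le> n" if "S \<subseteq> A" for S
    using that A n card_mono[OF finite_V, of S] by (meson order_trans)
  have LM: "L v \<le> M" if "v \<in> A" for v
    using that fA by (simp add: M_def)
  have "M \<in> L ` A" unfolding M_def using fA A by (intro Max_in) auto
  then have T0: "T 0 \<noteq> {}" by (auto simp: T_def)
  have Tsub: "T i \<subseteq> A" "T i \<subseteq> T (Suc i)" for i by (auto simp: T_def)
  have fT: "finite (T i)" for i using Tsub fA finite_subset by blast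
  \<comment> \<open>Otherwise \<open>T 0\<close>, ..., \<open>T n\<close> would be a strictly
    increasing chain and the last layer would have at least \<open>n + 1\<close> vertices.\<close>
  have "\<exists>i<n. T i = T (Suc i)"
  proof (rule ccontr)
    assume neg: "\<not> ?thesis"
    have "i \<le> n \<Longrightarrow> i + 1 \<le> card (T i)" for i
    proof (induction i)
      case 0 then show ?case using T0 fT[of 0] by (simp add: Suc_le_eq card_gt_0_iff)
    next
      case (Suc i)
      then have "T i \<subset> T (Suc i)" using neg Tsub[of i] by auto
      from psubset_card_mono[OF fT this] show ?case using Suc by simp
    qed
    from this[of n] card_le[OF Tsub(1), of n] show False by simp
  qed
  then obtain i where i: "i < n" "T i = T (Suc i)" by blast
  have Tne: "T i \<noteq> {}" using T0 by (auto simp: T_def)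
  \<comment> \<open>As the layer equals the next one, a load smaller by 1 does not lead out of
    it.\<close>
  have step: "p \<in> T i" if "p \<in> A" "q \<in> T i" "L q \<le> L p + 1" for p q
  proof -
    have "p \<in> T (Suc i)" using that by (simp add: T_def)
    then show ?thesis using i(2) by simp
  qed
  \<comment> \<open>An edge that leaves the layer has all its tokens at the outer end, so only edges
    inside the layer contribute to its loads.\<close>
  have "(\<Sum>v\<in>T i. L v) \<le> (\<Sum>j<m. b * of_bool (inside (T i) j))"
    unfolding L_def sum_endsum[OF fT]
  proof (intro sum_mono)
    fix j assume "j \<in> {..<m}"
    then have j: "j < m" by simp
    have st': "(0 < x j \<longrightarrow> L (u j) \<le> L (w j) + 1) \<and> (x j < b \<longrightarrow> L (w j) \<le> L (u j) + 1)"
      if "inside A j"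
      using st j that unfolding stable_def L_def[symmetric] by blast
    have 1: "w j \<in> T i" if "inside A j" "u j \<in> T i" "0 < x j"
      using step[of "w j" "u j"] that st' by (simp add: inside_def)
    have 2: "u j \<in> T i" if "inside A j" "w j \<in> T i" "x j < b"
      using step[of "u j" "w j"] that st' by (simp add: inside_def)
    show "of_bool (inside A j) * (of_bool (u j \<in> T i) * x j + of_bool (w j \<in> T i) * (b - x j))
      \<le> b * of_bool (inside (T i) j)"
    proof (cases "inside A j")
      case True
      consider "u j \<in> T i" "w j \<in> T i" | "u j \<notin> T i" "w j \<notin> T i"
        | "u j \<in> T i" "w j \<notin> T i" "x j = 0" | "u j \<notin> T i" "w j \<in> T i" "x j = b"
        using 1[OF True] 2[OF True] x[OF j] by fastforce
      then show ?thesis using x[OF j] by cases (simp_all add: True inside_def)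
    qed simp
  qed
  then have up: "(\<Sum>v\<in>T i. L v) \<le> b * ecount (T i)"
    unfolding ecount_def sum_distrib_left .
  have "(\<Sum>v\<in>T i. M) \<le> (\<Sum>v\<in>T i. L v + n)"
    using i(1) by (intro sum_mono) (auto simp: T_def)
  with up have dT: "M * card (T i) \<le> b * ecount (T i) + n * card (T i)"
    by (simp add: sum.distrib mult.commute)
  \<comment> \<open>Weak duality: the \<open>b\<close> tokens of an edge inside \<open>S\<close> all
    lie on vertices of \<open>S\<close>.\<close>
  have dS: "b * ecount S \<le> M * card S" if S: "S \<subseteq> A" for S
  proof -
    have fS: "finite S" using S fA finite_subset by blast
    have "b * ecount S \<le> (\<Sum>v\<in>S. L v)"
      unfolding L_def sum_endsum[OF fS] ecount_def sum_distrib_left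
    proof (intro sum_mono)
      fix j assume "j \<in> {..<m}"
      then show "b * of_bool (inside S j) \<le>
        of_bool (inside A j) * (of_bool (u j \<in> S) * x j + of_bool (w j \<in> S) * (b - x j))"
        using S x[of j] by (auto simp: inside_def)
    qed
    also have "\<dots> \<le> (\<Sum>v\<in>S. M)" using S LM by (intro sum_mono) auto
    finally show ?thesis by (simp add: mult.commute)
  qed
  have main: "ecount S * card (T i) \<le> ecount (T i) * card S" if S: "S \<subseteq> A" for S
  proof -
    have "b * (ecount S * card (T i)) \<le> M * card S * card (T i)"
      using mult_right_mono[OF dS[OF S], of "card (T i)"] by (simp add: mult.assoc)
    also have "\<dots> \<le> (b * ecount (T i) + n * card (T i)) * card S"
      using mult_right_mono[OF dT, of "card S"] by (simp add: ac_simps)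
    \<comment> \<open>The error is \<open>n\<close> times two cardinalities, so at most the cube of
      \<open>n\<close> and below \<open>b\<close>. Divided by \<open>b\<close> it is less than 1,
      and the compared products are integers.\<close>
    also have "\<dots> \<le> b * (ecount (T i) * card S) + n * (n * n)"
      using mult_mono[OF card_le[OF Tsub(1), of i] card_le[OF S]]
      by (simp add: algebra_simps)
    also have "\<dots> < b * (ecount (T i) * card S + 1)"
      using n by (simp add: power3_eq_cube algebra_simps)
    finally have "b * (ecount S * card (T i)) < b * (ecount (T i) * card S + 1)" .
    then have "ecount S * card (T i) < ecount (T i) * card S + 1"
      unfolding mult_less_cancel1 by blast
    then show ?thesis by simp
  qed
  \<comment> \<open>A vertex of least load in the layer gives the threshold, so only loads that
    occur have to be tried.\<close>
  obtain z where "is_arg_min L (\<lambda>v. v \<in> T i) z"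
    using ex_is_arg_min_if_finite[OF fT Tne] by blast
  then have z: "z \<in> T i" "\<And>v. v \<in> T i \<Longrightarrow> L z \<le> L v"
    by (auto simp: is_arg_min_linorder)
  have "v \<in> T i" if "v \<in> A" "L z \<le> L v" for v
    using that z(1) by (simp add: T_def)
  with z Tsub(1) have "T i = {v \<in> A. L z \<le> L v}" by blast
  with main z(1) Tsub(1) that[of z] show ?thesis unfolding L_def by auto
qed

section \<open>Potential of a token assignment\<close>

definition potential :: "(nat \<Rightarrow> nat) \<Rightarrow> nat" where
  "potential L = (\<Sum>v\<in>V. (L v)\<^sup>2)"

text \<open>If \<open>L p = L q + 2 + d\<close>, the two squares together drop by
  \<open>2 + 2 * d\<close>.\<close>

lemma potential_move:
  assumes "p \<in> V" "q \<in> V" "p \<noteq> q" and L: "L q + 2 \<le> L p"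
    and L': "L' p = L p - 1" "L' q = L q + 1" "\<And>v. v \<in> V \<Longrightarrow> v \<noteq> p \<Longrightarrow> v \<noteq> q \<Longrightarrow> L' v = L v"
  shows "potential L' + 1 \<le> potential L"
proof -
  have *: "potential L = (L p)\<^sup>2 + ((L q)\<^sup>2 + (\<Sum>v\<in>V - {p} - {q}. (L v)\<^sup>2))" for L
    using assms(1-3) finite_V by (simp add: potential_def sum.remove[of V p] sum.remove[of "V - {p}" q])
  have "(\<Sum>v\<in>V - {p} - {q}. (L' v)\<^sup>2) = (\<Sum>v\<in>V - {p} - {q}. (L v)\<^sup>2)"
    using L' by (intro sum.cong) auto
  moreover obtain d where "L p = L q + 2 + d" using L le_Suc_ex by blast
  ultimately show ?thesis using L'(1,2) by (simp add: *[of L] *[of L'] power2_eq_square)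
qed

lemma potential_le:
  assumes "\<And>v. v \<in> V \<Longrightarrow> L v \<le> a" shows "potential L \<le> card V * a\<^sup>2"
proof -
  have "potential L \<le> (\<Sum>v\<in>V. a\<^sup>2)"
    unfolding potential_def using assms by (intro sum_mono power_mono) auto
  then show ?thesis by simp
qed

section \<open>Degrees, dense sets and the local ratio inequality\<close>

lemma sum_deg_le: "finite S \<Longrightarrow> (\<Sum>v\<in>S. deg W v) \<le> 2 * ecount W"
  unfolding sum_endsum ecount_def sum_distrib_left by (intro sum_mono) auto

text \<open>An edge inside \<open>W\<close> either meets \<open>S\<close>, and is counted in a
  degree, or survives in \<open>W - S\<close>.\<close>

lemma ecount_le_deg:
  assumes "finite S" shows "ecount W \<le> (\<Sum>v\<in>S. deg W v) + ecount (W - S)"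
  unfolding sum_endsum[OF assms] ecount_def sum.distrib[symmetric]
  by (intro sum_mono) (auto simp: inside_def)

lemma ecount_empty [simp]: "ecount {} = 0"
  by (simp add: ecount_def inside_def)

text \<open>This supplies a candidate for the vertex with the least ratio of cost to degree, and so
  a nonzero divisor.\<close>

lemma dense_deg_pos:
  assumes "0 < ecount W" obtains v where "v \<in> V" "v \<in> W" "0 < deg W v"
proof -
  obtain j where j: "j < m" "inside W j"
  proof -
    have "ecount W = 0" if "\<forall>j<m. \<not> inside W j"
      unfolding ecount_def using that by (intro sum.neutral) auto
    then show ?thesis using assms that by force
  qed
  have "of_bool (inside W j) * (of_bool (u j = u j) * 1 + of_bool (w j = u j) * 1) \<le> deg W (u j)"
    unfolding endsum_def
    by (rule member_le_sum[of j "{..<m}" "\<lambda>i. of_bool (inside W i) * (of_bool (u i = u j) * 1 + of_bool (w i = u j) * 1)"])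
       (use j in auto)
  with j that[of "u j"] ends_V show ?thesis by (auto simp: inside_def)
qed

lemma deg_outside: "v \<notin> W \<Longrightarrow> deg W v = 0"
  unfolding endsum_def inside_def by (intro sum.neutral) auto

definition dense :: "real \<Rightarrow> real \<Rightarrow> nat set \<Rightarrow> bool" where
  "dense \<epsilon> \<rho> S \<longleftrightarrow> \<rho> * real (card S) < (1 - 2 * \<epsilon>) * real (ecount S)"

definition solution :: "real \<Rightarrow> nat set \<Rightarrow> bool" where
  "solution \<rho> S \<longleftrightarrow> S \<subseteq> V \<and> (\<forall>T\<subseteq>V - S. T \<noteq> {} \<longrightarrow> real (ecount T) \<le> \<rho> * real (card T))"

text \<open>A solution kills all but at most \<open>\<rho> |W|\<close> edges of \<open>W\<close>, i.e. at least a fraction \<open>2\<epsilon>\<close> of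
  them if \<open>W\<close> is dense; and each edge contributes at most 2 to the degrees.\<close>

lemma deg_ratio:
  assumes W: "W \<subseteq> V" "dense \<epsilon> \<rho> W" and \<rho>: "0 \<le> \<rho>" and \<epsilon>: "0 \<le> \<epsilon>"
    and S': "solution \<rho> S'" and S: "S \<subseteq> V"
  shows "\<epsilon> * (\<Sum>v\<in>S. real (deg W v)) \<le> (\<Sum>v\<in>S'. real (deg W v))"
proof -
  have fin: "finite S" "finite S'" "finite W"
    using S S' W(1) finite_subset[OF _ finite_V] unfolding solution_def by simp_all
  have "real (ecount (W - S')) \<le> \<rho> * real (card (W - S'))"
  proof (cases "W - S' = {}")
    case False
    moreover have "W - S' \<subseteq> V - S'" using W by blast
    ultimately show ?thesis using S' by (simp add: solution_def)
  next
    case True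
    show ?thesis unfolding True by simp
  qed
  \<comment> \<open>The sign of \<rho> matters here: for negative \<rho> the bound for the smaller
    set would be the weaker one.\<close>
  also have "\<dots> \<le> \<rho> * real (card W)"
    using \<rho> fin by (intro mult_left_mono) (auto intro: card_mono)
  finally have 1: "real (ecount (W - S')) \<le> (1 - 2 * \<epsilon>) * real (ecount W)"
    using W unfolding dense_def by simp
  have 2: "real (ecount W) \<le> (\<Sum>v\<in>S'. real (deg W v)) + real (ecount (W - S'))"
    using of_nat_mono[OF ecount_le_deg[OF fin(2), of W], where 'a=real] by simp
  have "(\<Sum>v\<in>S. real (deg W v)) \<le> 2 * real (ecount W)"
    using of_nat_mono[OF sum_deg_le[OF fin(1), of W], where 'a=real] by simp
  from mult_left_mono[OF this \<epsilon>] 1 2 show ?thesis by (simp add: algebra_simps)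
qed

text \<open>Since \<open>1 - 2 * \<epsilon>\<close> is nonnegative, a set at least as dense as a
  dense one is dense. Testing a densest set therefore decides whether any dense set exists.\<close>

lemma dense_transfer:
  assumes "dense \<epsilon> \<rho> S" "ecount S * card T \<le> ecount T * card S" "\<epsilon> \<le> 1 / 2"
    "0 < card T" "0 < card S"
  shows "dense \<epsilon> \<rho> T"
proof -
  have "\<rho> * real (card S) * real (card T) < (1 - 2 * \<epsilon>) * real (ecount S) * real (card T)"
    using assms unfolding dense_def by (intro mult_strict_right_mono) auto
  also have "\<dots> = (1 - 2 * \<epsilon>) * real (ecount S * card T)" by simp
  also have "\<dots> \<le> (1 - 2 * \<epsilon>) * real (ecount T * card S)"
    using assms by (intro mult_left_mono of_nat_mono) auto
  finally have "\<rho> * real (card T) * real (card S) < (1 - 2 * \<epsilon>) * real (ecount T) * real (card S)"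
    by (simp add: ac_simps)
  then show ?thesis unfolding dense_def using assms by simp
qed

end

section \<open>Graphs and their presentations as edge lists\<close>

lemma density_after_deletion_iff:
  assumes "finite V"
  shows "density_after_deletion_at_most V E S r \<longleftrightarrow>
    (\<forall>T\<subseteq>V - S. T \<noteq> {} \<longrightarrow> real (card (edges_within E T)) \<le> r * real (card T))"
proof -
  define D where "D = {real (card (edges_within (edges_within E (V - S)) T)) / real (card T) |T. T \<noteq> {} \<and> T \<subseteq> V - S}"
  have "D = (\<lambda>T. real (card (edges_within (edges_within E (V - S)) T)) / real (card T)) ` (Pow (V - S) - {{}})"
    unfolding D_def by auto
  then have "finite D" using assms by simp
  have e: "edges_within (edges_within E (V - S)) T = edges_within E T" if "T \<subseteq> V - S" for T
    using that by (auto simp: edges_within_def)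
  have c: "0 < real (card T)" if "T \<subseteq> V - S" "T \<noteq> {}" for T
    using that finite_subset[OF that(1)] assms by (simp add: card_gt_0_iff)
  show ?thesis
  proof (cases "V - S = {}")
    case True
    then show ?thesis unfolding density_after_deletion_at_most_def density_at_most_def by auto
  next
    case False
    then have "D \<noteq> {}" unfolding D_def by auto
    have "Max D \<le> r \<longleftrightarrow> (\<forall>d\<in>D. d \<le> r)" using \<open>finite D\<close> \<open>D \<noteq> {}\<close> by simp
    also have "\<dots> \<longleftrightarrow> (\<forall>T\<subseteq>V - S. T \<noteq> {} \<longrightarrow> real (card (edges_within E T)) \<le> r * real (card T))"
    proof -
      have "real (card (edges_within (edges_within E (V - S)) T)) / real (card T) \<le> r \<longleftrightarrow>
          real (card (edges_within E T)) \<le> r * real (card T)" if "T \<subseteq> V - S" "T \<noteq> {}" for T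
        unfolding e[OF that(1)] by (rule pos_divide_le_eq[OF c[OF that]])
      then show ?thesis unfolding D_def by blast
    qed
    finally show ?thesis
      using False unfolding density_after_deletion_at_most_def density_at_most_def max_density_def D_def by simp
  qed
qed

lemma edge_list_of_presentation:
  assumes "graph V E" "presents vs es V E"
  shows "edge_list V (length es) (\<lambda>j. fst (es ! j)) (\<lambda>j. snd (es ! j))"
proof
  show "finite V" using assms by (simp add: graph_def)
  fix j assume "j < length es"
  then have "{fst (es ! j), snd (es ! j)} \<in> E"
    using assms(2) nth_mem[of j es] by (force simp: presents_def case_prod_beta)
  then have "{fst (es ! j), snd (es ! j)} \<subseteq> V \<and> card {fst (es ! j), snd (es ! j)} = 2"
    using assms(1) unfolding graph_def by blast
  then show "fst (es ! j) \<in> V \<and> snd (es ! j) \<in> V" "fst (es ! j) \<noteq> snd (es ! j)"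
    by (auto simp: card_insert_if split: if_splits)
qed

text \<open>The unordered pairs in the list are distinct, so list positions correspond one-to-one to
  edges, and counting positions counts edges.\<close>

lemma ecount_presentation:
  assumes "graph V E" "presents vs es V E"
  shows "edge_list.ecount (length es) (\<lambda>j. fst (es ! j)) (\<lambda>j. snd (es ! j)) S = card (edges_within E S)"
proof -
  interpret edge_list V "length es" "\<lambda>j. fst (es ! j)" "\<lambda>j. snd (es ! j)"
    by (rule edge_list_of_presentation[OF assms])
  define g where "g j = {fst (es ! j), snd (es ! j)}" for j
  have d: "distinct (map (\<lambda>(u, v). {u, v}) es)" "set (map (\<lambda>(u, v). {u, v}) es) = E"
    using assms(2) by (auto simp: presents_def)
  have g: "map (\<lambda>(u, v). {u, v}) es ! j = g j" if "j < length es" for j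
    using that by (simp add: g_def case_prod_beta)
  have inj: "inj_on g {j. j < length es}"
    using d(1) unfolding distinct_conv_nth inj_on_def by (metis g length_map mem_Collect_eq)
  have "E = g ` {j. j < length es}"
  proof -
    have "map (\<lambda>(u, v). {u, v}) es = map g [0..<length es]"
      using g by (intro nth_equalityI) simp_all
    with d(2) have "E = set (map g [0..<length es])" by metis
    then show ?thesis by (auto simp del: upt_Suc)
  qed
  then have "edges_within E S = g ` {j. j < length es \<and> inside S j}"
    unfolding edges_within_def inside_def by (auto simp: g_def)
  moreover have "inj_on g {j. j < length es \<and> inside S j}"
    using inj by (rule inj_on_subset) auto
  moreover have "ecount S = card {j. j < length es \<and> inside S j}"
    unfolding ecount_def by (simp add: of_bool_def sum.If_cases Collect_conj_eq lessThan_def)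
  ultimately show ?thesis by (simp add: card_image)
qed

section \<open>The algorithm and its correctness\<close>

definition end1 :: nexp where "end1 = NGet ''end1'' (scalar ''e'')"
definition end2 :: nexp where "end2 = NGet ''end2'' (scalar ''e'')"

definition vertex :: "string \<Rightarrow> nexp" where "vertex i = NGet ''vertex'' (scalar i)"

definition edge_alive :: bexp where
  "edge_alive = NLe (NAdd (NGet ''out'' end1) (NGet ''out'' end2)) (NConst 0)"

definition edge_heavy :: "string \<Rightarrow> bexp" where
  "edge_heavy t = BAnd edge_alive
     (BAnd (NLe (scalar t) (NGet ''load'' end1)) (NLe (scalar t) (NGet ''load'' end2)))"

definition increment :: "string \<Rightarrow> nexp \<Rightarrow> com" where
  "increment a i = NSet a i (NAdd (NGet a i) (NConst 1))"

definition decrement :: "string \<Rightarrow> nexp \<Rightarrow> com" where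
  "decrement a i = NSet a i (NSub (NGet a i) (NConst 1))"

definition clear :: "string \<Rightarrow> com" where
  "clear a = For ''i'' ''n'' (NSet a (vertex ''i'') (NConst 0))"

text \<open>Any assignment could serve as a start; here all tokens of an edge lie at its second
  end.\<close>

definition init_loads :: com where
  "init_loads = Seq (clear ''load'') (For ''e'' ''m''
     (Seq (NSet ''x'' (scalar ''e'') (NConst 0))
       (If edge_alive (NSet ''load'' end2 (NAdd (NGet ''load'' end2) (scalar ''b''))) Skip)))"

text \<open>The guards not only ensure that the move pays off but also keep the truncated decrements
  exact.\<close>

definition move_token :: com where
  "move_token = If edge_alive
     (If (BAnd (NLe (NConst 1) (NGet ''x'' (scalar ''e'')))
               (NLe (NAdd (NGet ''load'' end2) (NConst 2)) (NGet ''load'' end1)))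
         (Seq (decrement ''x'' (scalar ''e'')) (Seq (decrement ''load'' end1) (increment ''load'' end2)))
         (If (BAnd (NLe (NAdd (NGet ''x'' (scalar ''e'')) (NConst 1)) (scalar ''b''))
                   (NLe (NAdd (NGet ''load'' end1) (NConst 2)) (NGet ''load'' end2)))
             (Seq (increment ''x'' (scalar ''e'')) (Seq (increment ''load'' end1) (decrement ''load'' end2)))
             Skip))
     Skip"

definition balance :: com where
  "balance = For ''r'' ''passes'' (For ''e'' ''m'' move_token)"

definition count_vertices :: com where
  "count_vertices = Seq (NSet ''nv'' (NConst 0) (NConst 0)) (For ''i'' ''n''
     (If (BAnd (NLe (NGet ''out'' (vertex ''i'')) (NConst 0))
               (NLe (scalar ''t'') (NGet ''load'' (vertex ''i''))))
         (increment ''nv'' (NConst 0)) Skip))"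

definition count_edges :: com where
  "count_edges = Seq (NSet ''ne'' (NConst 0) (NConst 0)) (For ''e'' ''m''
     (If (edge_heavy ''t'') (increment ''ne'' (NConst 0)) Skip))"

definition is_dense :: bexp where
  "is_dense = BNot (RLe
     (RMul (RSub (ROfNat (NConst 1)) (RMul (ROfNat (NConst 2)) (RGet ''eps'' (NConst 0)))) (ROfNat (scalar ''ne'')))
     (RMul (RGet ''rho'' (NConst 0)) (ROfNat (scalar ''nv''))))"

definition search :: com where
  "search = Seq (NSet ''found'' (NConst 0) (NConst 0)) (For ''z'' ''n''
     (If (NLe (NGet ''out'' (vertex ''z'')) (NConst 0))
         (Seq (NSet ''t'' (NConst 0) (NGet ''load'' (vertex ''z'')))
           (Seq count_vertices (Seq count_edges
             (If is_dense (Seq (NSet ''found'' (NConst 0) (NConst 1)) (NSet ''thr'' (NConst 0) (scalar ''t''))) Skip))))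
         Skip))"

definition degrees :: com where
  "degrees = Seq (clear ''deg'') (For ''e'' ''m''
     (If (edge_heavy ''thr'') (Seq (increment ''deg'' end1) (increment ''deg'' end2)) Skip))"

text \<open>The initial \<open>best\<close> may have degree 0; the first conjunct of the inner test
  lets any vertex of positive degree replace it. Ratios of cost to degree are compared by cross
  multiplication.\<close>

definition find_best :: com where
  "find_best = Seq (NSet ''best'' (NConst 0) (NGet ''vertex'' (NConst 0))) (For ''i'' ''n''
     (If (NLe (NConst 1) (NGet ''deg'' (vertex ''i'')))
         (If (BAnd (NLe (NConst 1) (NGet ''deg'' (scalar ''best'')))
                   (RLe (RMul (RGet ''cost'' (scalar ''best'')) (ROfNat (NGet ''deg'' (vertex ''i''))))
                        (RMul (RGet ''cost'' (vertex ''i'')) (ROfNat (NGet ''deg'' (scalar ''best''))))))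
             Skip (NSet ''best'' (NConst 0) (vertex ''i'')))
         Skip))"

text \<open>The quotient is stored beforehand because the loop changes the cost of
  \<open>best\<close> itself.\<close>

definition reduce_costs :: com where
  "reduce_costs = Seq
     (RSet ''delta'' (NConst 0) (RDiv (RGet ''cost'' (scalar ''best'')) (ROfNat (NGet ''deg'' (scalar ''best'')))))
     (For ''i'' ''n'' (RSet ''cost'' (vertex ''i'')
       (RSub (RGet ''cost'' (vertex ''i'')) (RMul (RGet ''delta'' (NConst 0)) (ROfNat (NGet ''deg'' (vertex ''i'')))))))"

definition round_step :: com where
  "round_step = Seq init_loads (Seq balance (Seq search
     (If (NLe (NConst 1) (scalar ''found''))
         (Seq degrees (Seq find_best (Seq reduce_costs (NSet ''out'' (scalar ''best'') (NConst 1)))))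
         Skip)))"

text \<open>The constant \<open>b\<close> is the cube of \<open>n\<close> plus 1. Loads are at most
  \<open>b * m\<close>, so the potential is at most \<open>n * (b * m * (b * m))\<close>, and
  \<open>passes\<close> is one more. A round deletes at most one vertex, so \<open>n\<close> rounds
  suffice.\<close>

definition algorithm :: com where
  "algorithm = If (RLe (ROfNat (NConst 0)) (RGet ''rho'' (NConst 0)))
     (Seq (NSet ''b'' (NConst 0) (NAdd (NMul (scalar ''n'') (NMul (scalar ''n'') (scalar ''n''))) (NConst 1)))
     (Seq (NSet ''passes'' (NConst 0) (NAdd (NMul (scalar ''n'')
            (NMul (NMul (scalar ''b'') (scalar ''m'')) (NMul (scalar ''b'') (scalar ''m'')))) (NConst 1)))
       (For ''k'' ''n'' round_step)))
     (For ''i'' ''n'' (NSet ''out'' (vertex ''i'') (NConst 1)))"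

text \<open>The predicate \<open>reachable k\<close> stands for whatever a cost model has to know
  about the costs after \<open>k\<close> rounds in order to bound their sizes by \<open>K\<close>.
  It is used only together with the bounds 0 and \<open>c v\<close> on the values. The term
  \<open>2 * K + 4 * nat_size m\<close> makes room for the quotient of a cost and a degree.\<close>

locale instance_run = bounded_machine sz good B + edge_list V m u w
  for sz :: "real \<Rightarrow> nat" and good :: "real set" and B :: nat
    and V :: "nat set" and m :: nat and u w :: "nat \<Rightarrow> nat" +
  fixes vs :: "nat list" and c :: "nat \<Rightarrow> real" and \<rho> \<epsilon> :: real and n b passes :: nat
    and reachable :: "nat \<Rightarrow> (nat \<Rightarrow> real) \<Rightarrow> bool" and K :: nat
  assumes vs: "distinct vs" "set vs = V" and n: "n = length vs"
    and b: "b = n * (n * n) + 1" and passes: "passes = n * (b * m * (b * m)) + 1"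
    and B_large: "passes + b * m + b + n + m + 3 \<le> B" "2 * K + 4 * nat_size m \<le> B"
    and \<epsilon>: "0 < \<epsilon>" "\<epsilon> < 1 / 2"
    and c_nonneg: "v \<in> V \<Longrightarrow> 0 \<le> c v"
    and reachable_0: "(\<And>v. v \<in> V \<Longrightarrow> f v = c v) \<Longrightarrow> reachable 0 f"
    and reachable_mono: "reachable k f \<Longrightarrow> reachable (k + 1) f"
    and reachable_step: "reachable k f \<Longrightarrow> \<beta> \<in> V \<Longrightarrow> 0 < d \<beta> \<Longrightarrow> (\<And>v. d v \<le> m) \<Longrightarrow>
      (\<And>v. v \<in> V \<Longrightarrow> f' v = f v - f \<beta> / real (d \<beta>) * real (d v)) \<Longrightarrow> reachable (k + 1) f'"
    and reachable_sz: "reachable k f \<Longrightarrow> k \<le> n \<Longrightarrow> v \<in> V \<Longrightarrow> 0 \<le> f v \<Longrightarrow> f v \<le> c v \<Longrightarrow>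
      f v \<in> good \<and> sz (f v) \<le> K"
begin

lemma nat_size_le_B: "k + 1 \<le> B \<Longrightarrow> nat_size k \<le> B"
  using nat_size_le_Suc[of k] by simp

lemma V_nth: "i < n \<Longrightarrow> vs ! i \<in> V"
  unfolding vs(2)[symmetric] n by (rule nth_mem)

lemma ball_V_nth: "(\<forall>v\<in>V. P v) \<longleftrightarrow> (\<forall>i<n. P (vs ! i))"
  unfolding vs(2)[symmetric] n by (auto simp: all_set_conv_all_nth)

lemma sum_V_nth: "(\<Sum>i<n. f (vs ! i)) = (\<Sum>v\<in>V. f v)"
proof -
  have "bij_betw ((!) vs) {..<n} V" by (rule bij_betw_nth) (simp_all add: vs n)
  then show ?thesis by (rule sum.reindex_bij_betw)
qed

definition env :: "state \<Rightarrow> bool" where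
  "env s \<longleftrightarrow> fst s ''n'' 0 = n \<and> fst s ''m'' 0 = m \<and> fst s ''b'' 0 = b \<and> fst s ''passes'' 0 = passes \<and>
    (\<forall>i<n. fst s ''vertex'' i = vs ! i) \<and> (\<forall>j<m. fst s ''end1'' j = u j \<and> fst s ''end2'' j = w j) \<and>
    snd s ''rho'' 0 = \<rho> \<and> snd s ''eps'' 0 = \<epsilon>"

lemma agree_fst: "agree_off X Y s s' \<Longrightarrow> a \<notin> X \<Longrightarrow> fst s' a = fst s a"
  by (simp add: agree_off_def)

lemma agree_snd: "agree_off X Y s s' \<Longrightarrow> a \<notin> Y \<Longrightarrow> snd s' a = snd s a"
  by (simp add: agree_off_def)

lemma agree_fst_disjoint: "agree_off X Y s s' \<Longrightarrow> X \<inter> Z = {} \<Longrightarrow> a \<in> Z \<Longrightarrow> fst s' a = fst s a"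
  by (rule agree_fst) blast+

lemma agree_snd_disjoint: "agree_off X Y s s' \<Longrightarrow> Y \<inter> Z = {} \<Longrightarrow> a \<in> Z \<Longrightarrow> snd s' a = snd s a"
  by (rule agree_snd) blast+

lemma env_agree:
  assumes "env s" "agree_off X Y s s'"
    and "X \<inter> {''n'', ''m'', ''b'', ''passes'', ''vertex'', ''end1'', ''end2''} = {}" "Y \<inter> {''rho'', ''eps''} = {}"
  shows "env s'"
proof -
  note f = agree_fst_disjoint[OF assms(2,3)] agree_snd_disjoint[OF assms(2,4)]
  have "fst s' ''n'' = fst s ''n''" "fst s' ''m'' = fst s ''m''" "fst s' ''b'' = fst s ''b''"
    "fst s' ''passes'' = fst s ''passes''" "fst s' ''vertex'' = fst s ''vertex''"
    "fst s' ''end1'' = fst s ''end1''" "fst s' ''end2'' = fst s ''end2''"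
    "snd s' ''rho'' = snd s ''rho''" "snd s' ''eps'' = snd s ''eps''"
    by (rule f; simp)+
  then show ?thesis using assms(1) unfolding env_def by simp
qed

lemmas wp_intros = wp_Seq wp_If wp_NSet wp_RSet wp_Skip

section \<open>Remaining vertices, loads and balancing\<close>

definition alive :: "state \<Rightarrow> nat set" where
  "alive s = {v \<in> V. fst s ''out'' v = 0}"

lemma alive_sub: "alive s \<subseteq> V" by (auto simp: alive_def)

lemma env_vertex: "env s \<Longrightarrow> fst s i 0 < n \<Longrightarrow> nval (vertex i) s = vs ! fst s i 0"
  by (simp add: env_def vertex_def)

lemma env_ends:
  assumes "env s" "fst s ''e'' 0 < m"
  shows "nval end1 s = u (fst s ''e'' 0)" "nval end2 s = w (fst s ''e'' 0)"
  using assms by (simp_all add: env_def end1_def end2_def)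

lemma bval_edge_alive:
  "env s \<Longrightarrow> fst s ''e'' 0 < m \<Longrightarrow> bval edge_alive s \<longleftrightarrow> inside (alive s) (fst s ''e'' 0)"
  using ends_V[of "fst s ''e'' 0"] by (auto simp: edge_alive_def env_ends inside_def alive_def)

definition heavy :: "state \<Rightarrow> nat \<Rightarrow> nat set" where
  "heavy s t = {v \<in> alive s. t \<le> fst s ''load'' v}"

lemma heavy_sub: "heavy s t \<subseteq> alive s" by (auto simp: heavy_def)

lemma bval_edge_heavy:
  "env s \<Longrightarrow> fst s ''e'' 0 < m \<Longrightarrow>
    bval (edge_heavy a) s \<longleftrightarrow> inside (heavy s (fst s a 0)) (fst s ''e'' 0)"
  by (auto simp: edge_heavy_def bval_edge_alive env_ends inside_def heavy_def)

lemma wp_clear: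
  assumes "env s" and a: "a \<notin> {''n'', ''m'', ''b'', ''passes'', ''vertex'', ''end1'', ''end2'', ''i''}"
  shows "wp (clear a) (\<lambda>s'. \<forall>v\<in>V. fst s' a v = 0) s"
  unfolding clear_def
proof (rule wp_mono[OF wp_For[where N = n and J = "\<lambda>k (s::state). \<forall>i<k. fst s a (vs ! i) = 0"]])
  fix k s' assume k: "k < n" "\<forall>i<k. fst s' a (vs ! i) = 0" "fst s' ''i'' 0 = k"
    and ag: "agree_off (insert ''i'' (nat_writes (NSet a (vertex ''i'') (NConst 0))))
      (real_writes (NSet a (vertex ''i'') (NConst 0))) s s'"
  have "env s'" by (rule env_agree[OF assms(1) ag]) (use a in auto)
  with k a show "wp (NSet a (vertex ''i'') (NConst 0))
      (\<lambda>s''. \<forall>i<k + 1. fst (nset ''i'' 0 (k + 1) s'') a (vs ! i) = 0) s'"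
    by (intro wp_intros) (auto simp: env_vertex less_Suc_eq intro!: nat_size_le_B intro: order_trans[OF _ B_large(1)])
next
  show "n + 1 \<le> B" using B_large by simp
next
  fix s' assume "\<forall>i<n. fst s' a (vs ! i) = 0"
  then show "\<forall>v\<in>V. fst s' a v = 0" by (simp add: ball_V_nth)
qed (use assms in \<open>auto simp: env_def\<close>)

lemma endsum_Suc: "endsum f g A (Suc k) v =
    endsum f g A k v + of_bool (inside A k) * (of_bool (u k = v) * f k + of_bool (w k = v) * g k)"
  by (simp add: endsum_def)

definition loads_ok :: "nat set \<Rightarrow> state \<Rightarrow> bool" where
  "loads_ok A s \<longleftrightarrow> (\<forall>j<m. fst s ''x'' j \<le> b) \<and> (\<forall>v\<in>V. fst s ''load'' v = load A b (fst s ''x'') v)"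

lemma loads_ok_le: "loads_ok A s \<Longrightarrow> v \<in> V \<Longrightarrow> fst s ''load'' v \<le> b * m"
  by (auto simp: loads_ok_def intro!: endsum_le)

lemma wp_init_loads:
  assumes "env s"
  shows "wp init_loads (\<lambda>s'. loads_ok (alive s) s') s"
  unfolding init_loads_def
proof (rule wp_Seq, rule wp_conseq[OF wp_clear[OF assms]], simp)
  let ?P = "Seq (NSet ''x'' (scalar ''e'') (NConst 0))
       (If edge_alive (NSet ''load'' end2 (NAdd (NGet ''load'' end2) (scalar ''b''))) Skip)"
  let ?A = "alive s"
  let ?J = "\<lambda>k (s::state). (\<forall>j<k. fst s ''x'' j = 0) \<and> (\<forall>v\<in>V. fst s ''load'' v = endsum (\<lambda>j. 0) (\<lambda>j. b) ?A k v)"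
  fix s1 assume l: "\<forall>v\<in>V. fst s1 ''load'' v = 0"
    and ag1: "agree_off (nat_writes (clear ''load'')) (real_writes (clear ''load'')) s s1"
  have env1: "env s1" by (rule env_agree[OF assms ag1]) (auto simp: clear_def)
  have alive1: "alive s1 = ?A" using ag1 by (simp add: alive_def clear_def agree_fst)
  show "wp (For ''e'' ''m'' ?P) (\<lambda>s'. loads_ok ?A s') s1"
  proof (rule wp_mono[OF wp_For[where N = m and J = ?J]])
    fix k s' assume k: "k < m" "?J k s'" "fst s' ''e'' 0 = k"
      and ag: "agree_off (insert ''e'' (nat_writes ?P)) (real_writes ?P) s1 s'"
    have env': "env s'" by (rule env_agree[OF env1 ag]) auto
    have alive': "alive s' = ?A" using ag alive1 by (simp add: alive_def agree_fst)
    define s2 where "s2 = nset ''x'' k 0 s'"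
    have env2: "env s2" "alive s2 = ?A" "fst s2 ''e'' 0 = k"
      using env' alive' k unfolding s2_def env_def alive_def by simp_all
    have "endsum (\<lambda>j. 0) (\<lambda>j. b) ?A k (w k) \<le> b * m" using k by (intro endsum_le) auto
    then have bound: "fst s2 ''load'' (w k) + b + 1 \<le> B"
      using k ends_V[OF k(1)] B_large by (simp add: s2_def)
    have b': "fst s2 ''b'' 0 = b" using env2 by (simp add: env_def)
    have "wp (If edge_alive (NSet ''load'' end2 (NAdd (NGet ''load'' end2) (scalar ''b''))) Skip)
      (\<lambda>s''. ?J (k + 1) (nset ''e'' 0 (k + 1) s'')) s2"
    proof (intro wp_intros)
      show "?J (k + 1) (nset ''e'' 0 (k + 1) (nset ''load'' (nval end2 s2) (nval (NAdd (NGet ''load'' end2) (scalar ''b'')) s2) s2))"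
        if "bval edge_alive s2"
        using that k env2 b' by (auto simp: bval_edge_alive env_ends endsum_Suc s2_def less_Suc_eq)
      show "?J (k + 1) (nset ''e'' 0 (k + 1) s2)" if "\<not> bval edge_alive s2"
        using that k env2 by (auto simp: bval_edge_alive endsum_Suc s2_def less_Suc_eq)
      show "nat_size (nval (NAdd (NGet ''load'' end2) (scalar ''b'')) s2) \<le> B"
        using bound k env2 b' by (auto simp: env_ends intro!: nat_size_le_B)
    qed
    then show "wp ?P (\<lambda>s''. ?J (k + 1) (nset ''e'' 0 (k + 1) s'')) s'"
      using k B_large by (intro wp_Seq wp_NSet) (auto simp: s2_def intro!: nat_size_le_B)
  next
    show "m + 1 \<le> B" using B_large by simp
    fix s' assume "?J m s'"
    then show "loads_ok ?A s'"
      by (auto simp: loads_ok_def endsum_def intro!: sum.cong)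
  qed (use env1 l in \<open>auto simp: env_def edge_alive_def endsum_def\<close>)
qed

text \<open>This is \<open>stable\<close> for a single edge, read off the stored loads instead of
  the recomputed ones.\<close>

definition settled :: "nat set \<Rightarrow> state \<Rightarrow> nat \<Rightarrow> bool" where
  "settled A s j \<longleftrightarrow> (inside A j \<longrightarrow>
     (0 < fst s ''x'' j \<longrightarrow> fst s ''load'' (u j) \<le> fst s ''load'' (w j) + 1) \<and>
     (fst s ''x'' j < b \<longrightarrow> fst s ''load'' (w j) \<le> fst s ''load'' (u j) + 1))"

lemma loads_ok_move:
  assumes ok: "loads_ok A s" and j: "j < m" "inside A j" and y: "y \<le> b"
    and x': "fst s' ''x'' = (fst s ''x'')(j := y)"
    and l': "\<And>v. v \<in> V \<Longrightarrow> fst s' ''load'' v + of_bool (u j = v) * fst s ''x'' j + of_bool (w j = v) * y =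
      fst s ''load'' v + of_bool (u j = v) * y + of_bool (w j = v) * fst s ''x'' j"
  shows "loads_ok A s'"
  unfolding loads_ok_def
proof (intro conjI ballI)
  show "\<forall>i<m. fst s' ''x'' i \<le> b" using ok y x' by (simp add: loads_ok_def)
  fix v assume v: "v \<in> V"
  have "fst s ''x'' j \<le> b" "fst s ''load'' v = load A b (fst s ''x'') v"
    using ok j v by (auto simp: loads_ok_def)
  with load_move[of j A "fst s ''x''" b y v] j y l'[OF v] show "fst s' ''load'' v = load A b (fst s' ''x'') v"
    unfolding x' by linarith
qed

text \<open>The alternative \<open>s' = s\<close> is essential: edges visited earlier in a pass stay
  settled as long as nothing moves.\<close>

lemma wp_move_token:
  assumes env: "env s" and j: "fst s ''e'' 0 = j" "j < m" and ok: "loads_ok (alive s) s"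
  shows "wp move_token (\<lambda>s'. loads_ok (alive s) s' \<and>
    (potential (fst s' ''load'') + 1 \<le> potential (fst s ''load'') \<and> \<not> settled (alive s) s j \<or>
     s' = s \<and> settled (alive s) s j)) s"
proof (cases "inside (alive s) j")
  case False
  then have "\<not> bval edge_alive s" "settled (alive s) s j"
    using env j by (simp_all add: bval_edge_alive settled_def)
  then show ?thesis
    using ok unfolding move_token_def by - (rule wp_If, simp, rule wp_Skip, simp)
next
  case inside: True
  let ?A = "alive s" and ?x = "fst s ''x'' j" and ?l = "fst s ''load''"
  have ends: "nval end1 s = u j" "nval end2 s = w j" using env j by (auto simp: env_ends)
  have E: "fst s ''end1'' j = u j" "fst s ''end2'' j = w j" using env j by (simp_all add: env_def)
  have V: "u j \<in> V" "w j \<in> V" "u j \<noteq> w j" using ends_V ends_neq j by auto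
  have b': "fst s ''b'' 0 = b" using env by (simp add: env_def)
  have x: "?x \<le> b" using ok j by (simp add: loads_ok_def)
  have lb: "?l (u j) \<le> b * m" "?l (w j) \<le> b * m" using loads_ok_le[OF ok] V by auto
  have size: "nat_size k \<le> B" if "k \<le> b * m + 1 \<or> k \<le> b" for k
    using that B_large by (intro nat_size_le_B) auto
  consider (down) "1 \<le> ?x" "?l (w j) + 2 \<le> ?l (u j)"
    | (up) "\<not> (1 \<le> ?x \<and> ?l (w j) + 2 \<le> ?l (u j))" "?x + 1 \<le> b" "?l (u j) + 2 \<le> ?l (w j)"
    | (stay) "\<not> (1 \<le> ?x \<and> ?l (w j) + 2 \<le> ?l (u j))" "\<not> (?x + 1 \<le> b \<and> ?l (u j) + 2 \<le> ?l (w j))"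
    by blast
  then show ?thesis
  proof cases
    case down
    define s' where "s' = nset ''load'' (w j) (?l (w j) + 1)
      (nset ''load'' (u j) (?l (u j) - 1) (nset ''x'' j (?x - 1) s))"
    have "loads_ok ?A s'"
      by (rule loads_ok_move[OF ok j(2) inside, where y = "?x - 1"])
         (use down V x in \<open>auto simp: s'_def\<close>)
    moreover have "potential (fst s' ''load'') + 1 \<le> potential ?l"
      by (rule potential_move[OF V down(2)]) (use V in \<open>auto simp: s'_def\<close>)
    moreover have "\<not> settled ?A s j" using down inside by (auto simp: settled_def)
    ultimately have Q: "loads_ok ?A s' \<and> (potential (fst s' ''load'') + 1 \<le> potential ?l \<and>
      \<not> settled ?A s j \<or> s' = s \<and> settled ?A s j)" by blast
    show ?thesis
      unfolding move_token_def
    proof (rule wp_If, goal_cases)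
      case 1
      show ?case
      proof (rule wp_If, goal_cases)
        case 1
        show ?case
          unfolding increment_def decrement_def
          by (intro wp_Seq wp_NSet)
             (use Q V j lb x in \<open>auto simp: E end1_def end2_def s'_def intro!: size\<close>)
      next
        case 2 then show ?case using down j by (simp add: ends)
      qed
    next
      case 2 then show ?case using inside env j by (simp add: bval_edge_alive)
    qed
  next
    case up
    define s' where "s' = nset ''load'' (w j) (?l (w j) - 1)
      (nset ''load'' (u j) (?l (u j) + 1) (nset ''x'' j (?x + 1) s))"
    have "loads_ok ?A s'"
      by (rule loads_ok_move[OF ok j(2) inside, where y = "?x + 1"])
         (use up V x in \<open>auto simp: s'_def\<close>)
    moreover have "potential (fst s' ''load'') + 1 \<le> potential ?l"
      by (rule potential_move[OF V(2,1) V(3)[symmetric] up(3)]) (use V in \<open>auto simp: s'_def\<close>)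
    moreover have "\<not> settled ?A s j" using up inside by (auto simp: settled_def)
    ultimately have Q: "loads_ok ?A s' \<and> (potential (fst s' ''load'') + 1 \<le> potential ?l \<and>
      \<not> settled ?A s j \<or> s' = s \<and> settled ?A s j)" by blast
    show ?thesis
      unfolding move_token_def
    proof (rule wp_If, goal_cases)
      case 1
      show ?case
      proof (rule wp_If, goal_cases)
        case 1 then show ?case using up j by (simp add: ends)
      next
        case 2
        show ?case
        proof (rule wp_If, goal_cases)
          case 1
          show ?case
            unfolding increment_def decrement_def
            by (intro wp_Seq wp_NSet)
               (use Q V j lb x up(2) in \<open>auto simp: E end1_def end2_def s'_def intro!: size\<close>)
        next
          case 2 then show ?case using up j b' by (simp add: ends)
        qed
      qed
    next
      case 2 then show ?case using inside env j by (simp add: bval_edge_alive)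
    qed
  next
    case stay
    then have "settled ?A s j" by (auto simp: settled_def)
    then show ?thesis
      unfolding move_token_def using stay j ok b'
      by - (rule wp_If, rule wp_If, simp add: ends, rule wp_If, simp add: ends, rule wp_Skip, simp,
        rule wp_Skip, simp)
  qed
qed

lemma nset_other [simp]:
  "a \<noteq> ''x'' \<Longrightarrow> a \<noteq> ''load'' \<Longrightarrow> loads_ok A (nset a i v s) \<longleftrightarrow> loads_ok A s"
  "a \<noteq> ''x'' \<Longrightarrow> a \<noteq> ''load'' \<Longrightarrow> settled A (nset a i v s) j \<longleftrightarrow> settled A s j"
  "a \<noteq> ''out'' \<Longrightarrow> alive (nset a i v s) = alive s"
  "a \<noteq> ''out'' \<Longrightarrow> a \<noteq> ''load'' \<Longrightarrow> heavy (nset a i v s) = heavy s"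
  by (auto simp: loads_ok_def settled_def alive_def heavy_def)

lemma alive_agree: "agree_off X Y s s' \<Longrightarrow> ''out'' \<notin> X \<Longrightarrow> alive s' = alive s"
  by (simp add: alive_def agree_fst)

lemma heavy_agree:
  "agree_off X Y s s' \<Longrightarrow> ''out'' \<notin> X \<Longrightarrow> ''load'' \<notin> X \<Longrightarrow> heavy s' = heavy s"
  by (simp add: heavy_def alive_def agree_fst fun_eq_iff)

lemma card_V: "card V = n"
  using vs n distinct_card by fastforce

lemma B_bounds: "n + 1 \<le> B" "m + 1 \<le> B" "passes + 1 \<le> B" "3 \<le> B"
  using B_large by simp_all

lemma env_lengths: "env s \<Longrightarrow> fst s ''n'' 0 = n" "env s \<Longrightarrow> fst s ''m'' 0 = m"
  "env s \<Longrightarrow> fst s ''b'' 0 = b" "env s \<Longrightarrow> fst s ''passes'' 0 = passes"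
  by (simp_all add: env_def)

lemma writes_increment [simp]:
  "nat_writes (increment a i) = {a}" "real_writes (increment a i) = {}"
  "nat_writes (decrement a i) = {a}" "real_writes (decrement a i) = {}"
  by (simp_all add: increment_def decrement_def)

lemma writes_move_token [simp]:
  "nat_writes move_token = {''x'', ''load''}" "real_writes move_token = {}"
  by (auto simp: move_token_def)

text \<open>A pass that moves a token lowers the potential; a pass that moves none leaves all loads
  as they were, so each of its visits certifies an edge for the final state.\<close>

lemma wp_pass:
  assumes env: "env s" and ok: "loads_ok (alive s) s"
    and pot: "potential (fst s ''load'') + r \<le> p \<or> (\<forall>j<m. settled (alive s) s j)"
  shows "wp (For ''e'' ''m'' move_token) (\<lambda>s'. loads_ok (alive s) s' \<and>
    (potential (fst s' ''load'') + (r + 1) \<le> p \<or> (\<forall>j<m. settled (alive s) s' j))) s"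
proof -
  \<comment> \<open>The three cases: a token has moved in this pass; none has moved and the first
    \<open>k\<close> edges are settled; or all edges were settled already.\<close>
  define J where "J k s' \<longleftrightarrow> loads_ok (alive s) s' \<and>
    (potential (fst s' ''load'') + (r + 1) \<le> p \<or>
     potential (fst s' ''load'') + r \<le> p \<and> (\<forall>j<k. settled (alive s) s' j) \<or>
     (\<forall>j<m. settled (alive s) s' j))" for k s'
  have J_e: "J k (nset ''e'' i v s') \<longleftrightarrow> J k s'" for k i v s'
    by (simp add: J_def)
  have "wp (For ''e'' ''m'' move_token) (J m) s"
  proof (rule wp_For)
    show "J 0 (nset ''e'' 0 0 s)" using ok pot by (auto simp: J_e) (auto simp: J_def)
    fix k s' assume k: "k < m" "J k s'" "fst s' ''e'' 0 = k"
      and ag: "agree_off (insert ''e'' (nat_writes move_token)) (real_writes move_token) s s'"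
    have env': "env s'" by (rule env_agree[OF env ag]) auto
    have al: "alive s' = alive s" by (rule alive_agree[OF ag]) auto
    have ok': "loads_ok (alive s') s'" using k(2) al by (simp add: J_def)
    show "wp move_token (\<lambda>s''. J (k + 1) (nset ''e'' 0 (k + 1) s'')) s'"
      by (rule wp_mono[OF wp_move_token[OF env' k(3,1) ok']])
         (use k(1,2) in \<open>auto simp: J_e al J_def less_Suc_eq\<close>)
  qed (use env B_bounds in \<open>simp_all add: env_lengths\<close>)
  then show ?thesis by (rule wp_mono) (auto simp: J_def)
qed

text \<open>The initial potential is smaller than the number of passes, so it cannot drop in each of
  them. Some pass moves nothing, and from then on the assignment does not change.\<close>

lemma wp_balance:
  assumes env: "env s" and ok: "loads_ok (alive s) s"
  shows "wp balance (\<lambda>s'. loads_ok (alive s) s' \<and> (\<forall>j<m. settled (alive s) s' j)) s"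
  unfolding balance_def
proof (rule wp_mono[OF wp_For[where N = passes]])
  let ?P = "For ''e'' ''m'' move_token"
  let ?J = "\<lambda>r s'. loads_ok (alive s) s' \<and> (potential (fst s' ''load'') + r \<le> potential (fst s ''load'') \<or>
     (\<forall>j<m. settled (alive s) s' j))"
  show "?J 0 (nset ''r'' 0 0 s)" using ok by simp
  show "wp ?P (\<lambda>s''. ?J (r + 1) (nset ''r'' 0 (r + 1) s'')) s'"
    if r: "r < passes" "?J r s'" "fst s' ''r'' 0 = r"
      and ag: "agree_off (insert ''r'' (nat_writes ?P)) (real_writes ?P) s s'" for r s'
  proof -
    have env': "env s'" by (rule env_agree[OF env ag]) auto
    have al: "alive s' = alive s" by (rule alive_agree[OF ag]) auto
    from wp_pass[OF env', of r "potential (fst s ''load'')"] r(2) show ?thesis by (simp add: al)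
  qed
  fix s' assume J: "?J passes s'"
  have "potential (fst s ''load'') \<le> n * (b * m)\<^sup>2"
    using potential_le[of "fst s ''load''" "b * m"] loads_ok_le[OF ok] by (simp add: card_V)
  also have "\<dots> < passes" by (simp add: passes power2_eq_square)
  finally show "loads_ok (alive s) s' \<and> (\<forall>j<m. settled (alive s) s' j)" using J by auto
qed (use env B_bounds in \<open>simp_all add: env_lengths\<close>)

section \<open>Search for a dense level set of the loads\<close>

lemma wp_count_vertices:
  assumes env: "env s"
  shows "wp count_vertices (\<lambda>s'. fst s' ''nv'' 0 = card (heavy s (fst s ''t'' 0))) s"
proof -
  define W where "W = heavy s (fst s ''t'' 0)"
  let ?P = "If (BAnd (NLe (NGet ''out'' (vertex ''i'')) (NConst 0))
               (NLe (scalar ''t'') (NGet ''load'' (vertex ''i'')))) (increment ''nv'' (NConst 0)) Skip"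
  let ?J = "\<lambda>k (s'::state). fst s' ''nv'' 0 = (\<Sum>i<k. of_bool (vs ! i \<in> W))"
  define s0 where "s0 = nset ''nv'' 0 0 s"
  have w: "nat_writes ?P = {''nv''}" "real_writes ?P = {}" by auto
  have env0: "env s0" by (rule env_agree[OF env, of "{''nv''}" "{}"]) (auto simp: s0_def agree_off_def)
  have "wp (For ''i'' ''n'' ?P) (?J n) s0"
  proof (rule wp_For[where J = ?J and N = n])
    show "?J 0 (nset ''i'' 0 0 s0)" by (simp add: s0_def)
    fix k s' assume k: "k < n" "?J k s'" "fst s' ''i'' 0 = k"
      and ag: "agree_off (insert ''i'' (nat_writes ?P)) (real_writes ?P) s0 s'"
    note ag' = ag[unfolded w]
    have env': "env s'" by (rule env_agree[OF env0 ag']) auto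
    have hv: "heavy s' = heavy s" using heavy_agree[OF ag'] by (simp add: s0_def)
    have t: "fst s' ''t'' 0 = fst s ''t'' 0" using agree_fst[OF ag', of "''t''"] by (simp add: s0_def)
    have "(\<Sum>i<k. of_bool (vs ! i \<in> W)) \<le> (\<Sum>i<k. 1::nat)" by (intro sum_mono) auto
    then have nv: "fst s' ''nv'' 0 \<le> k" using k by simp
    have tst: "bval (BAnd (NLe (NGet ''out'' (vertex ''i'')) (NConst 0))
               (NLe (scalar ''t'') (NGet ''load'' (vertex ''i'')))) s' \<longleftrightarrow> vs ! k \<in> W"
      using env' k V_nth[OF k(1)] unfolding W_def hv[symmetric] t[symmetric]
      by (simp add: env_vertex heavy_def alive_def)
    show "wp ?P (\<lambda>s''. ?J (k + 1) (nset ''i'' 0 (k + 1) s'')) s'"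
    proof (rule wp_If, goal_cases)
      case 1
      then show ?case unfolding tst increment_def using k nv B_bounds
        by (intro wp_NSet) (auto intro!: nat_size_le_B)
    next
      case 2
      then show ?case unfolding tst using k by (intro wp_Skip) simp
    qed
  qed (use env0 B_bounds in \<open>simp_all add: env_lengths w\<close>)
  moreover have "(\<Sum>i<n. of_bool (vs ! i \<in> W)) = card W"
  proof -
    have "W \<subseteq> V" using heavy_sub alive_sub unfolding W_def by blast
    then have "V \<inter> W = W" by blast
    then show ?thesis using sum_V_nth[of "\<lambda>v. of_bool (v \<in> W) :: nat"] finite_V by simp
  qed
  ultimately have "wp (For ''i'' ''n'' ?P) (\<lambda>s'. fst s' ''nv'' 0 = card W) s0" by simp
  then show ?thesis
    unfolding count_vertices_def W_def s0_def using B_bounds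
    by (intro wp_Seq wp_NSet) (auto intro!: nat_size_le_B)
qed

lemma wp_count_edges:
  assumes env: "env s"
  shows "wp count_edges (\<lambda>s'. fst s' ''ne'' 0 = ecount (heavy s (fst s ''t'' 0))) s"
proof -
  define W where "W = heavy s (fst s ''t'' 0)"
  let ?P = "If (edge_heavy ''t'') (increment ''ne'' (NConst 0)) Skip"
  let ?J = "\<lambda>k (s'::state). fst s' ''ne'' 0 = (\<Sum>j<k. of_bool (inside W j))"
  define s0 where "s0 = nset ''ne'' 0 0 s"
  have w: "nat_writes ?P = {''ne''}" "real_writes ?P = {}" by auto
  have env0: "env s0" by (rule env_agree[OF env, of "{''ne''}" "{}"]) (auto simp: s0_def agree_off_def)
  have "wp (For ''e'' ''m'' ?P) (?J m) s0"
  proof (rule wp_For[where J = ?J and N = m])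
    show "?J 0 (nset ''e'' 0 0 s0)" by (simp add: s0_def)
    fix k s' assume k: "k < m" "?J k s'" "fst s' ''e'' 0 = k"
      and ag: "agree_off (insert ''e'' (nat_writes ?P)) (real_writes ?P) s0 s'"
    note ag' = ag[unfolded w]
    have env': "env s'" by (rule env_agree[OF env0 ag']) auto
    have hv: "heavy s' = heavy s" using heavy_agree[OF ag'] by (simp add: s0_def)
    have t: "fst s' ''t'' 0 = fst s ''t'' 0" using agree_fst[OF ag', of "''t''"] by (simp add: s0_def)
    have "(\<Sum>j<k. of_bool (inside W j)) \<le> (\<Sum>j<k. 1::nat)" by (intro sum_mono) auto
    then have ne: "fst s' ''ne'' 0 \<le> k" using k by simp
    have tst: "bval (edge_heavy ''t'') s' \<longleftrightarrow> inside W k"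
      using env' k unfolding W_def hv[symmetric] t[symmetric] by (simp add: bval_edge_heavy)
    show "wp ?P (\<lambda>s''. ?J (k + 1) (nset ''e'' 0 (k + 1) s'')) s'"
    proof (rule wp_If, goal_cases)
      case 1
      then show ?case unfolding tst increment_def using k ne B_bounds
        by (intro wp_NSet) (auto intro!: nat_size_le_B)
    next
      case 2
      then show ?case unfolding tst using k by (intro wp_Skip) simp
    qed
  qed (use env0 B_bounds in \<open>simp_all add: env_lengths w\<close>)
  then have "wp (For ''e'' ''m'' ?P) (\<lambda>s'. fst s' ''ne'' 0 = ecount W) s0" by (simp only: ecount_def)
  then show ?thesis
    unfolding count_edges_def W_def s0_def using B_bounds
    by (intro wp_Seq wp_NSet) (auto intro!: nat_size_le_B)
qed

lemma writes_blocks [simp]: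
  "nat_writes init_loads = {''i'', ''e'', ''x'', ''load''}" "real_writes init_loads = {}"
  "nat_writes balance = {''r'', ''e'', ''x'', ''load''}" "real_writes balance = {}"
  "nat_writes count_vertices = {''i'', ''nv''}" "real_writes count_vertices = {}"
  "nat_writes count_edges = {''e'', ''ne''}" "real_writes count_edges = {}"
  "nat_writes (clear a) = {''i'', a}" "real_writes (clear a) = {}"
  by (auto simp: init_loads_def clear_def balance_def count_vertices_def count_edges_def)

lemma writes_search [simp]:
  "nat_writes search = {''found'', ''thr'', ''t'', ''z'', ''i'', ''e'', ''nv'', ''ne''}" "real_writes search = {}"
  by (auto simp: search_def)

lemma bval_is_dense:
  "env s \<Longrightarrow> fst s ''nv'' 0 = card W \<Longrightarrow> fst s ''ne'' 0 = ecount W \<Longrightarrow> bval is_dense s \<longleftrightarrow> dense \<epsilon> \<rho> W"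
  by (simp add: is_dense_def dense_def env_def not_le)

lemma wp_search:
  assumes env: "env s"
  shows "wp search (\<lambda>s'. if fst s' ''found'' 0 = 0
    then \<forall>v\<in>alive s. \<not> dense \<epsilon> \<rho> (heavy s (fst s ''load'' v))
    else dense \<epsilon> \<rho> (heavy s (fst s' ''thr'' 0))) s"
proof -
  let ?B = "If is_dense (Seq (NSet ''found'' (NConst 0) (NConst 1)) (NSet ''thr'' (NConst 0) (scalar ''t''))) Skip"
  let ?P = "If (NLe (NGet ''out'' (vertex ''z'')) (NConst 0))
         (Seq (NSet ''t'' (NConst 0) (NGet ''load'' (vertex ''z'')))
           (Seq count_vertices (Seq count_edges ?B))) Skip"
  let ?X = "{''found'', ''thr'', ''t'', ''z'', ''i'', ''e'', ''nv'', ''ne''}"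
  \<comment> \<open>After a success \<open>thr\<close> may be overwritten, but only by another
    threshold that has passed the same test, so nothing more has to be remembered.\<close>
  define J where "J k s' \<longleftrightarrow> (if fst s' ''found'' 0 = 0
    then \<forall>i<k. vs ! i \<in> alive s \<longrightarrow> \<not> dense \<epsilon> \<rho> (heavy s (fst s ''load'' (vs ! i)))
    else dense \<epsilon> \<rho> (heavy s (fst s' ''thr'' 0)))" for k and s' :: state
  have J_z: "J k (nset ''z'' i v s') \<longleftrightarrow> J k s'" for k i v s'
    by (simp add: J_def)
  define s0 where "s0 = nset ''found'' 0 0 s"
  have w: "nat_writes ?P = {''found'', ''thr'', ''t'', ''i'', ''e'', ''nv'', ''ne''}" "real_writes ?P = {}"
    by auto
  have env0: "env s0" by (rule env_agree[OF env, of "{''found''}" "{}"]) (auto simp: s0_def agree_off_def)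
  have "wp (For ''z'' ''n'' ?P) (J n) s0"
  proof (rule wp_For)
    show "J 0 (nset ''z'' 0 0 s0)" by (simp add: J_def s0_def)
    fix k s' assume k: "k < n" "J k s'" "fst s' ''z'' 0 = k"
      and ag: "agree_off (insert ''z'' (nat_writes ?P)) (real_writes ?P) s0 s'"
    note ag' = ag[unfolded w]
    have env': "env s'" by (rule env_agree[OF env0 ag']) auto
    have hv: "heavy s' = heavy s" using heavy_agree[OF ag'] by (simp add: s0_def)
    have al: "alive s' = alive s" using alive_agree[OF ag'] by (simp add: s0_def)
    have ld: "fst s' ''load'' = fst s ''load''" using agree_fst[OF ag', of "''load''"] by (simp add: s0_def)
    have vk: "nval (vertex ''z'') s' = vs ! k" using env' k by (simp add: env_vertex)
    define t where "t = fst s ''load'' (vs ! k)"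
    define s1 where "s1 = nset ''t'' 0 t s'"
    have env1: "env s1" by (rule env_agree[OF env', of "{''t''}" "{}"]) (auto simp: s1_def agree_off_def)
    have hv1: "heavy s1 = heavy s" using hv by (simp add: s1_def)
    have t1: "fst s1 ''t'' 0 = t" by (simp add: s1_def)
    have J1: "J k s1" using k by (simp add: s1_def J_def)
    have "wp (Seq count_vertices (Seq count_edges ?B)) (\<lambda>s''. J (k + 1) (nset ''z'' 0 (k + 1) s'')) s1"
      if alive: "vs ! k \<in> alive s"
    proof (rule wp_Seq, rule wp_conseq[OF wp_count_vertices[OF env1]])
      fix s2 assume nv: "fst s2 ''nv'' 0 = card (heavy s1 (fst s1 ''t'' 0))"
        and "agree_off (nat_writes count_vertices) (real_writes count_vertices) s1 s2"
      then have ag2: "agree_off {''i'', ''nv''} {} s1 s2" by simp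
      have env2: "env s2" by (rule env_agree[OF env1 ag2]) auto
      have hv2: "heavy s2 = heavy s" using heavy_agree[OF ag2] hv1 by simp
      have t2: "fst s2 ''t'' 0 = t" using agree_fst[OF ag2, of "''t''"] t1 by simp
      show "wp (Seq count_edges ?B) (\<lambda>s''. J (k + 1) (nset ''z'' 0 (k + 1) s'')) s2"
      proof (rule wp_Seq, rule wp_conseq[OF wp_count_edges[OF env2]])
        fix s3 assume ne: "fst s3 ''ne'' 0 = ecount (heavy s2 (fst s2 ''t'' 0))"
          and "agree_off (nat_writes count_edges) (real_writes count_edges) s2 s3"
        then have ag3: "agree_off {''e'', ''ne''} {} s2 s3" by simp
        have env3: "env s3" by (rule env_agree[OF env2 ag3]) auto
        have t3: "fst s3 ''t'' 0 = t" using agree_fst[OF ag3, of "''t''"] t2 by simp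
        have nv3: "fst s3 ''nv'' 0 = card (heavy s t)"
          using agree_fst[OF ag3, of "''nv''"] nv hv1 t1 by simp
        have f3: "fst s3 ''found'' = fst s1 ''found''" "fst s3 ''thr'' = fst s1 ''thr''"
          using agree_fst[OF ag3] agree_fst[OF ag2] by simp_all
        have tst: "bval is_dense s3 \<longleftrightarrow> dense \<epsilon> \<rho> (heavy s t)"
          by (rule bval_is_dense[OF env3 nv3]) (simp add: ne hv2 t2)
        show "wp ?B (\<lambda>s''. J (k + 1) (nset ''z'' 0 (k + 1) s'')) s3"
        proof (rule wp_If, goal_cases)
          case 1
          show ?case
          proof (rule wp_Seq, rule wp_NSet)
            show "nat_size (nval (NConst 1) s3) \<le> B" using B_bounds by (auto intro!: nat_size_le_B)
            show "wp (NSet ''thr'' (NConst 0) (scalar ''t'')) (\<lambda>s''. J (k + 1) (nset ''z'' 0 (k + 1) s''))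
              (nset ''found'' (nval (NConst 0) s3) (nval (NConst 1) s3) s3)"
              using 1 unfolding tst by (intro wp_NSet) (auto simp: J_def t3 dest: bnd_cell[of _ "''t''" 0])
          qed
        next
          case 2
          then show ?case
            unfolding tst using J1 f3
            by (intro wp_Skip) (auto simp: J_def t_def less_Suc_eq)
        qed
      qed
    qed
    moreover have "bval (NLe (NGet ''out'' (vertex ''z'')) (NConst 0)) s' \<longleftrightarrow> vs ! k \<in> alive s"
      unfolding al[symmetric] using vk V_nth[OF k(1)] by (simp add: alive_def)
    ultimately show "wp ?P (\<lambda>s''. J (k + 1) (nset ''z'' 0 (k + 1) s'')) s'"
      using k(1,2) vk ld bnd_cell[of s' "''load''" "vs ! k"]
      by (intro wp_If wp_Seq[of "NSet a i e" for a i e] wp_NSet wp_Skip)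
         (auto simp: s1_def t_def J_z J_def less_Suc_eq)
  qed (use env0 B_bounds in \<open>simp_all add: env_lengths w\<close>)
  then have "wp (For ''z'' ''n'' ?P) (\<lambda>s'. if fst s' ''found'' 0 = 0
    then \<forall>v\<in>alive s. \<not> dense \<epsilon> \<rho> (heavy s (fst s ''load'' v))
    else dense \<epsilon> \<rho> (heavy s (fst s' ''thr'' 0))) s0"
  proof (rule wp_mono)
    fix s' assume "J n s'"
    moreover have "(\<forall>v\<in>alive s. P v) \<longleftrightarrow> (\<forall>i<n. vs ! i \<in> alive s \<longrightarrow> P (vs ! i))" for P
      using ball_V_nth[of "\<lambda>v. v \<in> alive s \<longrightarrow> P v"] alive_sub[of s] by blast
    ultimately show "if fst s' ''found'' 0 = 0
      then \<forall>v\<in>alive s. \<not> dense \<epsilon> \<rho> (heavy s (fst s ''load'' v))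
      else dense \<epsilon> \<rho> (heavy s (fst s' ''thr'' 0))" by (simp add: J_def)
  qed
  then show ?thesis
    unfolding search_def s0_def using B_bounds
    by (intro wp_Seq[of "NSet a i e" for a i e] wp_NSet) (auto intro!: nat_size_le_B)
qed

end

text \<open>Transitivity of the comparison of \<open>x / p\<close>, \<open>y / q\<close> and
  \<open>z / r\<close>, for ratios that are compared by cross products.\<close>

lemma ratio_trans:
  fixes x y z p q r :: real
  assumes "0 < p" "0 < q" "0 < r" "x * q \<le> y * p" "y * r \<le> z * q"
  shows "x * r \<le> z * p"
proof -
  have "x / p \<le> y / q" "y / q \<le> z / r"
    using assms by (simp_all add: field_simps)
  then have "x / p \<le> z / r" by linarith
  then show ?thesis using assms by (simp add: field_simps)
qed

context instance_run begin

section \<open>Degrees, the vertex of least ratio and the reduction of costs\<close>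

lemma wp_degrees:
  assumes env: "env s"
  shows "wp degrees (\<lambda>s'. \<forall>v\<in>V. fst s' ''deg'' v = deg (heavy s (fst s ''thr'' 0)) v) s"
  unfolding degrees_def
proof (rule wp_Seq, rule wp_conseq[OF wp_clear[OF env]], simp)
  define W where "W = heavy s (fst s ''thr'' 0)"
  let ?P = "If (edge_heavy ''thr'') (Seq (increment ''deg'' end1) (increment ''deg'' end2)) Skip"
  let ?J = "\<lambda>k (s'::state). \<forall>v\<in>V. fst s' ''deg'' v = endsum (\<lambda>j. 1) (\<lambda>j. 1) W k v"
  fix s1 assume z: "\<forall>v\<in>V. fst s1 ''deg'' v = 0"
    and "agree_off (nat_writes (clear ''deg'')) (real_writes (clear ''deg'')) s s1"
  then have ag1: "agree_off {''i'', ''deg''} {} s s1" by simp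
  have env1: "env s1" by (rule env_agree[OF env ag1]) auto
  have W1: "heavy s1 (fst s1 ''thr'' 0) = W"
    using heavy_agree[OF ag1] agree_fst[OF ag1, of "''thr''"] by (simp add: W_def)
  have w: "nat_writes ?P = {''deg''}" "real_writes ?P = {}" by auto
  show "wp (For ''e'' ''m'' ?P) (\<lambda>s'. \<forall>v\<in>V. fst s' ''deg'' v = deg (heavy s (fst s ''thr'' 0)) v) s1"
    unfolding W_def[symmetric]
  proof (rule wp_For[where J = ?J and N = m])
    show "?J 0 (nset ''e'' 0 0 s1)" using z by (simp add: endsum_def)
    fix k s' assume k: "k < m" "?J k s'" "fst s' ''e'' 0 = k"
      and ag: "agree_off (insert ''e'' (nat_writes ?P)) (real_writes ?P) s1 s'"
    note ag' = ag[unfolded w]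
    have env': "env s'" by (rule env_agree[OF env1 ag']) auto
    have tst: "bval (edge_heavy ''thr'') s' \<longleftrightarrow> inside W k"
      using env' k heavy_agree[OF ag'] agree_fst[OF ag', of "''thr''"] W1 by (simp add: bval_edge_heavy)
    have E: "fst s' ''end1'' k = u k" "fst s' ''end2'' k = w k" using env' k by (simp_all add: env_def)
    have V: "u k \<in> V" "w k \<in> V" "u k \<noteq> w k" using ends_V ends_neq k by auto
    have d: "fst s' ''deg'' v \<le> m" if "v \<in> V" for v
      using k that endsum_le[of k "\<lambda>j. 1" 1 "\<lambda>j. 1" W v] by simp
    have size: "nat_size (Suc l) \<le> B" if "l \<le> m" for l
      using that B_large by (intro nat_size_le_B) simp
    show "wp ?P (\<lambda>s''. ?J (k + 1) (nset ''e'' 0 (k + 1) s'')) s'"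
    proof (rule wp_If, goal_cases)
      case 1
      then show ?case unfolding tst increment_def
        by (intro wp_Seq wp_NSet) (use k V d in \<open>auto simp: E end1_def end2_def endsum_Suc intro!: size\<close>)
    next
      case 2
      then show ?case unfolding tst using k by (intro wp_Skip) (simp add: endsum_Suc)
    qed
  qed (use env1 B_bounds in \<open>simp_all add: env_lengths\<close>)
qed

lemma writes_degrees [simp]: "nat_writes degrees = {''i'', ''e'', ''deg''}" "real_writes degrees = {}"
  by (auto simp: degrees_def)

lemma wp_find_best:
  assumes env: "env s" and pos: "v0 \<in> V" "0 < fst s ''deg'' v0"
  shows "wp find_best (\<lambda>s'. fst s' ''best'' 0 \<in> V \<and> 0 < fst s ''deg'' (fst s' ''best'' 0) \<and>
    (\<forall>v\<in>V. 0 < fst s ''deg'' v \<longrightarrow> snd s ''cost'' (fst s' ''best'' 0) * real (fst s ''deg'' v) \<le>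
      snd s ''cost'' v * real (fst s ''deg'' (fst s' ''best'' 0)))) s"
proof -
  let ?d = "fst s ''deg''" and ?f = "snd s ''cost''"
  let ?T = "BAnd (NLe (NConst 1) (NGet ''deg'' (scalar ''best'')))
                   (RLe (RMul (RGet ''cost'' (scalar ''best'')) (ROfNat (NGet ''deg'' (vertex ''i''))))
                        (RMul (RGet ''cost'' (vertex ''i'')) (ROfNat (NGet ''deg'' (scalar ''best'')))))"
  let ?P = "If (NLe (NConst 1) (NGet ''deg'' (vertex ''i'')))
         (If ?T Skip (NSet ''best'' (NConst 0) (vertex ''i''))) Skip"
  \<comment> \<open>Vertices of degree 0 impose no condition. Conversely, the first scanned vertex
    of positive degree forces \<beta> to have positive degree.\<close>
  define Q where "Q \<beta> v \<longleftrightarrow> (0 < ?d v \<longrightarrow> 0 < ?d \<beta> \<and> ?f \<beta> * real (?d v) \<le> ?f v * real (?d \<beta>))" for \<beta> v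
  let ?J = "\<lambda>k (s'::state). fst s' ''best'' 0 \<in> V \<and> (\<forall>i<k. Q (fst s' ''best'' 0) (vs ! i))"
  have n0: "0 < n" using pos(1) card_V finite_V by (metis card_gt_0_iff empty_iff)
  define s0 where "s0 = nset ''best'' 0 (vs ! 0) s"
  have env0: "env s0" by (rule env_agree[OF env, of "{''best''}" "{}"]) (auto simp: s0_def agree_off_def)
  have w: "nat_writes ?P = {''best''}" "real_writes ?P = {}" by auto
  have "wp (For ''i'' ''n'' ?P) (?J n) s0"
  proof (rule wp_For[where J = ?J and N = n])
    show "?J 0 (nset ''i'' 0 0 s0)" using V_nth[OF n0] by (simp add: s0_def)
    fix k s' assume k: "k < n" "?J k s'" "fst s' ''i'' 0 = k"
      and ag: "agree_off (insert ''i'' (nat_writes ?P)) (real_writes ?P) s0 s'"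
    note ag' = ag[unfolded w]
    have env': "env s'" by (rule env_agree[OF env0 ag']) auto
    have d: "fst s' ''deg'' = ?d" "snd s' ''cost'' = ?f"
      using agree_fst[OF ag', of "''deg''"] agree_snd[OF ag', of "''cost''"] by (simp_all add: s0_def)
    define v where "v = vs ! k"
    define \<beta> where "\<beta> = fst s' ''best'' 0"
    have v: "nval (vertex ''i'') s' = v" "v \<in> V" using env' k V_nth by (simp_all add: env_vertex v_def)
    have T: "bval ?T s' \<longleftrightarrow> 0 < ?d \<beta> \<and> ?f \<beta> * real (?d v) \<le> ?f v * real (?d \<beta>)"
      by (simp add: v d \<beta>_def Suc_le_eq)
    have J: "\<beta> \<in> V" "\<forall>i<k. Q \<beta> (vs ! i)" using k(2) by (auto simp: \<beta>_def)
    have Q_Suc: "(\<forall>i<k + 1. Q \<gamma> (vs ! i)) \<longleftrightarrow> (\<forall>i<k. Q \<gamma> (vs ! i)) \<and> Q \<gamma> v" for \<gamma>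
      by (auto simp: v_def less_Suc_eq)
    show "wp ?P (\<lambda>s''. ?J (k + 1) (nset ''i'' 0 (k + 1) s'')) s'"
    proof (rule wp_If, goal_cases)
      case 1
      then have dv: "0 < ?d v" by (simp add: v d)
      show ?case
      proof (rule wp_If, goal_cases)
        case 1
        then have "Q \<beta> v" using T by (simp add: Q_def)
        then show ?case unfolding Q_Suc using J by (intro wp_Skip) (simp add: \<beta>_def)
      next
        case 2
        \<comment> \<open>If \<beta> has degree 0, then so has every vertex scanned before;
          otherwise the failed test says that \<open>v\<close> has a smaller ratio than
          \<beta>.\<close>
        have "Q v v'" if "Q \<beta> v'" for v'
        proof (cases "0 < ?d v'")
          case True
          then have b: "0 < ?d \<beta>" "?f \<beta> * real (?d v') \<le> ?f v' * real (?d \<beta>)"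
            using that by (auto simp: Q_def)
          then have "?f v * real (?d \<beta>) \<le> ?f \<beta> * real (?d v)" using 2 T by auto
          from ratio_trans[OF _ _ _ this b(2)] True b dv show ?thesis by (simp add: Q_def)
        qed (simp add: Q_def)
        then have "\<forall>i<k + 1. Q v (vs ! i)" unfolding Q_Suc using J dv by (auto simp: Q_def)
        moreover have "nat_size v \<le> B" if "bnd s'"
          using bnd_cell[OF that, of "''vertex''" k] env' k by (simp add: env_def v_def)
        ultimately show ?case using v by (intro wp_NSet) simp_all
      qed
    next
      case 2
      then have "Q \<beta> v" by (simp add: v d Q_def)
      then show ?case unfolding Q_Suc using J by (intro wp_Skip) (simp add: \<beta>_def)
    qed
  qed (use env0 B_bounds in \<open>simp_all add: env_lengths\<close>)
  then have "wp (For ''i'' ''n'' ?P) (\<lambda>s'. fst s' ''best'' 0 \<in> V \<and> (\<forall>v\<in>V. Q (fst s' ''best'' 0) v)) s0"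
    unfolding ball_V_nth .
  then have "wp (For ''i'' ''n'' ?P) (\<lambda>s'. fst s' ''best'' 0 \<in> V \<and> 0 < ?d (fst s' ''best'' 0) \<and>
    (\<forall>v\<in>V. 0 < ?d v \<longrightarrow> ?f (fst s' ''best'' 0) * real (?d v) \<le> ?f v * real (?d (fst s' ''best'' 0)))) s0"
    by (rule wp_mono) (use pos in \<open>auto simp: Q_def\<close>)
  moreover have "nval (NGet ''vertex'' (NConst 0)) s = vs ! 0" using env n0 by (simp add: env_def)
  moreover have "nat_size (nval (NGet ''vertex'' (NConst 0)) s) \<le> B" if "bnd s"
    using bnd_cell[OF that] by simp
  ultimately show ?thesis
    unfolding find_best_def s0_def by (intro wp_Seq[of "NSet a i e" for a i e] wp_NSet) simp_all
qed

lemma writes_find_best [simp]: "nat_writes find_best = {''i'', ''best''}" "real_writes find_best = {}"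
  by (auto simp: find_best_def)

lemma wp_reduce_costs:
  fixes s :: state
  defines "\<beta> \<equiv> fst s ''best'' 0" and "d \<equiv> fst s ''deg''" and "f \<equiv> snd s ''cost''"
  assumes env: "env s" and \<beta>: "\<beta> \<in> V" "0 < d \<beta>" and d: "\<And>v. v \<in> V \<Longrightarrow> d v \<le> m"
    and r: "reachable k f" "k < n" and f: "\<And>v. v \<in> V \<Longrightarrow> 0 \<le> f v \<and> f v \<le> c v"
    and f': "\<And>v. v \<in> V \<Longrightarrow> 0 \<le> f v - f \<beta> / real (d \<beta>) * real (d v)"
  shows "wp reduce_costs (\<lambda>s'. reachable (k + 1) (snd s' ''cost'') \<and>
    (\<forall>v\<in>V. snd s' ''cost'' v = f v - f \<beta> / real (d \<beta>) * real (d v))) s"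
proof -
  define \<delta> where "\<delta> = f \<beta> / real (d \<beta>)"
  define g where "g v = f v - \<delta> * real (d v)" for v
  let ?P = "RSet ''cost'' (vertex ''i'')
       (RSub (RGet ''cost'' (vertex ''i'')) (RMul (RGet ''delta'' (NConst 0)) (ROfNat (NGet ''deg'' (vertex ''i'')))))"
  let ?J = "\<lambda>k (s'::state). \<forall>i<n. snd s' ''cost'' (vs ! i) = (if i < k then g (vs ! i) else f (vs ! i))"
  \<comment> \<open>Nothing is known about the degree array outside \<open>V\<close>, whereas
    \<open>reachable_step\<close> asks for a bound everywhere; hence the cut-off to 0.\<close>
  have reach: "reachable (k + 1) h" if "\<And>v. v \<in> V \<Longrightarrow> h v = g v" for h
    by (rule reachable_step[where d = "\<lambda>v. if v \<in> V then d v else 0", OF r(1) \<beta>(1)])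
       (use \<beta> d that in \<open>auto simp: g_def \<delta>_def\<close>)
  have "0 \<le> \<delta>" using f[OF \<beta>(1)] by (simp add: \<delta>_def)
  then have "0 \<le> \<delta> * real (d v)" for v by simp
  then have g: "0 \<le> g v" "g v \<le> c v" if "v \<in> V" for v
    using f[OF that] f'[OF that] order_trans[of "g v" "f v" "c v"] by (simp_all add: g_def \<delta>_def)
  have sz_g: "g v \<in> good \<and> sz (g v) \<le> B" if "v \<in> V" for v
    using reachable_sz[OF reach[of g] _ that] g[OF that] r(2) B_large(2) by simp
  \<comment> \<open>The quotient is not one of the costs, so \<open>reachable_sz\<close> does not
    cover it. A single use of \<open>sz_ops\<close> does, at the price of a factor 2.\<close>
  have sz_\<delta>: "\<delta> \<in> good \<and> sz \<delta> \<le> B"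
  proof -
    have 1: "f \<beta> \<in> good" "sz (f \<beta>) \<le> K" using reachable_sz[OF r(1) _ \<beta>(1)] r(2) f[OF \<beta>(1)] by auto
    have 2: "sz (real (d \<beta>)) \<le> 2 * nat_size m"
      using sz_of_nat[of "d \<beta>"] nat_size_mono[OF d[OF \<beta>(1)]] by simp
    have "sz \<delta> \<le> 2 * (sz (f \<beta>) + sz (real (d \<beta>)))"
      unfolding \<delta>_def using sz_ops[OF 1(1) good_of_nat] by blast
    also have "\<dots> \<le> 2 * (K + 2 * nat_size m)"
      using 1(2) 2 by (intro mult_le_mono2 add_le_mono)
    also have "\<dots> \<le> B" using B_large(2) by simp
    finally have "sz \<delta> \<le> B" .
    then show ?thesis using good_ops[OF 1(1) good_of_nat[of "d \<beta>"]] unfolding \<delta>_def by blast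
  qed
  define s0 where "s0 = rset ''delta'' 0 \<delta> s"
  have env0: "env s0" by (rule env_agree[OF env, of "{}" "{''delta''}"]) (auto simp: s0_def agree_off_def)
  have "wp (For ''i'' ''n'' ?P) (?J n) s0"
  proof (rule wp_For[where J = ?J and N = n])
    show "?J 0 (nset ''i'' 0 0 s0)" by (simp add: s0_def f_def)
    fix k s' assume k: "k < n" "?J k s'" "fst s' ''i'' 0 = k"
      and "agree_off (insert ''i'' (nat_writes ?P)) (real_writes ?P) s0 s'"
    then have ag: "agree_off {''i''} {''cost''} s0 s'" by simp
    have env': "env s'" by (rule env_agree[OF env0 ag]) auto
    have d': "fst s' ''deg'' = d" "snd s' ''delta'' 0 = \<delta>"
      using agree_fst[OF ag, of "''deg''"] agree_snd[OF ag, of "''delta''"] by (simp_all add: s0_def d_def)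
    have v: "nval (vertex ''i'') s' = vs ! k" using env' k by (simp add: env_vertex)
    have val: "snd s' ''cost'' (vs ! k) - \<delta> * real (d (vs ! k)) = g (vs ! k)"
      using k(1,2) by (simp add: g_def)
    have idx: "vs ! i = vs ! k \<longleftrightarrow> i = k" if "i < n" for i
      using that k vs(1) n by (simp add: nth_eq_iff_index_eq)
    show "wp ?P (\<lambda>s''. ?J (k + 1) (nset ''i'' 0 (k + 1) s'')) s'"
      using k(1,2) sz_g[OF V_nth[OF k(1)]] val
      by (intro wp_RSet) (auto simp: v d' idx less_Suc_eq)
  qed (use env0 B_bounds in \<open>simp_all add: env_lengths\<close>)
  then have "wp (For ''i'' ''n'' ?P) (\<lambda>s'. reachable (k + 1) (snd s' ''cost'') \<and>
      (\<forall>v\<in>V. snd s' ''cost'' v = g v)) s0"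
  proof (rule wp_mono)
    fix s' assume "?J n s'"
    then have "\<forall>v\<in>V. snd s' ''cost'' v = g v" by (simp add: ball_V_nth)
    with reach show "reachable (k + 1) (snd s' ''cost'') \<and> (\<forall>v\<in>V. snd s' ''cost'' v = g v)" by blast
  qed
  moreover have "rval (RDiv (RGet ''cost'' (scalar ''best'')) (ROfNat (NGet ''deg'' (scalar ''best'')))) s = \<delta>"
    by (simp add: \<delta>_def \<beta>_def d_def f_def)
  ultimately show ?thesis
    unfolding reduce_costs_def s0_def g_def \<delta>_def[symmetric] using sz_\<delta>
    by (intro wp_Seq[of "RSet a i e" for a i e] wp_RSet) simp_all
qed

lemma writes_reduce_costs [simp]: "nat_writes reduce_costs = {''i''}" "real_writes reduce_costs = {''delta'', ''cost''}"
  by (auto simp: reduce_costs_def)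

section \<open>The invariant of the rounds\<close>

definition chosen :: "state \<Rightarrow> nat set" where
  "chosen s = {v \<in> V. fst s ''out'' v = 1}"

definition sparse :: "state \<Rightarrow> bool" where
  "sparse s \<longleftrightarrow> (\<forall>S\<subseteq>alive s. S \<noteq> {} \<longrightarrow> \<not> dense \<epsilon> \<rho> S)"

text \<open>The difference \<open>c v - f v\<close> is what has been subtracted so far. Allowing
  every \<open>S \<subseteq> V\<close> on the left makes the inequality independent of the output,
  which is not yet known during the rounds.\<close>

definition charged :: "(nat \<Rightarrow> real) \<Rightarrow> bool" where
  "charged f \<longleftrightarrow> (\<forall>S S'. S \<subseteq> V \<longrightarrow> solution \<rho> S' \<longrightarrow>
     \<epsilon> * (\<Sum>v\<in>S. c v - f v) \<le> (\<Sum>v\<in>S'. c v - f v))"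

text \<open>The equation for \<open>V\<close> says that each flag is 0 or 1. The last conjunct
  measures progress: every round has deleted a new vertex unless no dense set remains.\<close>

definition run_inv :: "nat \<Rightarrow> state \<Rightarrow> bool" where
  "run_inv k s \<longleftrightarrow> env s \<and> V = alive s \<union> chosen s \<and> reachable k (snd s ''cost'') \<and>
    (\<forall>v\<in>V. 0 \<le> snd s ''cost'' v \<and> snd s ''cost'' v \<le> c v) \<and>
    (\<forall>v\<in>chosen s. snd s ''cost'' v = 0) \<and> charged (snd s ''cost'') \<and>
    (k \<le> card (chosen s) \<or> sparse s)"

text \<open>Both sides are linear in the subtracted amounts, so a round adds \<delta> times the
  inequality of \<open>deg_ratio\<close>.\<close>

lemma charged_step:
  assumes "charged f" and W: "W \<subseteq> V" "dense \<epsilon> \<rho> W" and \<rho>: "0 \<le> \<rho>" and \<delta>: "0 \<le> \<delta>"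
    and g: "\<And>v. v \<in> V \<Longrightarrow> g v = f v - \<delta> * real (deg W v)"
  shows "charged g"
  unfolding charged_def
proof (intro allI impI)
  fix S S' assume S: "S \<subseteq> V" and S': "solution \<rho> S'"
  then have "S' \<subseteq> V" by (simp add: solution_def)
  have sum_g: "(\<Sum>v\<in>X. c v - g v) = (\<Sum>v\<in>X. c v - f v) + \<delta> * (\<Sum>v\<in>X. real (deg W v))" if "X \<subseteq> V" for X
  proof -
    have "(\<Sum>v\<in>X. c v - g v) = (\<Sum>v\<in>X. (c v - f v) + \<delta> * real (deg W v))"
      using that g by (intro sum.cong) auto
    then show ?thesis by (simp only: sum.distrib sum_distrib_left)
  qed
  have "\<epsilon> * (\<Sum>v\<in>S. c v - f v) \<le> (\<Sum>v\<in>S'. c v - f v)"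
    using assms(1) S S' by (simp add: charged_def)
  moreover have "\<delta> * (\<epsilon> * (\<Sum>v\<in>S. real (deg W v))) \<le> \<delta> * (\<Sum>v\<in>S'. real (deg W v))"
    using deg_ratio[OF W \<rho> _ S' S] \<epsilon> \<delta> by (intro mult_left_mono) auto
  ultimately show "\<epsilon> * (\<Sum>v\<in>S. c v - g v) \<le> (\<Sum>v\<in>S'. c v - g v)"
    unfolding sum_g[OF S] sum_g[OF \<open>S' \<subseteq> V\<close>] by (simp add: distrib_left mult.left_commute)
qed

text \<open>If any remaining set were dense, then so would be a densest one, and balancing makes one
  of the tested level sets densest.\<close>

lemma sparse_if_no_heavy_dense:
  assumes ok: "loads_ok (alive s) s" and st: "\<forall>j<m. settled (alive s) s j"
    and nd: "\<forall>v\<in>alive s. \<not> dense \<epsilon> \<rho> (heavy s (fst s ''load'' v))"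
  shows "sparse s"
  unfolding sparse_def
proof (intro allI impI notI)
  fix S assume S: "S \<subseteq> alive s" "S \<noteq> {}" "dense \<epsilon> \<rho> S"
  define L where "L = load (alive s) b (fst s ''x'')"
  have L: "fst s ''load'' v = L v" if "v \<in> V" for v
    using ok that by (simp add: loads_ok_def L_def)
  have "stable (alive s) b (fst s ''x'') L m"
    using st L ends_V unfolding stable_def settled_def by simp
  moreover have "card V \<le> n" "n ^ 3 < b" by (simp_all add: card_V b power3_eq_cube)
  moreover have "alive s \<noteq> {}" using S by blast
  moreover have "fst s ''x'' j \<le> b" if "j < m" for j using ok that by (simp add: loads_ok_def)
  ultimately obtain z where z: "z \<in> alive s"
    and max: "\<And>S. S \<subseteq> alive s \<Longrightarrow> ecount S * card {v \<in> alive s. L z \<le> L v} \<le>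
      ecount {v \<in> alive s. L z \<le> L v} * card S"
    using stable_densest[OF alive_sub, of s n b "fst s ''x''"] unfolding L_def by blast
  have T: "{v \<in> alive s. L z \<le> L v} = heavy s (fst s ''load'' z)"
  proof -
    have "fst s ''load'' v = L v" if "v \<in> alive s" for v using L alive_sub that by blast
    then show ?thesis unfolding heavy_def using z by auto
  qed
  have fin: "finite X" if "X \<subseteq> alive s" for X
    using that alive_sub finite_V by (meson finite_subset)
  have "z \<in> heavy s (fst s ''load'' z)" using z by (simp add: heavy_def)
  then have "0 < card (heavy s (fst s ''load'' z))" "0 < card S"
    using fin[OF heavy_sub] fin[OF S(1)] S(2) by (auto simp: card_gt_0_iff)
  then have "dense \<epsilon> \<rho> (heavy s (fst s ''load'' z))"
    using dense_transfer[OF S(3) max[OF S(1)]] \<epsilon> unfolding T by simp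
  with nd z show False by blast
qed

lemma run_inv_agree:
  assumes "run_inv k s" and ag: "agree_off X {} s s'"
    and X: "X \<inter> {''n'', ''m'', ''b'', ''passes'', ''vertex'', ''end1'', ''end2'', ''out''} = {}"
  shows "run_inv k s'"
proof -
  have "env s'" by (rule env_agree[OF _ ag]) (use assms(1) X in \<open>auto simp: run_inv_def\<close>)
  moreover have "fst s' ''out'' = fst s ''out''" by (rule agree_fst_disjoint[OF ag X]) simp
  moreover have "snd s' = snd s" using ag by (simp add: agree_off_def fun_eq_iff)
  ultimately show ?thesis
    using assms(1) unfolding run_inv_def sparse_def chosen_def alive_def by simp
qed

text \<open>Vertices deleted earlier lie outside \<open>W\<close>, have degree 0 there and keep cost
  0. The selected vertex has positive degree, so it lies in \<open>W\<close>: it is new, and its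
  cost becomes 0.\<close>

lemma wp_reduction:
  assumes inv: "run_inv k s" and k: "k < n" and \<rho>: "0 \<le> \<rho>"
    and D: "dense \<epsilon> \<rho> (heavy s (fst s ''thr'' 0))"
  shows "wp (Seq degrees (Seq find_best (Seq reduce_costs (NSet ''out'' (scalar ''best'') (NConst 1)))))
    (run_inv (k + 1)) s"
proof (rule wp_Seq)
  define W where "W = heavy s (fst s ''thr'' 0)"
  define f where "f = snd s ''cost''"
  have I: "env s" "V = alive s \<union> chosen s" "reachable k f" "\<And>v. v \<in> V \<Longrightarrow> 0 \<le> f v \<and> f v \<le> c v"
    "\<And>v. v \<in> chosen s \<Longrightarrow> f v = 0" "charged f" "k \<le> card (chosen s) \<or> sparse s"
    using inv unfolding run_inv_def f_def by auto
  have WA: "W \<subseteq> alive s" unfolding W_def by (rule heavy_sub)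
  then have WV: "W \<subseteq> V" using alive_sub by blast
  \<comment> \<open>For \<rho> \<ge> 0 a set without edges is not dense.\<close>
  have "0 < ecount W"
  proof (rule ccontr)
    assume "\<not> ?thesis"
    then have "\<rho> * real (card W) < 0" using D by (simp add: dense_def W_def)
    then show False using \<rho> by (meson mult_nonneg_nonneg not_le of_nat_0_le_iff)
  qed
  then obtain v0 where v0: "v0 \<in> V" "v0 \<in> W" "0 < deg W v0" by (rule dense_deg_pos)
  then have "\<not> sparse s" using WA D unfolding sparse_def W_def by blast
  with I(7) have kc: "k \<le> card (chosen s)" by blast
  have deg_m: "deg W v \<le> m" for v using endsum_le[of m "\<lambda>j. 1" 1 "\<lambda>j. 1" W v] by simp
  show "wp degrees (wp (Seq find_best (Seq reduce_costs (NSet ''out'' (scalar ''best'') (NConst 1)))) (run_inv (k + 1))) s"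
  proof (rule wp_conseq[OF wp_degrees[OF I(1)]])
    fix s1 assume d0: "\<forall>v\<in>V. fst s1 ''deg'' v = deg (heavy s (fst s ''thr'' 0)) v"
      and "agree_off (nat_writes degrees) (real_writes degrees) s s1"
    then have ag1: "agree_off {''i'', ''e'', ''deg''} {} s s1" by simp
    have d1: "fst s1 ''deg'' v = deg W v" if "v \<in> V" for v using d0 that by (simp add: W_def)
    have env1: "env s1" by (rule env_agree[OF I(1) ag1]) auto
    have f1: "snd s1 ''cost'' = f" using agree_snd[OF ag1, of "''cost''"] by (simp add: f_def)
    show "wp (Seq find_best (Seq reduce_costs (NSet ''out'' (scalar ''best'') (NConst 1)))) (run_inv (k + 1)) s1"
    proof (rule wp_Seq, rule wp_conseq[OF wp_find_best[OF env1 v0(1)]])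
      show "0 < fst s1 ''deg'' v0" using v0 d1 by simp
      fix s2 :: state
      define \<beta> where "\<beta> = fst s2 ''best'' 0"
      assume best: "fst s2 ''best'' 0 \<in> V \<and> 0 < fst s1 ''deg'' (fst s2 ''best'' 0) \<and>
        (\<forall>v\<in>V. 0 < fst s1 ''deg'' v \<longrightarrow> snd s1 ''cost'' (fst s2 ''best'' 0) * real (fst s1 ''deg'' v) \<le>
          snd s1 ''cost'' v * real (fst s1 ''deg'' (fst s2 ''best'' 0)))"
        and "agree_off (nat_writes find_best) (real_writes find_best) s1 s2"
      then have ag2: "agree_off {''i'', ''best''} {} s1 s2" by simp
      have \<beta>: "\<beta> \<in> V" "0 < deg W \<beta>" using best d1 by (auto simp: \<beta>_def)
      have min: "f \<beta> * real (deg W v) \<le> f v * real (deg W \<beta>)" if "v \<in> V" "0 < deg W v" for v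
        using best that \<beta> by (auto simp: f1 d1 \<beta>_def)
      have env2: "env s2" by (rule env_agree[OF env1 ag2]) auto
      have f2: "snd s2 ''cost'' = f" using agree_snd[OF ag2, of "''cost''"] f1 by simp
      have d2: "fst s2 ''deg'' v = deg W v" if "v \<in> V" for v
        using agree_fst[OF ag2, of "''deg''"] d1[OF that] by simp
      define \<delta> where "\<delta> = f \<beta> / real (deg W \<beta>)"
      have \<delta>: "0 \<le> \<delta>" using I(4)[OF \<beta>(1)] by (simp add: \<delta>_def)
      have pos: "0 \<le> f v - \<delta> * real (deg W v)" if "v \<in> V" for v
      proof (cases "0 < deg W v")
        case True
        with min[OF that] \<beta> show ?thesis by (simp add: \<delta>_def field_simps)
      next
        case False
        then show ?thesis using I(4)[OF that] by simp
      qed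
      have "wp reduce_costs (\<lambda>s'. reachable (k + 1) (snd s' ''cost'') \<and>
        (\<forall>v\<in>V. snd s' ''cost'' v = snd s2 ''cost'' v - snd s2 ''cost'' (fst s2 ''best'' 0) /
          real (fst s2 ''deg'' (fst s2 ''best'' 0)) * real (fst s2 ''deg'' v))) s2"
        by (rule wp_reduce_costs[OF env2])
           (use \<beta> k I(3,4) pos deg_m in \<open>auto simp: f2 d2 \<beta>_def[symmetric] \<delta>_def\<close>)
      then have red: "wp reduce_costs (\<lambda>s'. reachable (k + 1) (snd s' ''cost'') \<and>
        (\<forall>v\<in>V. snd s' ''cost'' v = f v - \<delta> * real (deg W v))) s2"
        by (rule wp_mono) (simp add: f2 d2 \<beta>_def[symmetric] \<beta> \<delta>_def)
      show "wp (Seq reduce_costs (NSet ''out'' (scalar ''best'') (NConst 1))) (run_inv (k + 1)) s2"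
      proof (rule wp_Seq, rule wp_conseq[OF red])
        fix s3 assume c3: "reachable (k + 1) (snd s3 ''cost'') \<and>
            (\<forall>v\<in>V. snd s3 ''cost'' v = f v - \<delta> * real (deg W v))"
          and "agree_off (nat_writes reduce_costs) (real_writes reduce_costs) s2 s3"
        then have ag3: "agree_off {''i''} {''delta'', ''cost''} s2 s3" by simp
        have env3: "env s3" by (rule env_agree[OF env2 ag3]) auto
        have best3: "fst s3 ''best'' 0 = \<beta>" using agree_fst[OF ag3, of "''best''"] by (simp add: \<beta>_def)
        have out3: "fst s3 ''out'' = fst s ''out''"
          using agree_fst[OF ag3, of "''out''"] agree_fst[OF ag2, of "''out''"] agree_fst[OF ag1, of "''out''"]
          by simp
        define s4 where "s4 = nset ''out'' \<beta> 1 s3"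
        have \<beta>W: "\<beta> \<in> W" using \<beta>(2) deg_outside[of \<beta> W] by force
        have env4: "env s4" by (rule env_agree[OF env3, of "{''out''}" "{}"]) (auto simp: s4_def agree_off_def)
        have ch4: "chosen s4 = insert \<beta> (chosen s)" "alive s4 = alive s - {\<beta>}"
          using \<beta> out3 by (auto simp: chosen_def alive_def s4_def)
        have f4: "snd s4 ''cost'' v = f v - \<delta> * real (deg W v)" if "v \<in> V" for v
          using c3 that by (simp add: s4_def)
        have "run_inv (k + 1) s4"
          unfolding run_inv_def
        proof (intro conjI)
          show "env s4" by (rule env4)
          show "V = alive s4 \<union> chosen s4" unfolding ch4 using I(2) \<beta>(1) by blast
          show "reachable (k + 1) (snd s4 ''cost'')" using c3 by (simp add: s4_def)
          show "\<forall>v\<in>V. 0 \<le> snd s4 ''cost'' v \<and> snd s4 ''cost'' v \<le> c v"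
          proof
            fix v assume v: "v \<in> V"
            have "0 \<le> \<delta> * real (deg W v)" using \<delta> by simp
            then show "0 \<le> snd s4 ''cost'' v \<and> snd s4 ''cost'' v \<le> c v"
              using pos[OF v] I(4)[OF v] by (simp add: f4[OF v])
          qed
          show "\<forall>v\<in>chosen s4. snd s4 ''cost'' v = 0"
          proof
            fix v assume "v \<in> chosen s4"
            then consider "v = \<beta>" | "v \<in> chosen s" unfolding ch4 by blast
            then show "snd s4 ''cost'' v = 0"
            proof cases
              case 1
              then show ?thesis using \<beta> by (simp add: f4 \<delta>_def)
            next
              case 2
              then have "v \<in> V" "v \<notin> W" using WA by (auto simp: chosen_def alive_def)
              then show ?thesis using I(5)[OF 2] f4[of v] deg_outside[of v W] by simp
            qed
          qed
          show "charged (snd s4 ''cost'')"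
            by (rule charged_step[OF I(6) WV _ \<rho> \<delta>]) (use D f4 in \<open>auto simp: W_def\<close>)
          have "\<beta> \<notin> chosen s" using \<beta>W WA by (auto simp: chosen_def alive_def)
          moreover have "finite (chosen s)" using finite_V by (simp add: chosen_def)
          ultimately show "k + 1 \<le> card (chosen s4) \<or> sparse s4" unfolding ch4 using kc by simp
        qed
        then show "wp (NSet ''out'' (scalar ''best'') (NConst 1)) (run_inv (k + 1)) s3"
          using best3 B_bounds by (intro wp_NSet) (auto simp: s4_def intro!: nat_size_le_B)
      qed
    qed
  qed
qed

lemma wp_round_step:
  assumes inv: "run_inv k s" and k: "k < n" and \<rho>: "0 \<le> \<rho>"
  shows "wp round_step (run_inv (k + 1)) s"
  unfolding round_step_def
proof (rule wp_Seq, rule wp_conseq[OF wp_init_loads])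
  show "env s" using inv by (simp add: run_inv_def)
  fix s1 assume ok1: "loads_ok (alive s) s1" and "agree_off (nat_writes init_loads) (real_writes init_loads) s s1"
  then have ag1: "agree_off {''i'', ''e'', ''x'', ''load''} {} s s1" by simp
  have inv1: "run_inv k s1" by (rule run_inv_agree[OF inv ag1]) auto
  then have env1: "env s1" by (simp add: run_inv_def)
  have "alive s1 = alive s" by (rule alive_agree[OF ag1]) auto
  then have ok1': "loads_ok (alive s1) s1" using ok1 by simp
  let ?I = "If (NLe (NConst 1) (scalar ''found''))
    (Seq degrees (Seq find_best (Seq reduce_costs (NSet ''out'' (scalar ''best'') (NConst 1))))) Skip"
  show "wp (Seq balance (Seq search ?I)) (run_inv (k + 1)) s1"
  proof (rule wp_Seq, rule wp_conseq[OF wp_balance[OF env1 ok1']])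
    fix s2 assume b2: "loads_ok (alive s1) s2 \<and> (\<forall>j<m. settled (alive s1) s2 j)"
      and "agree_off (nat_writes balance) (real_writes balance) s1 s2"
    then have ag2: "agree_off {''r'', ''e'', ''x'', ''load''} {} s1 s2" by simp
    have inv2: "run_inv k s2" by (rule run_inv_agree[OF inv1 ag2]) auto
    then have env2: "env s2" by (simp add: run_inv_def)
    have al2: "alive s2 = alive s1" by (rule alive_agree[OF ag2]) auto
    show "wp (Seq search ?I) (run_inv (k + 1)) s2"
    proof (rule wp_Seq, rule wp_conseq[OF wp_search[OF env2]])
      fix s3 assume f3: "if fst s3 ''found'' 0 = 0
          then \<forall>v\<in>alive s2. \<not> dense \<epsilon> \<rho> (heavy s2 (fst s2 ''load'' v))
          else dense \<epsilon> \<rho> (heavy s2 (fst s3 ''thr'' 0))"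
        and "agree_off (nat_writes search) (real_writes search) s2 s3"
      then have ag3: "agree_off {''found'', ''thr'', ''t'', ''z'', ''i'', ''e'', ''nv'', ''ne''} {} s2 s3" by simp
      have inv3: "run_inv k s3" by (rule run_inv_agree[OF inv2 ag3]) auto
      have hv3: "heavy s3 = heavy s2" by (rule heavy_agree[OF ag3]) auto
      have al3: "alive s3 = alive s2" by (rule alive_agree[OF ag3]) auto
      show "wp ?I (run_inv (k + 1)) s3"
      proof (rule wp_If, goal_cases)
        case 1
        then have "dense \<epsilon> \<rho> (heavy s3 (fst s3 ''thr'' 0))" using f3 by (simp add: hv3)
        then show ?case by (rule wp_reduction[OF inv3 k \<rho>])
      next
        case 2
        then have "\<forall>v\<in>alive s2. \<not> dense \<epsilon> \<rho> (heavy s2 (fst s2 ''load'' v))" using f3 by simp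
        with b2 have "sparse s2" unfolding al2[symmetric] by (intro sparse_if_no_heavy_dense) auto
        then have "sparse s3" by (simp add: sparse_def al3)
        with inv3 have "run_inv (k + 1) s3" unfolding run_inv_def using reachable_mono by blast
        then show ?case by (rule wp_Skip)
      qed
    qed
  qed
qed

section \<open>Quality of the output\<close>

definition good_output :: "state \<Rightarrow> bool" where
  "good_output s \<longleftrightarrow>
    (\<forall>T\<subseteq>V - chosen s. T \<noteq> {} \<longrightarrow> real (ecount T) \<le> 1 / (1 - 2 * \<epsilon>) * \<rho> * real (card T)) \<and>
    (\<forall>S'. solution \<rho> S' \<longrightarrow> (\<Sum>v\<in>chosen s. c v) \<le> 1 / \<epsilon> * (\<Sum>v\<in>S'. c v))"

text \<open>If all \<open>n\<close> vertices have been deleted, the rest is empty and trivially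
  sparse; so the run ends sparse in any case. The chosen vertices have residual cost 0, so their
  whole cost has been subtracted, while a solution loses at most its own cost because residual costs
  are nonnegative.\<close>

lemma run_inv_good_output:
  assumes "run_inv n s" shows "good_output s"
proof -
  define f where "f = snd s ''cost''"
  have I: "V = alive s \<union> chosen s" "\<And>v. v \<in> V \<Longrightarrow> 0 \<le> f v \<and> f v \<le> c v"
    "\<And>v. v \<in> chosen s \<Longrightarrow> f v = 0" "charged f" "n \<le> card (chosen s) \<or> sparse s"
    using assms unfolding run_inv_def f_def by auto
  have cV: "chosen s \<subseteq> V" by (auto simp: chosen_def)
  have "sparse s"
  proof -
    have "alive s = {}" if "n \<le> card (chosen s)"
    proof -
      have "chosen s = V" using that cV finite_V card_V by (simp add: card_seteq)
      then have "\<forall>v\<in>V. fst s ''out'' v = 1" unfolding chosen_def by blast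
      then show ?thesis by (auto simp: alive_def)
    qed
    then show ?thesis using I(5) by (auto simp: sparse_def)
  qed
  have "real (ecount T) \<le> 1 / (1 - 2 * \<epsilon>) * \<rho> * real (card T)" if "T \<subseteq> V - chosen s" "T \<noteq> {}" for T
  proof -
    have "T \<subseteq> alive s" using that I(1) by blast
    then have "(1 - 2 * \<epsilon>) * real (ecount T) \<le> \<rho> * real (card T)"
      using \<open>sparse s\<close> that(2) by (auto simp: sparse_def dense_def not_less)
    then show ?thesis using \<epsilon> by (simp add: field_simps)
  qed
  moreover have "(\<Sum>v\<in>chosen s. c v) \<le> 1 / \<epsilon> * (\<Sum>v\<in>S'. c v)" if S': "solution \<rho> S'" for S'
  proof -
    have "S' \<subseteq> V" using S' by (simp add: solution_def)
    have "\<epsilon> * (\<Sum>v\<in>chosen s. c v) = \<epsilon> * (\<Sum>v\<in>chosen s. c v - f v)" by (simp add: I(3))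
    also have "\<dots> \<le> (\<Sum>v\<in>S'. c v - f v)" using I(4) S' cV by (simp add: charged_def)
    also have "\<dots> \<le> (\<Sum>v\<in>S'. c v)" using I(2) \<open>S' \<subseteq> V\<close> by (intro sum_mono) auto
    finally show ?thesis using \<epsilon> by (simp add: field_simps)
  qed
  ultimately show ?thesis by (simp add: good_output_def)
qed

text \<open>Densities are nonnegative, so for \<rho> < 0 only \<open>V\<close> itself is a solution.
  The output is then optimal, and the ratio is at least 1.\<close>

lemma wp_delete_all:
  assumes "fst s ''n'' 0 = n" "\<forall>i<n. fst s ''vertex'' i = vs ! i" and \<rho>: "\<rho> < 0"
  shows "wp (For ''i'' ''n'' (NSet ''out'' (vertex ''i'') (NConst 1))) good_output s"
proof -
  let ?P = "NSet ''out'' (vertex ''i'') (NConst 1)"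
  let ?J = "\<lambda>k (s'::state). \<forall>i<k. fst s' ''out'' (vs ! i) = 1"
  have "wp (For ''i'' ''n'' ?P) (?J n) s"
  proof (rule wp_For[where J = ?J and N = n])
    fix k s' assume k: "k < n" "?J k s'" "fst s' ''i'' 0 = k"
      and "agree_off (insert ''i'' (nat_writes ?P)) (real_writes ?P) s s'"
    then have ag: "agree_off {''i'', ''out''} {} s s'" by simp
    have v: "nval (vertex ''i'') s' = vs ! k"
      using k agree_fst[OF ag, of "''vertex''"] assms(2) by (simp add: vertex_def)
    show "wp ?P (\<lambda>s''. ?J (k + 1) (nset ''i'' 0 (k + 1) s'')) s'"
      using k B_bounds by (intro wp_NSet) (auto simp: v less_Suc_eq intro!: nat_size_le_B)
  qed (use assms B_bounds in simp_all)
  then show ?thesis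
  proof (rule wp_mono)
    fix s' assume "?J n s'"
    then have "\<forall>v\<in>V. fst s' ''out'' v = 1" unfolding ball_V_nth .
    then have ch: "chosen s' = V" unfolding chosen_def by blast
    have "(\<Sum>v\<in>V. c v) \<le> 1 / \<epsilon> * (\<Sum>v\<in>S'. c v)" if S': "solution \<rho> S'" for S'
    proof -
      have "V - S' = {}"
      proof (rule ccontr)
        assume ne: "V - S' \<noteq> {}"
        then have "real (ecount (V - S')) \<le> \<rho> * real (card (V - S'))" using S' by (simp add: solution_def)
        moreover have "\<rho> * real (card (V - S')) < 0"
          using \<rho> ne finite_V by (intro mult_neg_pos) (simp_all add: card_gt_0_iff)
        ultimately show False by simp
      qed
      then have "S' = V" using S' by (auto simp: solution_def)
      moreover have "0 \<le> (\<Sum>v\<in>V. c v)" using c_nonneg by (intro sum_nonneg) auto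
      moreover have "1 \<le> 1 / \<epsilon>" using \<epsilon> by simp
      ultimately show ?thesis using mult_right_mono[of 1 "1 / \<epsilon>" "\<Sum>v\<in>V. c v"] by simp
    qed
    then show "good_output s'" by (auto simp: good_output_def ch)
  qed
qed

lemma wp_algorithm:
  assumes s: "fst s ''n'' 0 = n" "fst s ''m'' 0 = m" "\<forall>i<n. fst s ''vertex'' i = vs ! i"
    "\<forall>j<m. fst s ''end1'' j = u j \<and> fst s ''end2'' j = w j" "\<forall>v\<in>V. fst s ''out'' v = 0"
    "snd s ''rho'' 0 = \<rho>" "snd s ''eps'' 0 = \<epsilon>" "\<forall>v\<in>V. snd s ''cost'' v = c v"
  shows "wp algorithm good_output s"
  unfolding algorithm_def
proof (rule wp_If)
  assume "\<not> bval (RLe (ROfNat (NConst 0)) (RGet ''rho'' (NConst 0))) s"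
  then show "wp (For ''i'' ''n'' (NSet ''out'' (vertex ''i'') (NConst 1))) good_output s"
    using s by (intro wp_delete_all) simp_all
next
  assume "bval (RLe (ROfNat (NConst 0)) (RGet ''rho'' (NConst 0))) s"
  then have \<rho>: "0 \<le> \<rho>" using s by simp
  define s' where "s' = nset ''passes'' 0 passes (nset ''b'' 0 b s)"
  have "alive s' = V" "chosen s' = {}" using s by (auto simp: s'_def alive_def chosen_def)
  moreover have "charged (snd s' ''cost'')"
  proof -
    have "(\<Sum>v\<in>S. c v - snd s' ''cost'' v) = 0" if "S \<subseteq> V" for S
      using that s(8) by (intro sum.neutral) (auto simp: s'_def)
    then show ?thesis by (auto simp: charged_def solution_def)
  qed
  moreover have "env s'" using s by (simp add: s'_def env_def)
  moreover have "reachable 0 (snd s' ''cost'')" using s by (intro reachable_0) (simp add: s'_def)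
  ultimately have inv: "run_inv 0 s'" using s c_nonneg by (auto simp: run_inv_def s'_def)
  have "wp (For ''k'' ''n'' round_step) (run_inv n) s'"
  proof (rule wp_For[where J = run_inv and N = n])
    have w: "nat_writes round_step \<subseteq> {''i'', ''e'', ''x'', ''load'', ''r'', ''found'', ''thr'', ''t'', ''z'',
      ''nv'', ''ne'', ''deg'', ''best'', ''out''}"
      by (simp add: round_step_def)
    then show "''k'' \<notin> nat_writes round_step" "''n'' \<notin> nat_writes round_step" by auto
    have run_k: "run_inv k (nset ''k'' 0 v s'') \<longleftrightarrow> run_inv k s''" for k v s''
      by (simp add: run_inv_def env_def sparse_def chosen_def)
    show "run_inv 0 (nset ''k'' 0 0 s')" using inv by (simp add: run_k)
    show "wp round_step (\<lambda>s''. run_inv (k + 1) (nset ''k'' 0 (k + 1) s'')) s''"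
      if "k < n" "run_inv k s''" for k s''
      unfolding run_k by (rule wp_round_step[OF that(2,1) \<rho>])
  qed (use s B_bounds in \<open>simp_all add: s'_def\<close>)
  then have "wp (For ''k'' ''n'' round_step) good_output s'"
    by (rule wp_mono) (rule run_inv_good_output)
  moreover have "b + 1 \<le> B" using B_large by simp
  ultimately show "wp (Seq (NSet ''b'' (NConst 0) (NAdd (NMul (scalar ''n'') (NMul (scalar ''n'') (scalar ''n''))) (NConst 1)))
     (Seq (NSet ''passes'' (NConst 0) (NAdd (NMul (scalar ''n'')
            (NMul (NMul (scalar ''b'') (scalar ''m'')) (NMul (scalar ''b'') (scalar ''m'')))) (NConst 1)))
       (For ''k'' ''n'' round_step))) good_output s"
    using s(1,2) B_bounds nat_size_le_B[of b] nat_size_le_B[of passes]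
    by (intro wp_Seq[of "NSet a i e" for a i e] wp_NSet) (simp_all add: s'_def b passes)
qed

end

section \<open>Sizes of fractions and the two cost models\<close>

lemma bit_size_of_rat:
  "bit_size (real_of_rat r) = 1 + floorlog 2 (nat \<bar>fst (quotient_of r)\<bar>) + floorlog 2 (nat (snd (quotient_of r)))"
proof -
  have "(THE q. real_of_rat r = real_of_rat q) = r" by (rule the_equality) (simp_all add: of_rat_eq_iff)
  then show ?thesis by (simp add: bit_size_def case_prod_beta)
qed

lemma nat_abs_less_power: "\<bar>p\<bar> < 2 ^ a \<Longrightarrow> nat \<bar>p\<bar> < 2 ^ a"
  by (simp add: nat_less_iff)

text \<open>Reduction to lowest terms divides numerator and denominator by their gcd and does not
  enlarge either, so every representation as a fraction bounds the size.\<close>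

lemma bit_size_le:
  assumes x: "x = real_of_int p / real_of_int q" and q: "0 < q" and "\<bar>p\<bar> < 2 ^ a" "q < 2 ^ b"
  shows "bit_size x \<le> 1 + a + b"
proof -
  define r where "r = Rat.Fract p q"
  have r: "x = real_of_rat r" using q by (simp add: x r_def of_rat_rat)
  have quot: "quotient_of r = (p div gcd p q, q div gcd p q)"
    using q by (simp add: r_def quotient_of_Fract Rat.normalize_def Let_def)
  have div_le: "\<bar>i div g\<bar> \<le> \<bar>i\<bar>" if "g dvd i" for i g :: int
  proof (cases "i = 0")
    case False
    moreover have "i div g dvd i" using dvd_div_mult_self[OF that] by (metis dvd_triv_left)
    ultimately show ?thesis by (rule dvd_imp_le_int)
  qed simp
  have "\<bar>p div gcd p q\<bar> \<le> \<bar>p\<bar>" by (rule div_le) simp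
  moreover have "\<bar>q div gcd p q\<bar> \<le> \<bar>q\<bar>" by (rule div_le) simp
  ultimately have "nat \<bar>p div gcd p q\<bar> < 2 ^ a" "nat (q div gcd p q) < 2 ^ b"
    using assms by (auto intro!: nat_abs_less_power simp: nat_less_iff)
  then show ?thesis
    unfolding r bit_size_of_rat quot using floorlog_le_if_less_power by (simp add: add_mono)
qed

lemma bit_size_witness:
  assumes "x \<in> \<rat>"
  obtains p q a b where "x = real_of_int p / real_of_int q" "0 < q" "\<bar>p\<bar> < 2 ^ a" "q < 2 ^ b"
    "bit_size x = 1 + a + b"
proof -
  obtain r where r: "x = real_of_rat r" using assms by (auto simp: Rats_def)
  obtain p q where pq: "quotient_of r = (p, q)" by fastforce
  have q: "0 < q" using quotient_of_denom_pos[OF pq] .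
  show ?thesis
  proof (rule that)
    show "x = real_of_int p / real_of_int q"
      unfolding r quotient_of_div[OF pq] by (simp add: of_rat_divide)
    show "bit_size x = 1 + floorlog 2 (nat \<bar>p\<bar>) + floorlog 2 (nat q)"
      unfolding r bit_size_of_rat pq by simp
    show "\<bar>p\<bar> < 2 ^ floorlog 2 (nat \<bar>p\<bar>)" "q < 2 ^ floorlog 2 (nat q)"
      using less_power_floorlog[of "nat \<bar>p\<bar>"] less_power_floorlog[of "nat q"] q
      by (simp_all add: nat_less_iff)
  qed (rule q)
qed

lemma bit_size_pos: "1 \<le> bit_size x"
  by (simp add: bit_size_def split: prod.split)

lemma abs_mult_less_power: "\<bar>x\<bar> < 2 ^ a \<Longrightarrow> \<bar>y\<bar> < 2 ^ b \<Longrightarrow> \<bar>x * y\<bar> < 2 ^ (a + b)" for x y :: int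
  unfolding abs_mult power_add by (intro mult_strict_mono) auto

lemma bit_size_zero: "bit_size 0 \<le> 2"
  using bit_size_le[of 0 0 1 0 1] by simp

lemma bit_size_of_nat: "bit_size (real k) \<le> 2 * nat_size k"
proof -
  have "bit_size (real k) \<le> 1 + floorlog 2 k + 1"
    by (rule bit_size_le[of _ "int k" 1]) (use less_power_floorlog[of k] in \<open>auto simp flip: of_nat_power\<close>)
  then show ?thesis by (simp add: nat_size_def)
qed

text \<open>The sum is brought to the product of the denominators; its numerator is a sum of two
  products and may need one carry bit.\<close>

lemma bit_size_add:
  assumes "x \<in> \<rat>" "y \<in> \<rat>" shows "bit_size (x + y) \<le> 2 * (bit_size x + bit_size y)"
proof -
  obtain p q a b where x: "x = real_of_int p / real_of_int q" "0 < q" "\<bar>p\<bar> < 2 ^ a" "q < 2 ^ b"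
    "bit_size x = 1 + a + b" by (rule bit_size_witness[OF assms(1)])
  obtain p' q' a' b' where y: "y = real_of_int p' / real_of_int q'" "0 < q'" "\<bar>p'\<bar> < 2 ^ a'" "q' < 2 ^ b'"
    "bit_size y = 1 + a' + b'" by (rule bit_size_witness[OF assms(2)])
  have "bit_size (x + y) \<le> 1 + (a + b + a' + b' + 1) + (b + b')"
  proof (rule bit_size_le)
    show "x + y = real_of_int (p * q' + p' * q) / real_of_int (q * q')"
      using x y by (simp add: field_simps)
    show "0 < q * q'" using x y by simp
    show "q * q' < 2 ^ (b + b')"
      using abs_mult_less_power[of q b q' b'] x y by (simp add: abs_mult)
    have "\<bar>p * q'\<bar> < 2 ^ (a + b')" "\<bar>p' * q\<bar> < 2 ^ (a' + b)"
      using x y by (auto intro!: abs_mult_less_power)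
    moreover have "(2::int) ^ (a + b') \<le> 2 ^ (a + b + a' + b')" "(2::int) ^ (a' + b) \<le> 2 ^ (a + b + a' + b')"
      by (intro power_increasing; simp)+
    ultimately have "\<bar>p * q' + p' * q\<bar> < 2 * 2 ^ (a + b + a' + b')"
      using abs_triangle_ineq[of "p * q'" "p' * q"] by linarith
    then show "\<bar>p * q' + p' * q\<bar> < 2 ^ (a + b + a' + b' + 1)" by simp
  qed
  then show ?thesis using x y by simp
qed

lemma bit_size_uminus: "x \<in> \<rat> \<Longrightarrow> bit_size (- x) \<le> bit_size x"
proof -
  assume "x \<in> \<rat>"
  then obtain p q a b where x: "x = real_of_int p / real_of_int q" "0 < q" "\<bar>p\<bar> < 2 ^ a" "q < 2 ^ b"
    "bit_size x = 1 + a + b" by (rule bit_size_witness)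
  then show ?thesis using bit_size_le[of "- x" "- p" q a b] by simp
qed

lemma bit_size_mult:
  assumes "x \<in> \<rat>" "y \<in> \<rat>" shows "bit_size (x * y) \<le> bit_size x + bit_size y"
proof -
  obtain p q a b where x: "x = real_of_int p / real_of_int q" "0 < q" "\<bar>p\<bar> < 2 ^ a" "q < 2 ^ b"
    "bit_size x = 1 + a + b" by (rule bit_size_witness[OF assms(1)])
  obtain p' q' a' b' where y: "y = real_of_int p' / real_of_int q'" "0 < q'" "\<bar>p'\<bar> < 2 ^ a'" "q' < 2 ^ b'"
    "bit_size y = 1 + a' + b'" by (rule bit_size_witness[OF assms(2)])
  have "bit_size (x * y) \<le> 1 + (a + a') + (b + b')"
  proof (rule bit_size_le)
    show "x * y = real_of_int (p * p') / real_of_int (q * q')" using x y by simp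
    show "0 < q * q'" using x y by simp
    show "q * q' < 2 ^ (b + b')"
      using abs_mult_less_power[of q b q' b'] x y by (simp add: abs_mult)
    show "\<bar>p * p'\<bar> < 2 ^ (a + a')" using x y by (intro abs_mult_less_power)
  qed
  then show ?thesis using x y by simp
qed

text \<open>Numerator and denominator change places, and the sign moves to the new numerator. The
  extra 1 covers \<open>inverse 0 = 0\<close>, where they cannot be exchanged.\<close>

lemma bit_size_inverse:
  assumes "x \<in> \<rat>" shows "bit_size (inverse x) \<le> 1 + bit_size x"
proof -
  obtain p q a b where x: "x = real_of_int p / real_of_int q" "0 < q" "\<bar>p\<bar> < 2 ^ a" "q < 2 ^ b"
    "bit_size x = 1 + a + b" by (rule bit_size_witness[OF assms(1)])
  show ?thesis
  proof (cases "p = 0")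
    case True
    then show ?thesis using x bit_size_zero by simp
  next
    case False
    have "bit_size (inverse x) \<le> 1 + b + a"
    proof (rule bit_size_le)
      show "inverse x = real_of_int (sgn p * q) / real_of_int \<bar>p\<bar>"
        using False by (cases "0 < p") (simp_all add: x(1) sgn_if)
      show "\<bar>sgn p * q\<bar> < 2 ^ b" using x False by (simp add: abs_mult)
    qed (use x False in auto)
    then show ?thesis using x by simp
  qed
qed

lemma bounded_machine_unit: "1 \<le> B \<Longrightarrow> bounded_machine unit_size UNIV B"
  by unfold_locales (simp_all add: unit_size_def nat_size_def)

lemma bounded_machine_bit:
  assumes "1 \<le> B" shows "bounded_machine bit_size \<rat> B"
proof
  fix x y :: real assume xy: "x \<in> \<rat>" "y \<in> \<rat>"
  show "x + y \<in> \<rat> \<and> x - y \<in> \<rat> \<and> x * y \<in> \<rat> \<and> x / y \<in> \<rat>" using xy by simp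
  have "bit_size (x - y) \<le> 2 * (bit_size x + bit_size y)"
    using bit_size_add[of x "- y"] bit_size_uminus[of y] xy by simp
  moreover have "bit_size (x / y) \<le> 2 * (bit_size x + bit_size y)"
    using bit_size_mult[of x "inverse y"] bit_size_inverse[of y] bit_size_pos[of x] xy
    by (simp add: divide_inverse)
  ultimately show "bit_size (x + y) \<le> 2 * (bit_size x + bit_size y) \<and>
      bit_size (x - y) \<le> 2 * (bit_size x + bit_size y) \<and>
      bit_size (x * y) \<le> 2 * (bit_size x + bit_size y) \<and> bit_size (x / y) \<le> 2 * (bit_size x + bit_size y)"
    using bit_size_add[OF xy] bit_size_mult[OF xy] by simp
qed (use assms bit_size_of_nat in auto)

section \<open>From the input size to a bound on the cells\<close>

lemma length_le_sum_list:
  fixes g :: "'a \<Rightarrow> nat"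
  assumes "\<And>x. 1 \<le> g x" shows "length xs \<le> (\<Sum>x\<leftarrow>xs. g x)"
proof (induction xs)
  case (Cons x xs)
  then show ?case using assms[of x] by simp
qed simp

lemma length_le_input_size:
  "length vs \<le> input_size sz vs es c \<rho> \<epsilon>" "length es \<le> input_size sz vs es c \<rho> \<epsilon>"
proof -
  have "length vs \<le> (\<Sum>v\<leftarrow>vs. nat_size v + sz (c v))"
    by (rule length_le_sum_list) (rule trans_le_add1[OF nat_size_pos])
  then show "length vs \<le> input_size sz vs es c \<rho> \<epsilon>" by (simp add: input_size_def)
  have "length es \<le> (\<Sum>(u, v)\<leftarrow>es. nat_size u + nat_size v)"
    by (rule length_le_sum_list) (use nat_size_pos trans_le_add1 in \<open>fastforce simp: case_prod_beta\<close>)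
  then show "length es \<le> input_size sz vs es c \<rho> \<epsilon>" by (simp add: input_size_def)
qed

text \<open>The left sides of the two conditions \<open>B_large\<close> are added, with
  \<open>n\<close> and \<open>m\<close> replaced by the input size, \<open>K\<close> by its
  quadratic bound and \<open>nat_size m\<close> by the input size plus 1.\<close>

definition cells_poly :: "nat poly" where
  "cells_poly = (let X = [:0, 1:]; b = X * (X * X) + 1 in
     X * (b * X * (b * X)) + 1 + b * X + b + X + X + 3 + (2 * (3 + 3 * X + 2 * (X * X)) + 4 * (X + 1)))"

text \<open>The statement is generic in the size measure; both cost models instantiate it with the
  same program and the same polynomial.\<close>

lemma halts_on_input:
  fixes sz :: "real \<Rightarrow> nat" and good :: "real set" and reachable :: "nat \<Rightarrow> (nat \<Rightarrow> real) \<Rightarrow> bool"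
    and vs :: "nat list" and es :: "(nat \<times> nat) list" and c :: "nat \<Rightarrow> real" and \<rho> \<epsilon> :: real
  defines "N \<equiv> input_size sz vs es c \<rho> \<epsilon>"
  assumes G: "graph V E" and P: "presents vs es V E" and c: "\<forall>u\<in>V. 0 \<le> c u" and \<epsilon>: "0 < \<epsilon>" "\<epsilon> < 1 / 2"
    and machine: "\<And>B. 1 \<le> B \<Longrightarrow> bounded_machine sz good B"
    and good: "\<And>v. v \<in> V \<Longrightarrow> c v \<in> good" "\<rho> \<in> good" "\<epsilon> \<in> good" and zero: "sz 0 \<le> 2"
    and K: "K \<le> 3 + 3 * N + 2 * (N * N)"
    and r0: "\<And>f. (\<And>v. v \<in> V \<Longrightarrow> f v = c v) \<Longrightarrow> reachable 0 f"
    and r_mono: "\<And>k f. reachable k f \<Longrightarrow> reachable (k + 1) f"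
    and r_step: "\<And>k f \<beta> d f'. reachable k f \<Longrightarrow> \<beta> \<in> V \<Longrightarrow> 0 < d \<beta> \<Longrightarrow> (\<And>v. d v \<le> length es) \<Longrightarrow>
      (\<And>v. v \<in> V \<Longrightarrow> f' v = f v - f \<beta> / real (d \<beta>) * real (d v)) \<Longrightarrow> reachable (k + 1) f'"
    and r_sz: "\<And>k f v. reachable k f \<Longrightarrow> k \<le> length vs \<Longrightarrow> v \<in> V \<Longrightarrow> 0 \<le> f v \<Longrightarrow> f v \<le> c v \<Longrightarrow>
      f v \<in> good \<and> sz (f v) \<le> K"
  shows "\<exists>s. halts_within sz algorithm (input_state vs es c \<rho> \<epsilon>) (poly (pcompose (time_poly algorithm) cells_poly) N) s \<and>
    (let S = returned_set V s in S \<subseteq> V \<and>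
       density_after_deletion_at_most V E S (1 / (1 - 2 * \<epsilon>) * \<rho>) \<and>
       (\<Sum>u\<in>S. c u) \<le> 1 / \<epsilon> * GraphDD_OPT V E c \<rho>)"
proof -
  define n where "n = length vs"
  define m where "m = length es"
  define b where "b = n * (n * n) + 1"
  define passes where "passes = n * (b * m * (b * m)) + 1"
  define B where "B = poly cells_poly N"
  have vs: "distinct vs" "set vs = V" using P by (auto simp: presents_def)
  have sizes: "nat_size v + sz (c v) \<le> N" if "v \<in> V" for v
    using member_le_sum_list[of "nat_size v + sz (c v)" "map (\<lambda>v. nat_size v + sz (c v)) vs"] that vs
    by (auto simp: N_def input_size_def)
  have e_sizes: "nat_size (fst e) + nat_size (snd e) \<le> N" if "e \<in> set es" for e
    using member_le_sum_list[of "nat_size (fst e) + nat_size (snd e)" "map (\<lambda>(u, v). nat_size u + nat_size v) es"] that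
    by (force simp: N_def input_size_def case_prod_beta)
  have N: "n \<le> N" "m \<le> N" using length_le_input_size by (simp_all add: N_def n_def m_def)
  moreover have "nat_size n \<le> N" "nat_size m \<le> N" "sz \<rho> \<le> N" "sz \<epsilon> \<le> N"
    by (auto simp: N_def input_size_def n_def m_def)
  ultimately have N: "n \<le> N" "m \<le> N" "nat_size n \<le> N" "nat_size m \<le> N" "sz \<rho> \<le> N" "sz \<epsilon> \<le> N"
    by blast+
  define b' where "b' = N * (N * N) + 1"
  have B: "B = N * (b' * N * (b' * N)) + 1 + b' * N + b' + N + N + 3 + (2 * (3 + 3 * N + 2 * (N * N)) + 4 * (N + 1))"
    by (simp add: B_def cells_poly_def b'_def Let_def algebra_simps)
  have bb: "b \<le> b'" unfolding b_def b'_def using N by (intro add_mono mult_mono) auto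
  have bm: "b * m \<le> b' * N" using bb N by (intro mult_mono) auto
  have pp: "passes \<le> N * (b' * N * (b' * N)) + 1"
    unfolding passes_def using mult_le_mono[OF N(1) mult_le_mono[OF bm bm]] by simp
  have BN: "N \<le> B" "2 \<le> B" "1 \<le> B" by (simp_all add: B)
  interpret edge_list V m "\<lambda>j. fst (es ! j)" "\<lambda>j. snd (es ! j)"
    unfolding m_def by (rule edge_list_of_presentation[OF G P])
  interpret bounded_machine sz good B by (rule machine[OF BN(3)])
  interpret instance_run sz good B V m "\<lambda>j. fst (es ! j)" "\<lambda>j. snd (es ! j)" vs c \<rho> \<epsilon> n b passes reachable K
  proof
    show "passes + b * m + b + n + m + 3 \<le> B" using pp bm bb N unfolding B by linarith
    show "2 * K + 4 * nat_size m \<le> B"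
    proof -
      have "2 * K + 4 * nat_size m \<le> 2 * (3 + 3 * N + 2 * (N * N)) + 4 * (N + 1)"
        using K N by (intro add_le_mono mult_le_mono2) auto
      then show ?thesis unfolding B by (rule trans_le_add2)
    qed
    show "reachable (k + 1) f'" if "reachable k f" "\<beta> \<in> V" "0 < d \<beta>" "\<And>v. d v \<le> m"
      "\<And>v. v \<in> V \<Longrightarrow> f' v = f v - f \<beta> / real (d \<beta>) * real (d v)" for k f \<beta> d f'
      using r_step[of k f \<beta> d f'] that by (simp add: m_def)
    show "f v \<in> good \<and> sz (f v) \<le> K" if "reachable k f" "k \<le> n" "v \<in> V" "0 \<le> f v" "f v \<le> c v" for k f v
      using r_sz[of k f v] that by (simp add: n_def)
  qed (use vs \<epsilon> c r0 r_mono in \<open>auto simp: n_def b_def passes_def\<close>)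
  define s0 where "s0 = input_state vs es c \<rho> \<epsilon>"
  have "bnd s0"
    unfolding bnd_def
  proof (intro conjI allI)
    fix a i
    have 1: "nat_size (vs ! i) \<le> B" if "i < n"
      using sizes[of "vs ! i"] that vs BN by (auto simp: n_def)
    have 2: "nat_size (fst (es ! i)) \<le> B \<and> nat_size (snd (es ! i)) \<le> B" if "i < m"
      using e_sizes[of "es ! i"] that BN by (auto simp: m_def)
    show "nat_size (fst s0 a i) \<le> B"
      using 1 2 N BN nat_size_le_B[of 0] by (auto simp: s0_def input_state_def n_def m_def)
    have 3: "c i \<in> good \<and> sz (c i) \<le> B" if "i \<in> V" using sizes[OF that] good(1)[OF that] BN by simp
    \<comment> \<open>All other real cells hold the default value 0, which is why
      \<open>sz 0\<close> needs a bound.\<close>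
    have "snd s0 a i \<in> insert 0 ({\<rho>, \<epsilon>} \<union> c ` V)" using vs by (auto simp: s0_def input_state_def)
    then consider "snd s0 a i = 0" | "snd s0 a i = \<rho>" | "snd s0 a i = \<epsilon>"
      | v where "v \<in> V" "snd s0 a i = c v" by blast
    then have "snd s0 a i \<in> good \<and> sz (snd s0 a i) \<le> B"
    proof cases
      case 1
      then show ?thesis using zero BN good_of_nat[of 0] by simp
    next
      case (4 v)
      then show ?thesis using sizes[OF 4(1)] good(1)[OF 4(1)] BN by simp
    qed (use good N BN in auto)
    then show "snd s0 a i \<in> good" "sz (snd s0 a i) \<le> B" by auto
  qed
  moreover have "wp algorithm good_output s0"
    by (rule wp_algorithm) (auto simp: s0_def input_state_def n_def m_def vs)
  ultimately obtain t s where t: "exec sz algorithm s0 t s" "t \<le> poly (time_poly algorithm) B" "good_output s"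
    unfolding wp_def by blast
  have ec: "ecount T = card (edges_within E T)" for T
    unfolding m_def by (rule ecount_presentation[OF G P])
  have fin: "finite V" using G by (simp add: graph_def)
  have sol: "solution \<rho> S' \<longleftrightarrow> GraphDD_feasible V E \<rho> S'" for S'
    by (simp add: solution_def GraphDD_feasible_def density_after_deletion_iff[OF fin] ec)
  have ret: "returned_set V s = chosen s" by (simp add: returned_set_def chosen_def)
  have "GraphDD_OPT V E c \<rho> \<in> {\<Sum>u\<in>S. c u | S. GraphDD_feasible V E \<rho> S}"
    unfolding GraphDD_OPT_def using GraphDD_OPT_attained[OF fin] by (rule Min_in)
  then obtain S' where "GraphDD_feasible V E \<rho> S'" "GraphDD_OPT V E c \<rho> = (\<Sum>u\<in>S'. c u)" by blast
  then have "(\<Sum>u\<in>chosen s. c u) \<le> 1 / \<epsilon> * GraphDD_OPT V E c \<rho>"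
    using t(3) by (simp add: good_output_def sol)
  moreover have "density_after_deletion_at_most V E (chosen s) (1 / (1 - 2 * \<epsilon>) * \<rho>)"
    using t(3) by (simp add: good_output_def density_after_deletion_iff[OF fin] ec)
  moreover have "halts_within sz algorithm s0 (poly (pcompose (time_poly algorithm) cells_poly) N) s"
    using t(1,2) by (auto simp: halts_within_def poly_pcompose B_def)
  moreover have "chosen s \<subseteq> V" by (auto simp: chosen_def)
  ultimately show ?thesis unfolding Let_def ret s0_def[symmetric] by (intro exI[of _ s]) (simp only: ret simp_thms)
qed

text \<open>Every reduction multiplies a common denominator of the costs by a degree.\<close>

definition common_denominator :: "nat set \<Rightarrow> nat \<Rightarrow> nat \<Rightarrow> nat \<Rightarrow> (nat \<Rightarrow> real) \<Rightarrow> bool" where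
  "common_denominator V a m k f \<longleftrightarrow>
     (\<exists>q::int. 0 < q \<and> q \<le> 2 ^ (a + m * k) \<and> (\<forall>v\<in>V. f v * real_of_int q \<in> \<int>))"

text \<open>The product of the individual denominators is a common one, and the bit sizes add up in
  the exponent.\<close>

lemma common_denominator_0:
  assumes "finite V" "\<forall>v\<in>V. f v \<in> \<rat>"
  shows "common_denominator V (\<Sum>v\<in>V. bit_size (f v)) m 0 f"
proof -
  have "\<exists>q::int. 0 < q \<and> q \<le> 2 ^ bit_size (f v) \<and> f v * real_of_int q \<in> \<int>" if "v \<in> V" for v
  proof -
    have "f v \<in> \<rat>" using assms(2) that by simp
    then obtain p q a b where w: "f v = real_of_int p / real_of_int q" "0 < q" "\<bar>p\<bar> < 2 ^ a" "q < 2 ^ b"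
      "bit_size (f v) = 1 + a + b" by (rule bit_size_witness)
    have "(2::int) ^ b \<le> 2 ^ bit_size (f v)" using w(5) by (intro power_increasing) auto
    then have "q \<le> 2 ^ bit_size (f v)" using w(4) by linarith
    moreover have "f v * real_of_int q \<in> \<int>" using w(1,2) by simp
    ultimately show ?thesis using w(2) by blast
  qed
  then have "\<forall>v\<in>V. \<exists>q::int. 0 < q \<and> q \<le> 2 ^ bit_size (f v) \<and> f v * real_of_int q \<in> \<int>" by blast
  from bchoice[OF this] obtain q :: "nat \<Rightarrow> int" where
    q: "\<forall>v\<in>V. 0 < q v \<and> q v \<le> 2 ^ bit_size (f v) \<and> f v * real_of_int (q v) \<in> \<int>" ..
  have "0 < prod q V" using q by (intro prod_pos) auto
  moreover have "prod q V \<le> (\<Prod>v\<in>V. 2 ^ bit_size (f v))" using q by (intro prod_mono) auto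
  moreover have "f v * real_of_int (prod q V) \<in> \<int>" if "v \<in> V" for v
  proof -
    have "f v * real_of_int (q v) * real_of_int (prod q (V - {v})) \<in> \<int>"
      using q that by (intro Ints_mult[of "f v * real_of_int (q v)"]) auto
    moreover have "prod q V = q v * prod q (V - {v})" using that assms(1) by (simp add: prod.remove)
    ultimately show ?thesis by (simp only: of_int_mult mult.assoc)
  qed
  ultimately show ?thesis
    unfolding common_denominator_def by (intro exI[of _ "prod q V"]) (auto simp: power_sum)
qed

lemma common_denominator_mono:
  assumes "common_denominator V a m k f" shows "common_denominator V a m (k + 1) f"
proof -
  obtain q :: int where q: "0 < q" "q \<le> 2 ^ (a + m * k)" "\<forall>v\<in>V. f v * real_of_int q \<in> \<int>"
    using assms by (auto simp: common_denominator_def)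
  have "(2::int) ^ (a + m * k) \<le> 2 ^ (a + m * (k + 1))" by (intro power_increasing) auto
  with q(2) have "q \<le> 2 ^ (a + m * (k + 1))" by (rule order_trans)
  with q show ?thesis unfolding common_denominator_def by blast
qed

text \<open>Multiplying by \<open>d \<beta>\<close> clears the only new denominator. The estimate of
  a degree by \<open>2 ^ m\<close> is crude, but it adds only \<open>m\<close> to the exponent per
  round.\<close>

lemma common_denominator_step:
  assumes "common_denominator V a m k f" and \<beta>: "\<beta> \<in> V" "0 < d \<beta>" and d: "d \<beta> \<le> m"
    and g: "\<And>v. v \<in> V \<Longrightarrow> g v = f v - f \<beta> / real (d \<beta>) * real (d v)"
  shows "common_denominator V a m (k + 1) g"
proof -
  obtain q :: int where q: "0 < q" "q \<le> 2 ^ (a + m * k)" "\<forall>v\<in>V. f v * real_of_int q \<in> \<int>"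
    using assms(1) by (auto simp: common_denominator_def)
  have "int (d \<beta>) \<le> 2 ^ m"
  proof -
    have "d \<beta> \<le> 2 ^ m" using d less_exp[of m] by linarith
    then have "int (d \<beta>) \<le> int (2 ^ m)" by (simp only: of_nat_le_iff)
    then show ?thesis by simp
  qed

  then have "q * int (d \<beta>) \<le> 2 ^ (a + m * k) * 2 ^ m" using q by (intro mult_mono) auto
  also have "\<dots> = 2 ^ (a + m * (k + 1))" by (simp add: power_add mult.commute)
  finally have "q * int (d \<beta>) \<le> 2 ^ (a + m * (k + 1))" .
  moreover have "g v * real_of_int (q * int (d \<beta>)) \<in> \<int>" if "v \<in> V" for v
  proof -
    have "g v * real_of_int (q * int (d \<beta>)) =
      (f v * real_of_int q) * real (d \<beta>) - (f \<beta> * real_of_int q) * real (d v)"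
      using \<beta> by (simp add: g[OF that] field_simps)
    then show ?thesis using q(3) that \<beta>(1) by (simp add: Ints_diff Ints_mult)
  qed
  ultimately show ?thesis
    unfolding common_denominator_def using q \<beta> by (intro exI[of _ "q * int (d \<beta>)"]) auto
qed

text \<open>A bounded denominator alone does not bound a fraction; the bound \<open>2 ^ a\<close> on
  the value controls the numerator. The exponents are \<open>2 * a + m * k\<close> for the numerator
  and \<open>a + m * k\<close> for the denominator; two strict inequalities and the 1 in
  \<open>bit_size\<close> make up the constant 3.\<close>

lemma common_denominator_bit_size:
  assumes "common_denominator V a m k f" "k \<le> n" "v \<in> V" "0 \<le> f v" "f v \<le> 2 ^ a"
  shows "f v \<in> \<rat> \<and> bit_size (f v) \<le> 3 + 3 * a + 2 * (m * n)"
proof -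
  obtain q :: int where q: "0 < q" "q \<le> 2 ^ (a + m * k)" "\<forall>v\<in>V. f v * real_of_int q \<in> \<int>"
    using assms(1) by (auto simp: common_denominator_def)
  obtain p where p: "f v * real_of_int q = real_of_int p" using q(3) assms(3) by (auto elim: Ints_cases)
  have fv: "f v = real_of_int p / real_of_int q" using p q(1) by (simp add: field_simps)
  have "0 \<le> real_of_int p" using p[symmetric] q(1) assms(4) by simp
  have "real_of_int p \<le> 2 ^ a * real_of_int (2 ^ (a + m * k))"
    unfolding p[symmetric]
  proof (rule mult_mono)
    show "real_of_int q \<le> real_of_int (2 ^ (a + m * k))" using q(2) by (simp only: of_int_le_iff)
  qed (use assms(5) q(1) in auto)
  then have "real_of_int p \<le> real_of_int (2 ^ (a + (a + m * k)))" by (simp add: power_add)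
  then have "p \<le> 2 ^ (a + (a + m * k))" by (simp only: of_int_le_iff)
  have double: "(2::int) ^ l < 2 ^ (l + 1)" for l by simp
  have "\<bar>p\<bar> < 2 ^ (a + (a + m * k) + 1)" "q < 2 ^ (a + m * k + 1)"
    using \<open>0 \<le> real_of_int p\<close> le_less_trans[OF \<open>p \<le> 2 ^ (a + (a + m * k))\<close> double] le_less_trans[OF q(2) double]
    by simp_all
  from bit_size_le[OF fv q(1) this] have "bit_size (f v) \<le> 3 + 3 * a + 2 * (m * k)" by simp
  also have "\<dots> \<le> 3 + 3 * a + 2 * (m * n)" using assms(2) by simp
  finally show ?thesis by (simp add: fv)
qed

theorem theorem1p4:
  shows "\<exists>(P :: com) (p :: nat poly).
    \<forall>(V :: nat set) (E :: nat set set) (c :: nat \<Rightarrow> real) (\<rho> :: real) (\<epsilon> :: real)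
     (vs :: nat list) (es :: (nat \<times> nat) list).
      graph V E \<and> (\<forall>u\<in>V. 0 \<le> c u) \<and> 0 < \<epsilon> \<and> \<epsilon> < 1 / 2 \<and> presents vs es V E \<longrightarrow>
      (\<exists>s. halts_within unit_size P (input_state vs es c \<rho> \<epsilon>)
             (poly p (input_size unit_size vs es c \<rho> \<epsilon>)) s \<and>
           ((\<forall>u\<in>V. c u \<in> \<rat>) \<and> \<rho> \<in> \<rat> \<and> \<epsilon> \<in> \<rat> \<longrightarrow>
             halts_within bit_size P (input_state vs es c \<rho> \<epsilon>)
               (poly p (input_size bit_size vs es c \<rho> \<epsilon>)) s) \<and>
           (let S = returned_set V s in
             S \<subseteq> V \<and>
             density_after_deletion_at_most V E S (1 / (1 - 2 * \<epsilon>) * \<rho>) \<and>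
             (\<Sum>u\<in>S. c u) \<le> 1 / \<epsilon> * GraphDD_OPT V E c \<rho>))"
proof (intro exI[of _ algorithm] exI[of _ "pcompose (time_poly algorithm) cells_poly"] allI impI, elim conjE)
  fix V :: "nat set" and E :: "nat set set" and c :: "nat \<Rightarrow> real" and \<rho> \<epsilon> :: real
    and vs :: "nat list" and es :: "(nat \<times> nat) list"
  assume G: "graph V E" and c: "\<forall>u\<in>V. 0 \<le> c u" and \<epsilon>: "0 < \<epsilon>" "\<epsilon> < 1 / 2" and P: "presents vs es V E"
  let ?p = "pcompose (time_poly algorithm) cells_poly"
  have "\<exists>s. halts_within unit_size algorithm (input_state vs es c \<rho> \<epsilon>)
      (poly ?p (input_size unit_size vs es c \<rho> \<epsilon>)) s \<and>
    (let S = returned_set V s in S \<subseteq> V \<and> density_after_deletion_at_most V E S (1 / (1 - 2 * \<epsilon>) * \<rho>) \<and>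
       (\<Sum>u\<in>S. c u) \<le> 1 / \<epsilon> * GraphDD_OPT V E c \<rho>)"
    \<comment> \<open>Under unit cost all reals have size 1, so nothing has to be known about the
      costs.\<close>
    by (rule halts_on_input[OF G P c \<epsilon> bounded_machine_unit, where reachable = "\<lambda>_ _. True" and K = 1])
       (simp_all add: unit_size_def)
  then obtain s where s: "halts_within unit_size algorithm (input_state vs es c \<rho> \<epsilon>)
      (poly ?p (input_size unit_size vs es c \<rho> \<epsilon>)) s"
    "let S = returned_set V s in S \<subseteq> V \<and> density_after_deletion_at_most V E S (1 / (1 - 2 * \<epsilon>) * \<rho>) \<and>
       (\<Sum>u\<in>S. c u) \<le> 1 / \<epsilon> * GraphDD_OPT V E c \<rho>"
    by blast
  have "halts_within bit_size algorithm (input_state vs es c \<rho> \<epsilon>)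
      (poly ?p (input_size bit_size vs es c \<rho> \<epsilon>)) s"
    if rat: "\<forall>u\<in>V. c u \<in> \<rat>" "\<rho> \<in> \<rat>" "\<epsilon> \<in> \<rat>"
  proof -
    define a where "a = (\<Sum>v\<in>V. bit_size (c v))"
    define N where "N = input_size bit_size vs es c \<rho> \<epsilon>"
    let ?K = "3 + 3 * a + 2 * (length es * length vs)"
    have fin: "finite V" using G by (simp add: graph_def)
    have vs: "distinct vs" "set vs = V" using P by (auto simp: presents_def)
    have "a = (\<Sum>v\<leftarrow>vs. bit_size (c v))" unfolding a_def using vs by (simp add: sum_list_distinct_conv_sum_set)
    also have "\<dots> \<le> (\<Sum>v\<leftarrow>vs. nat_size v + bit_size (c v))" by (rule sum_list_mono) simp
    finally have "a \<le> N" by (simp add: N_def input_size_def)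
    moreover have "length es * length vs \<le> N * N"
      unfolding N_def by (intro mult_mono length_le_input_size) auto
    ultimately have K: "?K \<le> 3 + 3 * N + 2 * (N * N)" by linarith
    \<comment> \<open>The exponent \<open>a\<close> bounds the values too, since bit sizes include
      the numerators and a nonnegative fraction is at most its numerator.\<close>
    have c_le: "c v \<le> 2 ^ a" if "v \<in> V" for v
    proof -
      have "c v \<in> \<rat>" using rat(1) that by simp
      then obtain p q i j where w: "c v = real_of_int p / real_of_int q" "0 < q" "\<bar>p\<bar> < 2 ^ i" "q < 2 ^ j"
        "bit_size (c v) = 1 + i + j" by (rule bit_size_witness)
      have "bit_size (c v) \<le> a" unfolding a_def using fin that by (intro member_le_sum) auto
      then have "(2::real) ^ i \<le> 2 ^ a" using w(5) by (intro power_increasing) auto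
      moreover have "real_of_int \<bar>p\<bar> \<le> real_of_int (2 ^ i)" using w(3) by (simp only: of_int_le_iff)
      moreover have "c v \<le> real_of_int \<bar>p\<bar>"
      proof -
        have "0 \<le> p" using c that w(1,2) by (auto simp: zero_le_divide_iff)
        then have "real_of_int p * 1 \<le> real_of_int p * real_of_int q"
          using w(2) by (intro mult_left_mono) auto
        then show ?thesis using \<open>0 \<le> p\<close> w(1,2) by (simp add: divide_le_eq)
      qed
      ultimately show ?thesis by (simp only: of_int_power of_int_numeral)
    qed
    have "\<exists>s'. halts_within bit_size algorithm (input_state vs es c \<rho> \<epsilon>)
        (poly ?p (input_size bit_size vs es c \<rho> \<epsilon>)) s' \<and>
      (let S = returned_set V s' in S \<subseteq> V \<and> density_after_deletion_at_most V E S (1 / (1 - 2 * \<epsilon>) * \<rho>) \<and>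
       (\<Sum>u\<in>S. c u) \<le> 1 / \<epsilon> * GraphDD_OPT V E c \<rho>)"
    proof (rule halts_on_input[OF G P c \<epsilon> bounded_machine_bit,
        where reachable = "common_denominator V a (length es)" and K = ?K])
      show "bit_size 0 \<le> 2" by (rule bit_size_zero)
      show "?K \<le> 3 + 3 * input_size bit_size vs es c \<rho> \<epsilon> +
          2 * (input_size bit_size vs es c \<rho> \<epsilon> * input_size bit_size vs es c \<rho> \<epsilon>)"
        using K unfolding N_def .
      show "common_denominator V a (length es) 0 f" if "\<And>v. v \<in> V \<Longrightarrow> f v = c v" for f
      proof -
        have "(\<Sum>v\<in>V. bit_size (f v)) = a" unfolding a_def using that by (intro sum.cong) auto
        then show ?thesis using common_denominator_0[OF fin, of f "length es"] rat(1) that by simp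
      qed
      show "common_denominator V a (length es) (k + 1) f" if "common_denominator V a (length es) k f" for k f
        by (rule common_denominator_mono[OF that])
      show "common_denominator V a (length es) (k + 1) f'"
        if "common_denominator V a (length es) k f" "\<beta> \<in> V" "0 < d \<beta>" "\<And>v. d v \<le> length es"
          "\<And>v. v \<in> V \<Longrightarrow> f' v = f v - f \<beta> / real (d \<beta>) * real (d v)" for k f \<beta> d f'
        by (rule common_denominator_step[OF that])
      show "f v \<in> \<rat> \<and> bit_size (f v) \<le> ?K"
        if "common_denominator V a (length es) k f" "k \<le> length vs" "v \<in> V" "0 \<le> f v" "f v \<le> c v" for k f v
        using common_denominator_bit_size[OF that(1-4)] c_le[OF that(3)] that(5) by simp
    qed (use rat in auto)
    then obtain s' where s': "halts_within bit_size algorithm (input_state vs es c \<rho> \<epsilon>)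
        (poly ?p (input_size bit_size vs es c \<rho> \<epsilon>)) s'" by blast
    \<comment> \<open>The two models yield separate runs; as the size measure does not affect the
      result, they end in the same state.\<close>
    moreover have "s' = s" using s(1) s' exec_deterministic unfolding halts_within_def by blast
    ultimately show ?thesis by simp
  qed
  with s show "\<exists>s. halts_within unit_size algorithm (input_state vs es c \<rho> \<epsilon>)
             (poly ?p (input_size unit_size vs es c \<rho> \<epsilon>)) s \<and>
           ((\<forall>u\<in>V. c u \<in> \<rat>) \<and> \<rho> \<in> \<rat> \<and> \<epsilon> \<in> \<rat> \<longrightarrow>
             halts_within bit_size algorithm (input_state vs es c \<rho> \<epsilon>)
               (poly ?p (input_size bit_size vs es c \<rho> \<epsilon>)) s) \<and>
           (let S = returned_set V s in
             S \<subseteq> V \<and>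
             density_after_deletion_at_most V E S (1 / (1 - 2 * \<epsilon>) * \<rho>) \<and>
             (\<Sum>u\<in>S. c u) \<le> 1 / \<epsilon> * GraphDD_OPT V E c \<rho>)"
    by blast
qed

end
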